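(* Let $(M,\mathcal B,\mu,\Phi_t)$ be a system with pure point spectrum, $C^\infty$ Koopman eigenfunctions and $m$ basic frequencies as described in the context, let $F:M\to\mathbb R^d$ be a smooth embedding with induced metric $g$, and let $g_s$, $s=1,2,\dots$, be the Riemannian metrics associated with $s$ delays. Then the limit $\bar g=\lim_{s\to\infty}g_s$ exists and is the smooth Riemannian metric $$\bar g=\sum_{i,j=1}^m B_{ij}\,\beta_i\otimes\beta_j,$$ where $\beta_1,\dots,\beta_m$ are the smooth dual vector fields (1-forms) to the vector fields $v_i$, defined uniquely through $\beta_i(v_j)=\delta_{ij}$, and $B_{ij}=\int_M g(v_i,v_j)\,d\mu$. Moreover, $\bar g$ has the following properties: (i) It is invariant under each of the flows $\Phi_{i,t}$ generated by $v_i$, i.e. every $\Phi_{i,t}$ is an isometry of $\bar g$. (ii) It is flat. (iii) Its volume form has uniform density relative to the invariant measure: $\mathrm{dvol}_{\bar g}/d\mu=\Gamma$, where $\Gamma$ is a positive constant.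
   Context: Setting. $M$ is a closed, connected, compact, orientable $C^\infty$ manifold of dimension $m$ with Borel $\sigma$-algebra $\mathcal B$; $\Phi_t:M\to M$, $t\in\mathbb R$, is a smooth flow with generating smooth vector field $v$; $\mu$ is a $\Phi_t$-invariant Borel probability measure with smooth positive density in local coordinates. For a fixed sampling interval $T>0$ the discrete-time system $\hat\Phi_n=\Phi_{nT}$, $n\in\mathbb Z$, is ergodic for $\mu$. $\tilde v$ is the skew-adjoint generator of the Koopman group $U_tf=f\circ\Phi_t$ on $L^2(M,\mu)$. Pure point spectrum. There are rationally independent real numbers $\Omega_1,\dots,\Omega_m$ (basic frequencies) and $C^\infty$ eigenfunctions $\zeta_i$ with $\tilde v(\zeta_i)=\mathrm i\,\Omega_i\zeta_i$, $|\zeta_i|=1$, such that $z_k=\prod_{i=1}^m\zeta_i^{k_i}$, $k\in\mathbb Z^m$, form an orthonormal basis of $L^2(M,\mu)$. The map $(\zeta_1,\dots,\zeta_m):M\to\mathbb T^m$ is a $C^\infty$ diffeomorphism, giving angle coordinates $\theta^i$ with $\zeta_i=e^{\mathrm i\theta^i}$ and globally defined vector fields $\frac{\partial}{\partial\theta^i}$; set $v_i=\Omega_i\frac{\partial}{\partial\theta^i}$, so that $v=\sum_iv_i$. Metrics. $g(u_1,u_2)=F_*u_1\cdot F_*u_2$ is the metric induced by $F$. The delay-coordinate map with $s$ delays is $F_s:M\to\mathbb R^{sd}$, $F_s(a)=(F(a),F(\hat\Phi_{-1}(a)),\dots,F(\hat\Phi_{-s+1}(a)))$, with $\mathbb R^{sd}$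 equipped with the inner product $\langle X,Y\rangle_s=\frac1s\sum_{k=0}^{s-1}\langle x_k,y_k\rangle$ for $X=(x_0,\dots,x_{s-1})$, $Y=(y_0,\dots,y_{s-1})$, $x_k,y_k\in\mathbb R^d$. The induced metric is $$g_s(u_1,u_2)=\frac1s\sum_{k=0}^{s-1}g(\hat\Phi_{-k*}u_1,\hat\Phi_{-k*}u_2),\qquad u_1,u_2\in T_aM,$$ and $\lim_{s\to\infty}g_s$ is taken pointwise on pairs of tangent vectors. *)

theory Defs
  imports "HOL-Probability.Probability"
begin

section \<open>Smooth maps between Euclidean spaces and between manifolds\<close>

primrec Ck_on :: "nat \<Rightarrow> 'a::real_normed_vector set \<Rightarrow> ('a \<Rightarrow> 'b::real_normed_vector) \<Rightarrow> bool" where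
  "Ck_on 0 S f \<longleftrightarrow> continuous_on S f"
| "Ck_on (Suc n) S f \<longleftrightarrow>
     (\<forall>x\<in>S. f differentiable (at x)) \<and> (\<forall>v. Ck_on n S (\<lambda>x. frechet_derivative f (at x) v))"

text \<open>Only meant for open \<open>S\<close>.\<close>
definition smooth_on :: "'a::real_normed_vector set \<Rightarrow> ('a \<Rightarrow> 'b::real_normed_vector) \<Rightarrow> bool" where
  "smooth_on S f \<longleftrightarrow> (\<forall>n. Ck_on n S f)"

text \<open>A chart is a pair of its domain and its coordinate map; the inverse coordinate map is
  \<open>inv_into U \<phi>\<close>. Charts take values in open subsets of the model space, so manifolds have no
  boundary. Atlases need not be maximal.\<close>
type_synonym ('a, 'e) atlas = "('a set \<times> ('a \<Rightarrow> 'e)) set"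

definition smooth_atlas :: "'a::topological_space set \<Rightarrow> ('a, 'e::euclidean_space) atlas \<Rightarrow> bool" where
  "smooth_atlas M A \<longleftrightarrow>
     (\<Union>(U, \<phi>)\<in>A. U) = M \<and>
     (\<forall>(U, \<phi>)\<in>A. openin (top_of_set M) U \<and> open (\<phi> ` U) \<and>
        homeomorphism U (\<phi> ` U) \<phi> (inv_into U \<phi>)) \<and>
     (\<forall>(U, \<phi>)\<in>A. \<forall>(V, \<psi>)\<in>A. smooth_on (\<phi> ` (U \<inter> V)) (\<psi> \<circ> inv_into U \<phi>))"

definition oriented_atlas :: "('a, real ^ 'm) atlas \<Rightarrow> bool" where
  "oriented_atlas A \<longleftrightarrow>
     (\<forall>(U, \<phi>)\<in>A. \<forall>(V, \<psi>)\<in>A. \<forall>x\<in>\<phi> ` (U \<inter> V).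
        det (matrix (frechet_derivative (\<psi> \<circ> inv_into U \<phi>) (at x))) > 0)"

definition orientable :: "'a::topological_space set \<Rightarrow> ('a, real ^ 'm) atlas \<Rightarrow> bool" where
  "orientable M A \<longleftrightarrow> (\<exists>B. smooth_atlas M B \<and> smooth_atlas M (A \<union> B) \<and> oriented_atlas B)"

definition eucl_atlas :: "('e, 'e) atlas" where
  "eucl_atlas = {(UNIV, \<lambda>x. x)}"

definition prod_atlas :: "('a, 'e) atlas \<Rightarrow> ('b, 'f) atlas \<Rightarrow> ('a \<times> 'b, 'e \<times> 'f) atlas" where
  "prod_atlas A B = {(U \<times> V, map_prod \<phi> \<psi>) | U \<phi> V \<psi>. (U, \<phi>) \<in> A \<and> (V, \<psi>) \<in> B}"

text \<open>Smoothness of \<open>f\<close> on an open subset \<open>S\<close> of the manifold with atlas \<open>A\<close>.\<close>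
definition smooth_map_on ::
  "('a::topological_space, 'e::euclidean_space) atlas \<Rightarrow> ('b::topological_space, 'f::euclidean_space) atlas
    \<Rightarrow> 'a set \<Rightarrow> ('a \<Rightarrow> 'b) \<Rightarrow> bool" where
  "smooth_map_on A B S f \<longleftrightarrow>
     continuous_on S f \<and>
     (\<forall>(U, \<phi>)\<in>A. \<forall>(V, \<psi>)\<in>B.
        smooth_on (\<phi> ` (U \<inter> S \<inter> f -` V)) (\<psi> \<circ> f \<circ> inv_into U \<phi>))"

definition diffeomorphism ::
  "('a::topological_space, 'e::euclidean_space) atlas \<Rightarrow> ('b::topological_space, 'f::euclidean_space) atlas
    \<Rightarrow> 'a set \<Rightarrow> 'b set \<Rightarrow> ('a \<Rightarrow> 'b) \<Rightarrow> bool" where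
  "diffeomorphism A B M N f \<longleftrightarrow>
     bij_betw f M N \<and> smooth_map_on A B M f \<and> smooth_map_on B A N (inv_into M f)"

text \<open>From here on manifolds occupy a whole type. This is the space of smooth functions on such
  a manifold, with values in a Euclidean space.\<close>
definition smooth_fun ::
  "('a::topological_space, 'e::euclidean_space) atlas \<Rightarrow> ('a \<Rightarrow> 'f::euclidean_space) \<Rightarrow> bool" where
  "smooth_fun A f \<longleftrightarrow> smooth_map_on A eucl_atlas UNIV f"

section \<open>The torus\<close>

definition torus :: "(complex ^ 'm) set" where
  "torus = {z. \<forall>i. norm (z $ i) = 1}"

definition torus_exp :: "real ^ 'm \<Rightarrow> complex ^ 'm" where
  "torus_exp x = (\<chi> i. cis (x $ i))"

definition torus_box :: "real ^ 'm \<Rightarrow> (real ^ 'm) set" where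
  "torus_box b = {x. \<forall>i. b $ i - pi < x $ i \<and> x $ i < b $ i + pi}"

text \<open>The charts are the angle coordinates, i.e. the inverses of \<open>torus_exp\<close> on open cubes of
  side \<open>2 * pi\<close>.\<close>
definition torus_atlas :: "(complex ^ 'm, real ^ 'm) atlas" where
  "torus_atlas = {(torus_exp ` torus_box b, inv_into (torus_box b) torus_exp) | b. True}"

section \<open>Tangent vectors, vector fields and flows\<close>

text \<open>A tangent vector at \<open>a\<close> is the derivation \<open>f \<mapsto> (f \<circ> c)'(0)\<close> of the smooth functions given by
  a smooth curve \<open>c\<close> with \<open>c 0 = a\<close>. Tangent vectors are set to \<open>0\<close> on nonsmooth functions, so that
  equality of tangent vectors is equality of functionals; their vector space operations are pointwise.\<close>
type_synonym 'a tvec = "('a \<Rightarrow> real) \<Rightarrow> real"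

definition velocity ::
  "('a::topological_space, 'e::euclidean_space) atlas \<Rightarrow> (real \<Rightarrow> 'a) \<Rightarrow> 'a tvec" where
  "velocity A c = (\<lambda>f. if smooth_fun A f then deriv (\<lambda>t. f (c t)) 0 else 0)"

definition tangent_space ::
  "('a::topological_space, 'e::euclidean_space) atlas \<Rightarrow> 'a \<Rightarrow> 'a tvec set" where
  "tangent_space A a =
     {velocity A c | c \<epsilon>. \<epsilon> > 0 \<and> c 0 = a \<and> smooth_map_on eucl_atlas A {-\<epsilon><..<\<epsilon>} c}"

definition pushforward ::
  "('a::topological_space, 'e::euclidean_space) atlas \<Rightarrow> ('a \<Rightarrow> 'a) \<Rightarrow> 'a tvec \<Rightarrow> 'a tvec" where
  "pushforward A h u = (\<lambda>f. if smooth_fun A f then u (f \<circ> h) else 0)"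

text \<open>The pushforward along a map into \<open>real ^ 'd\<close>, tangent spaces of the latter being identified
  with \<open>real ^ 'd\<close>.\<close>
definition pushforward_eucl :: "('a \<Rightarrow> real ^ 'd) \<Rightarrow> 'a tvec \<Rightarrow> real ^ 'd" where
  "pushforward_eucl F u = (\<chi> i. u (\<lambda>x. F x $ i))"

definition smooth_embedding ::
  "('a::topological_space, 'e::euclidean_space) atlas \<Rightarrow> ('a \<Rightarrow> real ^ 'd) \<Rightarrow> bool" where
  "smooth_embedding A F \<longleftrightarrow>
     smooth_fun A F \<and>
     (\<forall>a. inj_on (pushforward_eucl F) (tangent_space A a)) \<and>
     homeomorphism UNIV (range F) F (inv F)"

definition smooth_vector_field ::
  "('a::topological_space, 'e::euclidean_space) atlas \<Rightarrow> ('a \<Rightarrow> 'a tvec) \<Rightarrow> bool" where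
  "smooth_vector_field A X \<longleftrightarrow>
     (\<forall>a. X a \<in> tangent_space A a) \<and> (\<forall>f. smooth_fun A f \<longrightarrow> smooth_fun A (\<lambda>a. X a f))"

definition lie_bracket :: "('a \<Rightarrow> 'a tvec) \<Rightarrow> ('a \<Rightarrow> 'a tvec) \<Rightarrow> 'a \<Rightarrow> 'a tvec" where
  "lie_bracket X Y = (\<lambda>a f. X a (\<lambda>b. Y b f) - Y a (\<lambda>b. X b f))"

definition smooth_flow ::
  "('a::topological_space, 'e::euclidean_space) atlas \<Rightarrow> (real \<Rightarrow> 'a \<Rightarrow> 'a) \<Rightarrow> bool" where
  "smooth_flow A \<Psi> \<longleftrightarrow>
     (\<forall>a. \<Psi> 0 a = a) \<and> (\<forall>s t a. \<Psi> (s + t) a = \<Psi> s (\<Psi> t a)) \<and>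
     smooth_map_on (prod_atlas eucl_atlas A) A UNIV (\<lambda>(t, a). \<Psi> t a)"

definition generates ::
  "('a::topological_space, 'e::euclidean_space) atlas \<Rightarrow> ('a \<Rightarrow> 'a tvec) \<Rightarrow> (real \<Rightarrow> 'a \<Rightarrow> 'a) \<Rightarrow> bool" where
  "generates A X \<Psi> \<longleftrightarrow> (\<forall>a. X a = velocity A (\<lambda>t. \<Psi> t a))"

definition coord_vec ::
  "('a::topological_space, real ^ 'm) atlas \<Rightarrow> 'a set \<Rightarrow> ('a \<Rightarrow> real ^ 'm) \<Rightarrow> 'm \<Rightarrow> 'a \<Rightarrow> 'a tvec" where
  "coord_vec A U \<phi> i a = velocity A (\<lambda>t. inv_into U \<phi> (\<phi> a + t *\<^sub>R axis i 1))"

section \<open>One-forms, Riemannian metrics, curvature and volume\<close>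

definition linear_tangent ::
  "('a::topological_space, 'e::euclidean_space) atlas \<Rightarrow> 'a \<Rightarrow> ('a tvec \<Rightarrow> real) \<Rightarrow> bool" where
  "linear_tangent A a l \<longleftrightarrow>
     (\<forall>u\<in>tangent_space A a. \<forall>w\<in>tangent_space A a. \<forall>p q.
        l (\<lambda>f. p * u f + q * w f) = p * l u + q * l w)"

definition one_form ::
  "('a::topological_space, 'e::euclidean_space) atlas \<Rightarrow> ('a \<Rightarrow> 'a tvec \<Rightarrow> real) \<Rightarrow> bool" where
  "one_form A \<beta> \<longleftrightarrow> (\<forall>a. linear_tangent A a (\<beta> a))"

definition smooth_one_form ::
  "('a::topological_space, 'e::euclidean_space) atlas \<Rightarrow> ('a \<Rightarrow> 'a tvec \<Rightarrow> real) \<Rightarrow> bool" where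
  "smooth_one_form A \<beta> \<longleftrightarrow>
     one_form A \<beta> \<and> (\<forall>X. smooth_vector_field A X \<longrightarrow> smooth_fun A (\<lambda>a. \<beta> a (X a)))"

type_synonym 'a metric_tensor = "'a \<Rightarrow> 'a tvec \<Rightarrow> 'a tvec \<Rightarrow> real"

definition riemannian_metric ::
  "('a::topological_space, 'e::euclidean_space) atlas \<Rightarrow> 'a metric_tensor \<Rightarrow> bool" where
  "riemannian_metric A g \<longleftrightarrow>
     (\<forall>a. \<forall>u\<in>tangent_space A a.
        linear_tangent A a (g a u) \<and>
        (\<forall>w\<in>tangent_space A a. g a u w = g a w u) \<and>
        (u \<noteq> (\<lambda>f. 0) \<longrightarrow> g a u u > 0)) \<and>
     (\<forall>X Y. smooth_vector_field A X \<and> smooth_vector_field A Y \<longrightarrow> smooth_fun A (\<lambda>a. g a (X a) (Y a)))"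

definition isometry ::
  "('a::topological_space, 'e::euclidean_space) atlas \<Rightarrow> 'a metric_tensor \<Rightarrow> ('a \<Rightarrow> 'a) \<Rightarrow> bool" where
  "isometry A g h \<longleftrightarrow>
     diffeomorphism A A UNIV UNIV h \<and>
     (\<forall>a. \<forall>u\<in>tangent_space A a. \<forall>w\<in>tangent_space A a.
        g (h a) (pushforward A h u) (pushforward A h w) = g a u w)"

definition levi_civita ::
  "('a::topological_space, 'e::euclidean_space) atlas \<Rightarrow> 'a metric_tensor
    \<Rightarrow> (('a \<Rightarrow> 'a tvec) \<Rightarrow> ('a \<Rightarrow> 'a tvec) \<Rightarrow> ('a \<Rightarrow> 'a tvec)) \<Rightarrow> bool" where
  "levi_civita A g D \<longleftrightarrow>
     (\<forall>X Y Z h. smooth_vector_field A X \<and> smooth_vector_field A Y \<and> smooth_vector_field A Z \<and>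
        smooth_fun A h \<longrightarrow>
        smooth_vector_field A (D X Y) \<and>
        D (\<lambda>a f. X a f + Y a f) Z = (\<lambda>a f. D X Z a f + D Y Z a f) \<and>
        D (\<lambda>a f. h a * X a f) Y = (\<lambda>a f. h a * D X Y a f) \<and>
        D X (\<lambda>a f. Y a f + Z a f) = (\<lambda>a f. D X Y a f + D X Z a f) \<and>
        D X (\<lambda>a f. h a * Y a f) = (\<lambda>a f. X a h * Y a f + h a * D X Y a f) \<and>
        (\<lambda>a f. D X Y a f - D Y X a f) = lie_bracket X Y \<and>
        (\<forall>a. X a (\<lambda>b. g b (Y b) (Z b)) = g a (D X Y a) (Z a) + g a (Y a) (D X Z a)))"

text \<open>Vanishing of the Riemann curvature tensor. A Riemannian metric has exactly one
  Levi-Civita connection on smooth vector fields, so it does not matter how \<open>D\<close> is quantified.\<close>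
definition flat_metric ::
  "('a::topological_space, 'e::euclidean_space) atlas \<Rightarrow> 'a metric_tensor \<Rightarrow> bool" where
  "flat_metric A g \<longleftrightarrow>
     (\<exists>D. levi_civita A g D \<and>
        (\<forall>X Y Z. smooth_vector_field A X \<and> smooth_vector_field A Y \<and> smooth_vector_field A Z \<longrightarrow>
           (\<forall>a f. D X (D Y Z) a f - D Y (D X Z) a f - D (lie_bracket X Y) Z a f = 0)))"

text \<open>The charts cover the manifold, so these local expressions determine the measure \<open>\<nu>\<close>.\<close>
definition riemannian_volume ::
  "('a::topological_space, real ^ 'm) atlas \<Rightarrow> 'a metric_tensor \<Rightarrow> 'a measure \<Rightarrow> bool" where
  "riemannian_volume A g \<nu> \<longleftrightarrow>
     sets \<nu> = sets borel \<and>
     (\<forall>(U, \<phi>)\<in>A. \<forall>E\<in>sets borel. E \<subseteq> U \<longrightarrow>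
        emeasure \<nu> E = (\<integral>\<^sup>+x\<in>\<phi> ` E.
          ennreal (sqrt (det (\<chi> i j. let a = inv_into U \<phi> x in
            g a (coord_vec A U \<phi> i a) (coord_vec A U \<phi> j a)))) \<partial>lborel))"

definition smooth_positive_density ::
  "('a::topological_space, 'e::euclidean_space) atlas \<Rightarrow> 'a measure \<Rightarrow> bool" where
  "smooth_positive_density A \<mu> \<longleftrightarrow>
     (\<forall>(U, \<phi>)\<in>A. \<exists>\<rho>. smooth_on (\<phi> ` U) \<rho> \<and> (\<forall>x\<in>\<phi> ` U. \<rho> x > (0::real)) \<and>
        (\<forall>E\<in>sets borel. E \<subseteq> U \<longrightarrow> emeasure \<mu> E = (\<integral>\<^sup>+x\<in>\<phi> ` E. ennreal (\<rho> x) \<partial>lborel)))"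

section \<open>Ergodicity, Koopman generator and point spectrum\<close>

definition measure_preserving :: "'a measure \<Rightarrow> ('a \<Rightarrow> 'a) \<Rightarrow> bool" where
  "measure_preserving \<mu> S \<longleftrightarrow> S \<in> measurable \<mu> \<mu> \<and> distr \<mu> \<mu> S = \<mu>"

definition ergodic :: "'a measure \<Rightarrow> ('a \<Rightarrow> 'a) \<Rightarrow> bool" where
  "ergodic \<mu> S \<longleftrightarrow>
     measure_preserving \<mu> S \<and>
     (\<forall>E\<in>sets \<mu>. S -` E \<inter> space \<mu> = E \<longrightarrow> measure \<mu> E = 0 \<or> measure \<mu> E = 1)"

definition L2 :: "'a measure \<Rightarrow> ('a \<Rightarrow> complex) \<Rightarrow> bool" where
  "L2 \<mu> f \<longleftrightarrow> f \<in> borel_measurable \<mu> \<and> integrable \<mu> (\<lambda>x. (norm (f x))\<^sup>2)"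

text \<open>\<open>f\<close> is in the domain of the generator of the unitary group \<open>f \<mapsto> f \<circ> \<Phi> t\<close> on the Hilbert
  space of square-integrable functions, and is mapped to \<open>h\<close>.\<close>
definition koopman_generator ::
  "'a measure \<Rightarrow> (real \<Rightarrow> 'a \<Rightarrow> 'a) \<Rightarrow> ('a \<Rightarrow> complex) \<Rightarrow> ('a \<Rightarrow> complex) \<Rightarrow> bool" where
  "koopman_generator \<mu> \<Phi> f h \<longleftrightarrow>
     L2 \<mu> f \<and> L2 \<mu> h \<and>
     ((\<lambda>t. LINT x|\<mu>. (norm ((f (\<Phi> t x) - f x) /\<^sub>R t - h x))\<^sup>2) \<longlongrightarrow> 0) (at 0)"

definition orthonormal_basis_L2 :: "'a measure \<Rightarrow> ('k \<Rightarrow> 'a \<Rightarrow> complex) \<Rightarrow> bool" where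
  "orthonormal_basis_L2 \<mu> z \<longleftrightarrow>
     (\<forall>k. L2 \<mu> (z k)) \<and>
     (\<forall>k l. (LINT x|\<mu>. cnj (z k x) * z l x) = (if k = l then 1 else 0)) \<and>
     (\<forall>f. L2 \<mu> f \<longrightarrow> (\<forall>\<epsilon>>0. \<exists>K c. finite K \<and>
        (LINT x|\<mu>. (norm (f x - (\<Sum>k\<in>K. c k * z k x)))\<^sup>2) < \<epsilon>))"

definition rationally_independent :: "('m::finite \<Rightarrow> real) \<Rightarrow> bool" where
  "rationally_independent \<Omega> \<longleftrightarrow>
     (\<forall>q :: 'm \<Rightarrow> rat. (\<Sum>i\<in>UNIV. of_rat (q i) * \<Omega> i) = 0 \<longrightarrow> (\<forall>i. q i = 0))"

definition torus_map :: "('m::finite \<Rightarrow> 'a \<Rightarrow> complex) \<Rightarrow> 'a \<Rightarrow> complex ^ 'm" where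
  "torus_map \<zeta> x = (\<chi> i. \<zeta> i x)"

text \<open>\<open>\<partial>/\<partial>\<theta>\<^sup>i\<close> for the angle coordinates \<open>\<zeta> j = exp (\<i> \<theta>\<^sup>j)\<close>: the velocity of the curve along which the
  \<open>i\<close>-th angle increases at unit speed and the other angles are constant.\<close>
definition angle_field ::
  "('a::topological_space, 'e::euclidean_space) atlas \<Rightarrow> ('m::finite \<Rightarrow> 'a \<Rightarrow> complex) \<Rightarrow> 'm \<Rightarrow> 'a \<Rightarrow> 'a tvec" where
  "angle_field A \<zeta> i a =
     velocity A (\<lambda>t. inv (torus_map \<zeta>) (\<chi> j. if j = i then cis t * \<zeta> j a else \<zeta> j a))"

definition freq_field ::
  "('a::topological_space, 'e::euclidean_space) atlas \<Rightarrow> ('m::finite \<Rightarrow> real) \<Rightarrow> ('m \<Rightarrow> 'a \<Rightarrow> complex)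
    \<Rightarrow> 'm \<Rightarrow> 'a \<Rightarrow> 'a tvec" where
  "freq_field A \<Omega> \<zeta> i = (\<lambda>a f. \<Omega> i * angle_field A \<zeta> i a f)"

section \<open>Induced and delay-coordinate metrics\<close>

definition induced_metric :: "('a \<Rightarrow> real ^ 'd) \<Rightarrow> 'a metric_tensor" where
  "induced_metric F a u w = pushforward_eucl F u \<bullet> pushforward_eucl F w"

definition delay_metric ::
  "('a::topological_space, 'e::euclidean_space) atlas \<Rightarrow> 'a metric_tensor \<Rightarrow> (real \<Rightarrow> 'a \<Rightarrow> 'a) \<Rightarrow> real
    \<Rightarrow> nat \<Rightarrow> 'a metric_tensor" where
  "delay_metric A g \<Phi> T s a u w =
     (1 / real s) * (\<Sum>k<s. let S = \<Phi> (- (real k * T)) in g (S a) (pushforward A S u) (pushforward A S w))"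

end

theory Submission
  imports Defs
begin

text \<open>The eigenfunctions identify \<open>M\<close> with a torus on which \<open>\<Phi> t\<close> is the translation by \<open>t * \<Omega>\<close>. A tangent vector has
  constant components in the angle frame along an orbit, so \<open>g\<^sub>s\<close> is a Birkhoff average of the continuous
  functions \<open>g(\<partial>\<^sub>i, \<partial>\<^sub>j)\<close>. Ergodicity of \<open>\<Phi> T\<close> rules out resonances \<open>exp (\<i> T k\<cdot>\<Omega>) = 1\<close>, so the averages of
  characters, and by Stone-Weierstrass those of all continuous functions, converge at every point to the space
  average. The limit has constant coefficients in the angle frame. This gives invariance under translations,
  flatness (differentiating components is the Levi-Civita connection) and a volume form that is a constant
  multiple of Haar measure, and \<open>\<mu>\<close> is Haar measure because it has the same Fourier coefficients.\<close>

section \<open>Calculus of smooth maps\<close>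

text \<open>The charts in \<open>A\<close> are arbitrary and know nothing of the angles, which are
  themselves only defined modulo 2 \<pi>. Both difficulties are met by the covering map
  \<open>cover\<close> from \<open>real ^ 'm\<close>: smoothness is tested by pulling back to the
  cover, every tangent vector is a direction \<open>w\<close> at a point \<open>x\<close> upstairs,
  and the charts in \<open>A\<close> matter again only for the smoothness of translations and for
  the volume. The hypotheses on the flow are weaker than they look. The eigenvalue equation holds in
  mean square only, and rational independence of the frequencies does not prevent T k\<cdot>\<Omega>
  from being a multiple of 2 \<pi>; the positive density supplies full support, which repairs the
  first and makes ergodicity of the single map \<open>\<Phi> T\<close> strong enough to exclude the
  second. Angle components are used throughout. They differ from components along the fields v_i by
  factors \<Omega>_i, which are nonzero by rational independence and cancel in the final formula.
  The constant \<Gamma> arises as the square root of the determinant of the averaged Gram matrix in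
  the angle frame times the Lebesgue measure of a period cube.\<close>

text \<open>On an open set equal functions have the same derivatives at each point, so
  \<open>frechet_derivative\<close> makes the same choice for both, and the induction passes to the
  directional derivatives.\<close>

lemma Ck_on_cong:
  assumes "open S" "\<And>x. x \<in> S \<Longrightarrow> f x = g x"
  shows "Ck_on n S f \<longleftrightarrow> Ck_on n S g"
proof -
  have "Ck_on n S g" if "Ck_on n S f" "\<And>x. x \<in> S \<Longrightarrow> f x = g x" for f g :: "'a \<Rightarrow> 'b"
    using that
  proof (induction n arbitrary: f g)
    case 0
    then show ?case by (auto cong: continuous_on_cong)
  next
    case (Suc n)
    have d: "(f has_derivative D) (at x) \<longleftrightarrow> (g has_derivative D) (at x)" if "x \<in> S" for x D
      using has_derivative_transform_within_open[OF _ assms(1) that] Suc.prems(2)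
      by (metis (no_types, lifting))
    have fd: "frechet_derivative f (at x) = frechet_derivative g (at x)" if "x \<in> S" for x
      using d[OF that] by (simp add: frechet_derivative_def)
    show ?case
      using Suc.prems(1) d fd Suc.IH[of "\<lambda>x. frechet_derivative f (at x) _" "\<lambda>x. frechet_derivative g (at x) _"]
      by (auto simp: differentiable_def)
  qed
  from this[of f g] this[of g f] show ?thesis using assms(2) by auto
qed

lemma Ck_on_subset: "Ck_on n S f \<Longrightarrow> T \<subseteq> S \<Longrightarrow> Ck_on n T f"
  by (induction n arbitrary: f) (auto intro: continuous_on_subset)

lemma Ck_on_SucD: "Ck_on (Suc n) S f \<Longrightarrow> Ck_on n S f"
proof (induction n arbitrary: f)
  case 0
  then show ?case
    by (auto intro!: differentiable_imp_continuous_on simp: differentiable_on_def differentiable_at_withinI)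
next
  case (Suc n)
  then show ?case by auto
qed

lemma Ck_on_UN:
  assumes "\<And>i. i \<in> I \<Longrightarrow> open (S i)" "\<And>i. i \<in> I \<Longrightarrow> Ck_on n (S i) f"
  shows "Ck_on n (\<Union>i\<in>I. S i) f"
  using assms(2)
proof (induction n arbitrary: f)
  case 0
  then show ?case using assms(1) by (auto intro!: continuous_on_open_UN)
next
  case (Suc n)
  then show ?case by auto
qed

lemma frechet_derivative_eqI: "(f has_derivative D) (at x) \<Longrightarrow> frechet_derivative f (at x) = D"
  by (metis frechet_derivative_at)

text \<open>Lets any explicit formula for the derivative stand in for
  \<open>frechet_derivative\<close>; the closure rules for sums, products and compositions below all
  go through it.\<close>

lemma Ck_on_SucI:
  assumes "open S" "\<And>x. x \<in> S \<Longrightarrow> (f has_derivative D x) (at x)" "\<And>v. Ck_on n S (\<lambda>x. D x v)"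
  shows "Ck_on (Suc n) S f"
proof -
  have "Ck_on n S (\<lambda>x. frechet_derivative f (at x) v)" for v
    using assms(3)[of v] frechet_derivative_eqI[OF assms(2)] by (subst Ck_on_cong[OF assms(1)]) auto
  then show ?thesis using assms(2) by (auto simp: differentiable_def)
qed

lemma Ck_on_SucE:
  assumes "Ck_on (Suc n) S f" "x \<in> S"
  shows "(f has_derivative frechet_derivative f (at x)) (at x)"
  using assms by (auto simp: frechet_derivative_works)

lemma Ck_on_const: "Ck_on n S (\<lambda>x. c)"
  by (induction n arbitrary: c) auto

lemma Ck_on_bounded_linear:
  assumes "bounded_linear L" "open S"
  shows "Ck_on n S L"
proof -
  have "Ck_on (Suc n) S L"
    by (rule Ck_on_SucI[where D = "\<lambda>_. L"])
      (auto simp: assms Ck_on_const bounded_linear_imp_has_derivative)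
  then show ?thesis by (rule Ck_on_SucD)
qed

lemma Ck_on_add:
  assumes "open S" "Ck_on n S f" "Ck_on n S g"
  shows "Ck_on n S (\<lambda>x. f x + g x)"
  using assms(2,3)
proof (induction n arbitrary: f g)
  case (Suc n)
  then show ?case
    by (intro Ck_on_SucI[where D = "\<lambda>x v. frechet_derivative f (at x) v + frechet_derivative g (at x) v"])
      (auto intro!: has_derivative_add simp: assms(1) frechet_derivative_works[symmetric])
qed (auto intro: continuous_intros)

lemma Ck_on_sum:
  assumes "open S" "\<And>i. i \<in> I \<Longrightarrow> Ck_on n S (f i)"
  shows "Ck_on n S (\<lambda>x. \<Sum>i\<in>I. f i x)"
proof (cases "finite I")
  case True
  then show ?thesis using assms(2)
    by (induction I rule: finite_induct) (auto simp: Ck_on_const intro!: Ck_on_add assms(1))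
qed (simp add: Ck_on_const)

lemma Ck_on_bilinear:
  assumes "bounded_bilinear B" "open S" "Ck_on n S f" "Ck_on n S g"
  shows "Ck_on n S (\<lambda>x. B (f x) (g x))"
  using assms(3,4)
proof (induction n arbitrary: f g)
  case 0
  then show ?case by (auto intro!: bounded_bilinear.continuous_on[OF assms(1)])
next
  case (Suc n)
  show ?case
  proof (rule Ck_on_SucI[OF assms(2)])
    fix x assume "x \<in> S"
    then show "((\<lambda>x. B (f x) (g x)) has_derivative (\<lambda>v. B (f x) (frechet_derivative g (at x) v) 
        + B (frechet_derivative f (at x) v) (g x))) (at x)"
      using Suc.prems by (intro bounded_bilinear.FDERIV[OF assms(1)] Ck_on_SucE)
  next
    fix v show "Ck_on n S (\<lambda>x. B (f x) (frechet_derivative g (at x) v) 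
        + B (frechet_derivative f (at x) v) (g x))"
      using Suc.prems Ck_on_SucD[OF Suc.prems(1)] Ck_on_SucD[OF Suc.prems(2)] 
      by (intro Ck_on_add[OF assms(2)] Suc.IH) auto
  qed
qed

text \<open>Induction on the order with only \<open>g\<close> generalized: the derivative of the
  composite involves directional derivatives of \<open>g\<close> composed with the same
  \<open>f\<close>, which is still of the lower order.\<close>

lemma Ck_on_compose:
  fixes f :: "'a::real_normed_vector \<Rightarrow> 'b::euclidean_space" and g :: "'b \<Rightarrow> 'c::real_normed_vector"
  assumes "open S" "open T" "f ` S \<subseteq> T" "Ck_on n S f" "Ck_on n T g"
  shows "Ck_on n S (\<lambda>x. g (f x))"
  using assms(4,5)
proof (induction n arbitrary: g)
  case 0
  then show ?case using assms(3) by (auto intro: continuous_on_compose2)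
next
  case (Suc n)
  let ?Df = "\<lambda>x. frechet_derivative f (at x)" and ?Dg = "\<lambda>x. frechet_derivative g (at x)"
  show ?case
  proof (rule Ck_on_SucI[OF assms(1)])
    fix x assume x: "x \<in> S"
    then have f: "(f has_derivative ?Df x) (at x)" and g: "(g has_derivative ?Dg (f x)) (at (f x))"
      using assms(3) by (auto intro!: Ck_on_SucE[OF Suc.prems(1)] Ck_on_SucE[OF Suc.prems(2)])
    have "((\<lambda>x. g (f x)) has_derivative (\<lambda>v. ?Dg (f x) (?Df x v))) (at x)"
      by (rule has_derivative_compose[OF f g])
    \<comment> \<open>In the chain rule the direction fed to \<open>?Dg\<close> moves with
      \<open>x\<close>, whereas the induction hypothesis speaks of fixed directions. Expanding in a
      basis leaves only fixed directions \<open>b\<close> with varying scalar coefficients.\<close>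
    also have "(\<lambda>v. ?Dg (f x) (?Df x v)) = (\<lambda>v. \<Sum>b\<in>Basis. (?Df x v \<bullet> b) *\<^sub>R ?Dg (f x) b)" 
    proof
      fix v
      have "?Dg (f x) (?Df x v) = ?Dg (f x) (\<Sum>b\<in>Basis. (?Df x v \<bullet> b) *\<^sub>R b)"
        by (simp add: euclidean_representation)
      then show "?Dg (f x) (?Df x v) = (\<Sum>b\<in>Basis. (?Df x v \<bullet> b) *\<^sub>R ?Dg (f x) b)"
        using has_derivative_linear[OF g] by (simp add: linear_sum linear_scale)
    qed
    finally show "((\<lambda>x. g (f x)) has_derivative (\<lambda>v. \<Sum>b\<in>Basis. (?Df x v \<bullet> b) *\<^sub>R ?Dg (f x) b)) (at x)" .
  next
    fix v
    show "Ck_on n S (\<lambda>x. \<Sum>b\<in>Basis. (?Df x v \<bullet> b) *\<^sub>R ?Dg (f x) b)"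
      using Suc.prems Ck_on_SucD[OF Suc.prems(1)]
      by (intro Ck_on_sum Ck_on_bilinear[OF bounded_bilinear_scaleR] assms(1) 
          Ck_on_bilinear[OF bounded_bilinear_inner] Ck_on_const Suc.IH) auto
  qed
qed

section \<open>Closure properties of maps of class C^\<infinity>\<close>

lemma smooth_on_cong:
  "open S \<Longrightarrow> (\<And>x. x \<in> S \<Longrightarrow> f x = g x) \<Longrightarrow> smooth_on S f \<longleftrightarrow> smooth_on S g"
  unfolding smooth_on_def using Ck_on_cong by blast

lemma smooth_on_subset: "smooth_on S f \<Longrightarrow> T \<subseteq> S \<Longrightarrow> smooth_on T f"
  unfolding smooth_on_def using Ck_on_subset by blast

lemma smooth_on_UN:
  "(\<And>i. i \<in> I \<Longrightarrow> open (S i)) \<Longrightarrow> (\<And>i. i \<in> I \<Longrightarrow> smooth_on (S i) f) \<Longrightarrow> smooth_on (\<Union>i\<in>I. S i) f"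
  unfolding smooth_on_def using Ck_on_UN by metis

lemma smooth_on_locallyI:
  assumes "\<And>x. x \<in> S \<Longrightarrow> \<exists>W. open W \<and> x \<in> W \<and> smooth_on W f"
  shows "smooth_on S f"
proof -
  obtain W where W: "\<And>x. x \<in> S \<Longrightarrow> open (W x) \<and> x \<in> W x \<and> smooth_on (W x) f"
    using assms by metis
  then have "smooth_on (\<Union>x\<in>S. W x) f" by (intro smooth_on_UN) auto
  then show ?thesis by (rule smooth_on_subset) (use W in auto)
qed

lemma smooth_on_const: "smooth_on S (\<lambda>x. c)"
  by (simp add: smooth_on_def Ck_on_const)

lemma smooth_on_bounded_linear: "bounded_linear L \<Longrightarrow> open S \<Longrightarrow> smooth_on S L"
  by (simp add: smooth_on_def Ck_on_bounded_linear)

lemma smooth_on_ident: "open S \<Longrightarrow> smooth_on S (\<lambda>x. x)"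
  by (simp add: bounded_linear_ident smooth_on_bounded_linear)

lemma smooth_on_add:
  "open S \<Longrightarrow> smooth_on S f \<Longrightarrow> smooth_on S g \<Longrightarrow> smooth_on S (\<lambda>x. f x + g x)"
  by (simp add: smooth_on_def Ck_on_add)

lemma smooth_on_sum:
  "open S \<Longrightarrow> (\<And>i. i \<in> I \<Longrightarrow> smooth_on S (f i)) \<Longrightarrow> smooth_on S (\<lambda>x. \<Sum>i\<in>I. f i x)"
  by (simp add: smooth_on_def Ck_on_sum)

lemma smooth_on_bilinear:
  "bounded_bilinear B \<Longrightarrow> open S \<Longrightarrow> smooth_on S f \<Longrightarrow> smooth_on S g \<Longrightarrow> smooth_on S (\<lambda>x. B (f x) (g x))"
  by (simp add: smooth_on_def Ck_on_bilinear)

lemma smooth_on_mult: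
  fixes f g :: "'a::real_normed_vector \<Rightarrow> 'b::real_normed_algebra"
  shows "open S \<Longrightarrow> smooth_on S f \<Longrightarrow> smooth_on S g \<Longrightarrow> smooth_on S (\<lambda>x. f x * g x)"
  by (rule smooth_on_bilinear[OF bounded_bilinear_mult])

lemma smooth_on_compose:
  fixes f :: "'a::real_normed_vector \<Rightarrow> 'b::euclidean_space" and g :: "'b \<Rightarrow> 'c::real_normed_vector"
  shows "open S \<Longrightarrow> open T \<Longrightarrow> f ` S \<subseteq> T \<Longrightarrow> smooth_on S f \<Longrightarrow> smooth_on T g \<Longrightarrow> smooth_on S (\<lambda>x. g (f x))"
  unfolding smooth_on_def using Ck_on_compose by metis

lemma smooth_on_linear_compose:
  fixes f :: "'a::real_normed_vector \<Rightarrow> 'b::euclidean_space"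
  assumes "bounded_linear L" "open S" "smooth_on S f"
  shows "smooth_on S (\<lambda>x. L (f x))"
  using smooth_on_compose[OF assms(2) open_UNIV _ assms(3) smooth_on_bounded_linear[OF assms(1) open_UNIV]]
  by simp

lemma smooth_on_imp_continuous_on: "smooth_on S f \<Longrightarrow> continuous_on S f"
  unfolding smooth_on_def by (metis Ck_on.simps(1))

lemma smooth_on_has_derivative:
  "smooth_on S f \<Longrightarrow> x \<in> S \<Longrightarrow> (f has_derivative frechet_derivative f (at x)) (at x)"
  unfolding smooth_on_def by (metis Ck_on_SucE)

lemma smooth_on_frechet_derivative:
  "smooth_on S f \<Longrightarrow> smooth_on S (\<lambda>x. frechet_derivative f (at x) v)"
  unfolding smooth_on_def by (metis Ck_on.simps(2))

section \<open>Symmetry of second derivatives\<close>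

lemma has_derivative_imp_has_real_derivative_line:
  fixes f :: "'a::real_normed_vector \<Rightarrow> real"
  assumes "(f has_derivative D) (at (x + t *\<^sub>R v))"
  shows "((\<lambda>t. f (x + t *\<^sub>R v)) has_real_derivative D v) (at t)"
proof -
  have "((\<lambda>t. f (x + t *\<^sub>R v)) has_derivative (\<lambda>s. D (s *\<^sub>R v))) (at t)"
    by (rule has_derivative_compose[where g = f]) (auto intro!: derivative_eq_intros assms)
  then show ?thesis
    using has_derivative_linear[OF assms] by (simp add: linear_scale has_field_derivative_def mult_commute_abs)
qed

text \<open>Both mixed derivatives are limits of the second difference quotient, by applying the mean value theorem
  twice.\<close>
lemma mixed_difference_mean_value:
  fixes f :: "'a::real_normed_vector \<Rightarrow> real"
  assumes "Ck_on 2 UNIV f" and h: "h > 0"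
  shows "\<exists>s t. 0 < s \<and> s < h \<and> 0 < t \<and> t < h \<and>
    f (x + h *\<^sub>R v + h *\<^sub>R w) - f (x + h *\<^sub>R v) - f (x + h *\<^sub>R w) + f x
    = h\<^sup>2 * frechet_derivative (\<lambda>y. frechet_derivative f (at y) v) (at (x + s *\<^sub>R v + t *\<^sub>R w)) w"
proof -
  let ?D = "\<lambda>y. frechet_derivative f (at y)"
  have C: "Ck_on (Suc (Suc 0)) UNIV f" using assms(1) by (simp add: numeral_2_eq_2)
  have f: "(f has_derivative ?D y) (at y)" for y
    using Ck_on_SucE[OF C] by auto
  have f2: "((\<lambda>y. ?D y v) has_derivative frechet_derivative (\<lambda>y. ?D y v) (at y)) (at y)" for y
    using C by (intro Ck_on_SucE[of 0 UNIV]) auto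
  have "((\<lambda>s. f (x + h *\<^sub>R w + s *\<^sub>R v) - f (x + s *\<^sub>R v)) has_real_derivative 
      ?D (x + h *\<^sub>R w + s *\<^sub>R v) v - ?D (x + s *\<^sub>R v) v) (at s)" for s
    by (intro DERIV_diff has_derivative_imp_has_real_derivative_line f)
  from MVT2[OF h this] obtain s where s: "0 < s" "s < h" 
    "f (x + h *\<^sub>R w + h *\<^sub>R v) - f (x + h *\<^sub>R v) - (f (x + h *\<^sub>R w) - f x) =
     h * (?D (x + h *\<^sub>R w + s *\<^sub>R v) v - ?D (x + s *\<^sub>R v) v)" by auto
  have "((\<lambda>t. ?D (x + s *\<^sub>R v + t *\<^sub>R w) v) has_real_derivative 
      frechet_derivative (\<lambda>y. ?D y v) (at (x + s *\<^sub>R v + t *\<^sub>R w)) w) (at t)" for t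
    by (intro has_derivative_imp_has_real_derivative_line f2)
  from MVT2[OF h this] obtain t where t: "0 < t" "t < h" 
    "?D (x + s *\<^sub>R v + h *\<^sub>R w) v - ?D (x + s *\<^sub>R v) v =
     h * frechet_derivative (\<lambda>y. ?D y v) (at (x + s *\<^sub>R v + t *\<^sub>R w)) w" by auto
  show ?thesis using s t by (intro exI[of _ s] exI[of _ t]) (auto simp: algebra_simps power2_eq_square)
qed

lemma mixed_derivatives_commute:
  fixes f :: "'a::real_normed_vector \<Rightarrow> real"
  assumes C: "Ck_on 2 UNIV f"
  shows "frechet_derivative (\<lambda>y. frechet_derivative f (at y) v) (at x) w =
    frechet_derivative (\<lambda>y. frechet_derivative f (at y) w) (at x) v"
proof -
  define G where "G v w y = frechet_derivative (\<lambda>y. frechet_derivative f (at y) v) (at y) w" for v w y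
  have cont: "isCont (G v w) y" for v w y
    using C by (auto simp: numeral_2_eq_2 G_def[abs_def] continuous_on_eq_continuous_at)
  define q where "q n = (f (x + (1 / Suc n) *\<^sub>R v + (1 / Suc n) *\<^sub>R w) - f (x + (1 / Suc n) *\<^sub>R v)
    - f (x + (1 / Suc n) *\<^sub>R w) + f x) / (1 / Suc n)\<^sup>2" for n
  have lim: "(\<lambda>n. y n) \<longlonglongrightarrow> 0" if "\<And>n. 0 < y n \<and> y n < 1 / real (Suc n)" for y :: "nat \<Rightarrow> real"
    using that by (intro tendsto_sandwich[OF _ _ tendsto_const lim_inverse_n'[THEN LIMSEQ_Suc]] always_eventually)
      (auto intro: less_imp_le)
  obtain s t where st: "\<And>n. 0 < s n \<and> s n < 1 / real (Suc n) \<and> 0 < t n \<and> t n < 1 / real (Suc n) \<and>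
    f (x + (1 / Suc n) *\<^sub>R v + (1 / Suc n) *\<^sub>R w) - f (x + (1 / Suc n) *\<^sub>R v) - f (x + (1 / Suc n) *\<^sub>R w) + f x
    = (1 / Suc n)\<^sup>2 * G v w (x + s n *\<^sub>R v + t n *\<^sub>R w)"
    using mixed_difference_mean_value[OF C, of "1 / real (Suc _)" x v w] unfolding G_def[symmetric]
    by (metis of_nat_0_less_iff zero_less_Suc zero_less_divide_1_iff)
  obtain s' t' where st': "\<And>n. 0 < s' n \<and> s' n < 1 / real (Suc n) \<and> 0 < t' n \<and> t' n < 1 / real (Suc n) \<and>
    f (x + (1 / Suc n) *\<^sub>R w + (1 / Suc n) *\<^sub>R v) - f (x + (1 / Suc n) *\<^sub>R w) - f (x + (1 / Suc n) *\<^sub>R v) + f x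
    = (1 / Suc n)\<^sup>2 * G w v (x + s' n *\<^sub>R w + t' n *\<^sub>R v)"
    using mixed_difference_mean_value[OF C, of "1 / real (Suc _)" x w v] unfolding G_def[symmetric]
    by (metis of_nat_0_less_iff zero_less_Suc zero_less_divide_1_iff)
  have "q = (\<lambda>n. G v w (x + s n *\<^sub>R v + t n *\<^sub>R w))"
    using st by (auto simp: q_def fun_eq_iff)
  moreover have "(\<lambda>n. G v w (x + s n *\<^sub>R v + t n *\<^sub>R w)) \<longlonglongrightarrow> G v w x"
    by (rule isCont_tendsto_compose[OF cont]) (use st in \<open>auto intro!: tendsto_eq_intros lim\<close>)
  \<comment> \<open>The second difference is symmetric in \<open>v\<close> and \<open>w\<close>, so
    this one sequence has both mixed derivatives as its limit.\<close>
  moreover have "q = (\<lambda>n. G w v (x + s' n *\<^sub>R w + t' n *\<^sub>R v))"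
    using st' by (auto simp: q_def fun_eq_iff algebra_simps)
  moreover have "(\<lambda>n. G w v (x + s' n *\<^sub>R w + t' n *\<^sub>R v)) \<longlonglongrightarrow> G w v x"
    by (rule isCont_tendsto_compose[OF cont]) (use st' in \<open>auto intro!: tendsto_eq_intros lim\<close>)
  ultimately show ?thesis unfolding G_def[symmetric] by (metis LIMSEQ_unique)
qed

section \<open>Change of variables\<close>

text \<open>The change of variables theorem of the library is restricted to index types with a well-order.
  \<open>'n woi\<close> is a copy of a finite type \<open>'n\<close> carrying such an order.\<close>

typedef 'n woi = "UNIV :: 'n set" by auto

lemma Rep_Abs_woi [simp]: "Rep_woi (Abs_woi i) = i"
  by (simp add: Abs_woi_inverse)

lemma bij_Rep_woi: "bij (Rep_woi :: 'n woi \<Rightarrow> 'n)"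
  by (rule bij_betwI[where g = Abs_woi]) (auto simp: Rep_woi_inverse)

instance woi :: (finite) finite
  by standard (metis bij_Rep_woi bij_betw_finite finite)

instantiation woi :: (finite) wellorder
begin

text \<open>Any injection into the naturals will do, because Lebesgue measure and determinants do
  not depend on the order of the coordinates.\<close>

definition index_woi :: "'a woi \<Rightarrow> nat" where "index_woi = (SOME f. inj f)"
definition less_eq_woi :: "'a woi \<Rightarrow> 'a woi \<Rightarrow> bool" where "x \<le> y \<longleftrightarrow> index_woi x \<le> index_woi y"
definition less_woi :: "'a woi \<Rightarrow> 'a woi \<Rightarrow> bool" where "x < y \<longleftrightarrow> index_woi x < index_woi y"

lemma inj_index_woi: "inj (index_woi :: 'a woi \<Rightarrow> nat)"
proof -
  obtain f :: "'a woi \<Rightarrow> nat" where "inj f"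
    using finite_imp_inj_to_nat_seg[OF finite_class.finite_UNIV] by metis
  then show ?thesis unfolding index_woi_def by (rule someI[of inj])
qed

instance
proof
  fix P :: "'a woi \<Rightarrow> bool" and a :: "'a woi"
  assume *: "\<And>x. (\<And>y. y < x \<Longrightarrow> P y) \<Longrightarrow> P x"
  show "P a"
    by (induction a rule: measure_induct_rule[where f = index_woi]) (rule *, simp add: less_woi_def)
qed (auto simp: less_eq_woi_def less_woi_def injD[OF inj_index_woi])

end

section \<open>Lebesgue measure and determinants under relabelling of coordinates\<close>

definition to_woi :: "real ^ 'n \<Rightarrow> real ^ ('n::finite) woi" where
  "to_woi x = (\<chi> i. x $ Rep_woi i)"

definition of_woi :: "real ^ ('n::finite) woi \<Rightarrow> real ^ 'n" where
  "of_woi x = (\<chi> i. x $ Abs_woi i)"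

lemma of_to_woi [simp]: "of_woi (to_woi x) = x"
  by (simp add: of_woi_def to_woi_def)

lemma to_of_woi [simp]: "to_woi (of_woi x) = x"
  by (simp add: of_woi_def to_woi_def Rep_woi_inverse)

lemma bounded_linear_to_woi: "bounded_linear (to_woi :: real ^ 'n \<Rightarrow> _)"
  by (rule linear_conv_bounded_linear[THEN iffD1], rule linearI) (auto simp: to_woi_def vec_eq_iff)

lemma bounded_linear_of_woi: "bounded_linear (of_woi :: _ \<Rightarrow> real ^ 'n)"
  by (rule linear_conv_bounded_linear[THEN iffD1], rule linearI) (auto simp: of_woi_def vec_eq_iff)

lemma borel_measurable_to_woi [measurable]: "to_woi \<in> borel_measurable borel"
  by (intro borel_measurable_continuous_onI linear_continuous_on bounded_linear_to_woi)

lemma borel_measurable_of_woi [measurable]: "of_woi \<in> borel_measurable borel"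
  by (intro borel_measurable_continuous_onI linear_continuous_on bounded_linear_of_woi)

lemma prod_Basis_vec:
  fixes f :: "real ^ 'n \<Rightarrow> 'b::comm_monoid_mult"
  shows "(\<Prod>b\<in>Basis. f b) = (\<Prod>i\<in>UNIV. f (axis i 1))"
proof -
  have "(Basis :: (real ^ 'n) set) = range (\<lambda>i. axis i 1)"
    by (auto simp: Basis_vec_def)
  moreover have "inj (\<lambda>i::'n. axis i (1::real))"
    by (auto simp: inj_def axis_eq_axis)
  ultimately show ?thesis by (intro prod.reindex_cong) auto
qed

text \<open>Relabelling turns a box into a box with the same side lengths, and Lebesgue measure is
  determined by its values on boxes.\<close>

lemma lborel_distr_to_woi: "distr lborel borel to_woi = (lborel :: (real ^ ('n::finite) woi) measure)"
proof (rule lborel_eqI[symmetric])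
  fix l u :: "real ^ ('n::finite) woi"
  assume le: "\<And>b. b \<in> Basis \<Longrightarrow> l \<bullet> b \<le> u \<bullet> b"
  have "l $ i \<le> u $ i" for i using le[of "axis i 1"] by (simp add: inner_axis)
  then have le': "of_woi l \<bullet> b \<le> of_woi u \<bullet> b" if "b \<in> Basis" for b
    using that by (auto simp: Basis_vec_def inner_axis of_woi_def)
  have "to_woi -` box l u = box (of_woi l) (of_woi u)"
  proof (intro set_eqI)
    fix x :: "real ^ 'n"
    have "(\<forall>i. P (Rep_woi i)) \<longleftrightarrow> (\<forall>i. P i)" for P :: "'n \<Rightarrow> bool"
      by (metis Rep_Abs_woi)
    from this[of "\<lambda>i. l $ Abs_woi i < x $ i \<and> x $ i < u $ Abs_woi i"]
    show "x \<in> to_woi -` box l u \<longleftrightarrow> x \<in> box (of_woi l) (of_woi u)"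
      by (simp add: mem_box_cart to_woi_def of_woi_def Rep_woi_inverse)
  qed
  then have "emeasure (distr lborel borel to_woi) (box l u) = emeasure lborel (box (of_woi l) (of_woi u))"
    by (subst emeasure_distr) auto
  also have "\<dots> = (\<Prod>i\<in>UNIV. (u - l) $ Abs_woi i)"
    using le' by (simp add: emeasure_lborel_box_eq prod_Basis_vec inner_axis) (simp add: of_woi_def)
  also have "(\<Prod>i\<in>UNIV. (u - l) $ Abs_woi i) = (\<Prod>i\<in>UNIV. (u - l) $ i)"
    by (rule prod.reindex_bij_witness[where i = Rep_woi and j = Abs_woi]) (auto simp: Rep_woi_inverse)
  finally show "emeasure (distr lborel borel to_woi) (box l u) = (\<Prod>b\<in>Basis. (u - l) \<bullet> b)"
    by (simp add: prod_Basis_vec inner_axis)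
qed auto

text \<open>The two permutations live on different types, so their signs are compared by building
  both from transpositions in parallel: conjugation sends a transposition to a
  transposition.\<close>

lemma permutes_conjugate_woi:
  assumes "p permutes (UNIV :: 'n::finite set)"
  shows "(Abs_woi \<circ> p \<circ> Rep_woi) permutes UNIV \<and> sign (Abs_woi \<circ> p \<circ> Rep_woi) = sign p"
  using assms finite_class.finite_UNIV
proof (induction p rule: permutes_induct)
  case id
  have "Abs_woi \<circ> (id :: 'n \<Rightarrow> 'n) \<circ> Rep_woi = id" by (auto simp: Rep_woi_inverse)
  then show ?case by (simp only: sign_id permutes_id)
next
  case (swap a b p)
  let ?q = "Abs_woi \<circ> p \<circ> Rep_woi" and ?s = "Transposition.transpose (Abs_woi a) (Abs_woi b)"
  have eq: "Abs_woi \<circ> (Transposition.transpose a b \<circ> p) \<circ> Rep_woi = ?s \<circ> ?q"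
    by (simp add: fun_eq_iff Transposition.transpose_def Abs_woi_inject)
  have q: "?q permutes UNIV" using swap by blast
  have p: "permutation p" "permutation ?q"
    using swap q by (auto simp: permutation_permutes intro: finite_class.finite_UNIV)
  have "?s \<circ> ?q permutes UNIV"
    by (intro permutes_compose q permutes_swap_id) auto
  moreover have "sign (?s \<circ> ?q) = sign (Transposition.transpose a b \<circ> p)"
    using p swap conjunct2[OF swap.IH]
    by (simp add: sign_compose permutation_swap_id sign_swap_id Abs_woi_inject del: o_apply)
  ultimately show ?case unfolding eq by (rule conjI)
qed

lemma permutes_conjugate_woi':
  assumes "p permutes (UNIV :: 'n::finite woi set)"
  shows "(Rep_woi \<circ> p \<circ> Abs_woi) permutes UNIV"
proof (rule bij_imp_permutes)
  have "bij (Abs_woi :: 'n \<Rightarrow> _)"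
    by (rule bij_betwI[where g = Rep_woi]) (auto simp: Rep_woi_inverse)
  then show "bij (Rep_woi \<circ> p \<circ> Abs_woi)"
    using assms by (intro bij_comp bij_Rep_woi permutes_bij)
qed auto

text \<open>Conjugation is a sign-preserving bijection between the permutations over which the two
  Leibniz sums run, and it matches the products term by term.\<close>

lemma det_reindex_woi:
  fixes M :: "real ^ 'n ^ 'n"
  shows "det (\<chi> i j. M $ Rep_woi i $ Rep_woi j) = det M"
proof -
  have "(\<Prod>i\<in>UNIV. M $ i $ Rep_woi (q (Abs_woi i))) = (\<Prod>i\<in>UNIV. M $ Rep_woi i $ Rep_woi (q i))" for q
    by (rule prod.reindex_bij_witness[where i = Rep_woi and j = Abs_woi]) (auto simp: Rep_woi_inverse)
  moreover have "sign (Rep_woi \<circ> q \<circ> Abs_woi) = sign q" if "q permutes UNIV" for q :: "'n woi \<Rightarrow> 'n woi"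
    using permutes_conjugate_woi[OF permutes_conjugate_woi'[OF that]]
    by (simp add: o_def Rep_woi_inverse)
  ultimately show ?thesis unfolding det_def
    by (intro sum.reindex_bij_witness[where i = "\<lambda>p. Abs_woi \<circ> p \<circ> Rep_woi" and j = "\<lambda>p. Rep_woi \<circ> p \<circ> Abs_woi"])
      (auto simp: permutes_conjugate_woi permutes_conjugate_woi' fun_eq_iff Rep_woi_inverse)
qed

text \<open>The density \<open>h\<close> is the reciprocal of the Jacobian, so the integrand pulled
  back to \<open>S\<close> is the constant 1. Finite measure of \<open>S\<close> then yields
  integrability on both sides of the change of variables.\<close>

lemma nn_integral_image_wellorder:
  fixes g :: "real ^ 'n::{finite,wellorder} \<Rightarrow> real ^ 'n::_"
  assumes S: "S \<in> sets borel" "emeasure lborel S < \<infinity>"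
    and der: "\<And>x. x \<in> S \<Longrightarrow> (g has_derivative g' x) (at x)"
    and inj: "inj_on g S"
    and h: "\<And>y. y \<in> g ` S \<Longrightarrow> 0 \<le> h y"
    and one: "\<And>x. x \<in> S \<Longrightarrow> \<bar>det (matrix (g' x))\<bar> * h (g x) = 1"
  shows "(\<integral>\<^sup>+y\<in>g ` S. ennreal (h y) \<partial>lborel) = emeasure lborel S"
proof -
  have lm: "S \<in> lmeasurable"
    using S by (intro fmeasurableI) (auto simp: emeasure_completion)
  \<comment> \<open>The change of variables theorem speaks of vector-valued integrands; a scalar
    enters as a vector with one component.\<close>
  have 1: "(\<lambda>x. \<bar>det (matrix (g' x))\<bar> *\<^sub>R (vec (h (g x)) :: real ^ 1)) absolutely_integrable_on S \<and>
    integral S (\<lambda>x. \<bar>det (matrix (g' x))\<bar> *\<^sub>R (vec (h (g x)) :: real ^ 1)) = vec (measure lebesgue S)"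
  proof -
    have eq: "\<bar>det (matrix (g' x))\<bar> *\<^sub>R (vec (h (g x)) :: real ^ 1) = vec 1" if "x \<in> S" for x
      using one[OF that] by (simp add: vec_eq_iff)
    have "(\<lambda>x. vec 1 :: real ^ 1) absolutely_integrable_on S"
      using lm by (intro absolutely_integrable_on_const)
    moreover have "integral S (\<lambda>x. vec 1 :: real ^ 1) = vec (measure lebesgue S)"
      using lm by (simp add: integral_on_1_eq lmeasure_integral)
    moreover have "integral S (\<lambda>x. \<bar>det (matrix (g' x))\<bar> *\<^sub>R (vec (h (g x)) :: real ^ 1)) = integral S (\<lambda>x. vec 1)"
      by (rule integral_cong) (rule eq)
    moreover have "(\<lambda>x. \<bar>det (matrix (g' x))\<bar> *\<^sub>R (vec (h (g x)) :: real ^ 1)) absolutely_integrable_on S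
      \<longleftrightarrow> (\<lambda>x. vec 1 :: real ^ 1) absolutely_integrable_on S"
      by (rule set_integrable_cong[OF refl refl]) (rule eq)
    ultimately show ?thesis by simp
  qed
  then have 2: "(\<lambda>y. vec (h y) :: real ^ 1) absolutely_integrable_on (g ` S)"
     "integral (g ` S) (\<lambda>y. vec (h y) :: real ^ 1) = vec (measure lebesgue S)"
    using has_absolute_integral_change_of_variables[of S g g' "\<lambda>y. vec (h y)" "vec (measure lebesgue S)"]
      S inj has_derivative_at_withinI[OF der] 1 by auto
  then have 3: "h absolutely_integrable_on (g ` S)" "integral (g ` S) h = measure lebesgue S"
    by (auto simp: absolutely_integrable_on_1_iff integral_on_1_eq vec_eq_iff)
  have "(\<integral>\<^sup>+y\<in>g ` S. ennreal (h y) \<partial>lborel) = ennreal (measure lebesgue S)"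
    using set_lebesgue_integral_eq_integral(1)[OF 3(1)] 3(2) h
    by (intro nn_integral_has_integral_lebesgue') (auto simp: has_integral_iff)
  also have "\<dots> = emeasure lborel S"
    using S lm by (simp add: measure_def emeasure_completion)
  finally show ?thesis .
qed

text \<open>Conjugating with \<open>to_woi\<close> reduces to an ordered index type. Measurability
  of \<open>h\<close> enters where the integral over the image is carried back along this
  relabelling.\<close>

lemma nn_integral_image:
  fixes g :: "real ^ 'n \<Rightarrow> real ^ 'n"
  assumes S: "S \<in> sets borel" "emeasure lborel S < \<infinity>"
    and der: "\<And>x. x \<in> S \<Longrightarrow> (g has_derivative g' x) (at x)"
    and inj: "inj_on g S"
    and h: "(\<lambda>y. indicator (g ` S) y * h y) \<in> borel_measurable borel" "\<And>y. y \<in> g ` S \<Longrightarrow> 0 \<le> h y"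
    and one: "\<And>x. x \<in> S \<Longrightarrow> \<bar>det (matrix (g' x))\<bar> * h (g x) = 1"
  shows "(\<integral>\<^sup>+y\<in>g ` S. ennreal (h y) \<partial>lborel) = emeasure lborel S"
proof -
  let ?S = "of_woi -` S" and ?g = "\<lambda>x. to_woi (g (of_woi x))" 
  let ?g' = "\<lambda>x v. to_woi (g' (of_woi x) (of_woi v))" and ?h = "\<lambda>y. h (of_woi y)"
  have img: "?g ` ?S = of_woi -` (g ` S)"
  proof (intro set_eqI iffI)
    fix y assume "y \<in> of_woi -` (g ` S)"
    then obtain x where "x \<in> S" "of_woi y = g x" by auto
    then have "y = ?g (to_woi x)" "to_woi x \<in> ?S" using to_of_woi[of y] by simp_all
    then show "y \<in> ?g ` ?S" by (rule image_eqI)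
  qed auto
  have meas: "?S \<in> sets borel"
    using measurable_sets[OF borel_measurable_of_woi S(1)] by simp
  have em: "emeasure lborel ?S = emeasure lborel S"
  proof -
    have "emeasure lborel ?S = emeasure (distr lborel borel to_woi) ?S"
      by (simp only: lborel_distr_to_woi)
    also have "\<dots> = emeasure lborel S"
      using meas by (subst emeasure_distr) (auto simp: vimage_def)
    finally show ?thesis .
  qed
  have "(\<integral>\<^sup>+y\<in>?g ` ?S. ennreal (?h y) \<partial>lborel) = emeasure lborel ?S"
  proof (rule nn_integral_image_wellorder)
    show "(?g has_derivative ?g' x) (at x)" if "x \<in> ?S" for x
    proof -
      have "(g has_derivative g' (of_woi x)) (at (of_woi x))" using that by (intro der) simp
      note * = has_derivative_compose[OF bounded_linear_imp_has_derivative[OF bounded_linear_of_woi] this]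
      show ?thesis
        by (rule has_derivative_compose[OF * bounded_linear_imp_has_derivative[OF bounded_linear_to_woi]])
    qed
    show "inj_on ?g ?S"
    proof (rule inj_onI)
      fix x y assume "x \<in> ?S" "y \<in> ?S" "?g x = ?g y"
      then have "of_woi x = of_woi y"
        by (metis inj inj_onD of_to_woi vimageE)
      then show "x = y" by (metis to_of_woi)
    qed
    show "\<bar>det (matrix (?g' x))\<bar> * ?h (?g x) = 1" if "x \<in> ?S" for x
    proof -
      have "of_woi (axis j 1) = axis (Rep_woi j) (1::real)" for j
        by (auto simp: of_woi_def axis_def vec_eq_iff Rep_woi_inverse)
      then have ax: "of_woi (axis j 1) = axis (Rep_woi j) (1::real)" for j by blast
      have "matrix (?g' x) = (\<chi> i j. matrix (g' (of_woi x)) $ Rep_woi i $ Rep_woi j)"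
        unfolding matrix_def to_woi_def ax by simp
      then show ?thesis using that one[of "of_woi x"] by (simp add: det_reindex_woi)
    qed
    show "emeasure lborel ?S < \<infinity>" using em S by simp
    show "0 \<le> ?h y" if "y \<in> ?g ` ?S" for y using that h(2) unfolding img by simp
  qed (rule meas)
  also have "(\<integral>\<^sup>+y\<in>?g ` ?S. ennreal (?h y) \<partial>lborel) = (\<integral>\<^sup>+y\<in>g ` S. ennreal (h y) \<partial>lborel)"
  proof -
    let ?F = "\<lambda>y. ennreal (indicator (g ` S) y * h y)"
    have F: "ennreal (h y) * indicator (g ` S) y = ?F y" for y
      by (simp add: indicator_def)
    have m: "(\<lambda>y. ?F (of_woi y)) \<in> borel_measurable borel"
      by (rule measurable_compose[OF borel_measurable_of_woi measurable_compose[OF h(1) measurable_ennreal]])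
    have "(\<integral>\<^sup>+y. ?F (of_woi y) \<partial>distr lborel borel to_woi) = (\<integral>\<^sup>+y. ?F (of_woi (to_woi y)) \<partial>lborel)"
      by (rule nn_integral_distr) (use m in \<open>simp_all\<close>)
    then have "(\<integral>\<^sup>+y. ?F (of_woi y) \<partial>lborel) = (\<integral>\<^sup>+y. ?F y \<partial>lborel)"
      by (simp only: lborel_distr_to_woi of_to_woi)
    moreover have "ennreal (?h y) * indicator (?g ` ?S) y = ?F (of_woi y)" for y
      unfolding img by (simp add: indicator_def)
    ultimately show ?thesis by (simp only: F)
  qed
  finally show ?thesis using em by simp
qed

section \<open>The angle coordinates\<close>

lemma smooth_on_eq:
  "smooth_on S f \<Longrightarrow> open S \<Longrightarrow> (\<And>x. x \<in> S \<Longrightarrow> f x = g x) \<Longrightarrow> smooth_on S g"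
  using smooth_on_cong[of S f g] by blast

lemma smooth_map_onD:
  assumes "smooth_map_on A B S f" "(U, \<phi>) \<in> A" "(V, \<psi>) \<in> B"
  shows "smooth_on (\<phi> ` (U \<inter> S \<inter> f -` V)) (\<psi> \<circ> f \<circ> inv_into U \<phi>)"
  using assms unfolding smooth_map_on_def by fastforce

section \<open>Cubes of angles and the exponential map of the torus\<close>

lemma open_torus_box: "open (torus_box b)"
proof -
  have "torus_box b = box (\<chi> i. b $ i - pi) (\<chi> i. b $ i + pi)"
    by (auto simp: torus_box_def mem_box_cart)
  then show ?thesis by (simp add: open_box)
qed

lemma mem_torus_box_self: "b \<in> torus_box b"
  by (simp add: torus_box_def)

lemma torus_exp_in_torus: "torus_exp x \<in> torus"
  by (simp add: torus_exp_def torus_def)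

lemma continuous_on_torus_exp: "continuous_on S torus_exp"
  unfolding torus_exp_def by (auto intro!: continuous_intros simp: continuous_on_vec_lambda)

lemma cis_eq_imp_eq:
  assumes "cis s = cis t" "\<bar>s - t\<bar> < 2 * pi"
  shows "s = t"
proof -
  have "cis (s - t) = 1"
    using assms(1) by (simp flip: cis_divide)
  then obtain n :: int where n: "s - t = 2 * pi * n"
    by (auto simp: cis_conv_exp exp_eq_1)
  with assms(2) have "\<bar>real_of_int n\<bar> < 1"
    by (simp add: abs_mult)
  then have "n = 0" by linarith
  then show ?thesis using n by simp
qed

lemma inj_on_torus_exp: "inj_on torus_exp (torus_box b)"
proof (rule inj_onI)
  fix x y
  assume xy: "x \<in> torus_box b" "y \<in> torus_box b" and eq: "torus_exp x = torus_exp y"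
  have "x $ i = y $ i" for i
  proof (rule cis_eq_imp_eq)
    show "cis (x $ i) = cis (y $ i)"
      using eq by (simp add: torus_exp_def vec_eq_iff)
    show "\<bar>x $ i - y $ i\<bar> < 2 * pi"
      using xy unfolding torus_box_def by (simp add: abs_less_iff) (smt (verit))
  qed
  then show "x = y" by (simp add: vec_eq_iff)
qed

text \<open>The open arc of length 2 \<pi> centred at \<open>cis b\<close> misses only the antipode.
  The angle is \<open>b\<close> plus the principal argument of \<open>z\<close> rotated by
  \<open>- b\<close>.\<close>

lemma unit_eq_cis_near:
  assumes "norm z = 1" "z \<noteq> - cis b"
  obtains t where "b - pi < t" "t < b + pi" "z = cis t"
proof -
  let ?w = "z * cis (- b)"
  have w: "norm ?w = 1" using assms by (simp add: norm_mult)
  then have "?w = cis (Arg ?w)"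
    by (metis complex_norm_eq_1_exp cis_conv_exp rcis_cmod_Arg rcis_def mult_1 of_real_1)
  then have "cis b * ?w = cis (Arg ?w + b)" by (metis cis_mult mult.commute)
  then have z: "z = cis (Arg ?w + b)" by (simp add: mult.assoc mult.left_commute[of "cis b"] cis_mult)
  \<comment> \<open>\<open>Arg\<close> takes values in the half-open interval from -\<pi> to \<pi>;
    its closed end is exactly the excluded antipode.\<close>
  have "Arg ?w \<noteq> pi"
  proof
    assume "Arg ?w = pi"
    then have "z = cis pi * cis b" using z by (simp only: cis_mult)
    then show False using assms(2) by (simp add: cis_pi)
  qed
  then show ?thesis using Arg_bounded[of ?w] z by (intro that[of "Arg ?w + b"]) auto
qed

section \<open>The universal cover and its local inverses\<close>

locale torus_manifold =
  fixes A :: "('a::t2_space, real ^ 'm) atlas" and \<zeta> :: "'m \<Rightarrow> 'a \<Rightarrow> complex"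
  assumes atlas: "smooth_atlas UNIV A"
    and smooth_zeta: "\<And>i. smooth_fun A (\<zeta> i)"
    and diffeo: "diffeomorphism A torus_atlas UNIV torus (torus_map \<zeta>)"
begin

text \<open>The universal covering of the manifold: the point whose angles are the entries of
  \<open>x\<close> modulo 2 \<pi>.\<close>

definition cover :: "real ^ 'm \<Rightarrow> 'a" where
  "cover x = inv (torus_map \<zeta>) (torus_exp x)"

definition patch :: "real ^ 'm \<Rightarrow> 'a set" where
  "patch b = cover ` torus_box b"

text \<open>The branch of the angles with values in the cube about \<open>b\<close>. It is
  meaningful on \<open>patch b\<close> only.\<close>

definition lift :: "real ^ 'm \<Rightarrow> 'a \<Rightarrow> real ^ 'm" where
  "lift b a = inv_into (torus_box b) torus_exp (torus_map \<zeta> a)"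

lemma torus_map_in_torus: "torus_map \<zeta> a \<in> torus"
  and inj_torus_map: "inj (torus_map \<zeta>)"
  using diffeo by (auto simp: diffeomorphism_def bij_betw_def)

lemma norm_zeta [simp]: "norm (\<zeta> i a) = 1"
  using torus_map_in_torus[of a] by (simp add: torus_def torus_map_def)

lemma torus_map_cover [simp]: "torus_map \<zeta> (cover x) = torus_exp x"
proof -
  have "torus_exp x \<in> range (torus_map \<zeta>)"
    using diffeo torus_exp_in_torus by (auto simp: diffeomorphism_def bij_betw_def)
  then show ?thesis by (simp add: cover_def f_inv_into_f)
qed

lemma zeta_cover [simp]: "\<zeta> i (cover x) = cis (x $ i)"
  using arg_cong[OF torus_map_cover[of x], of "\<lambda>z. z $ i"] by (simp add: torus_map_def torus_exp_def)

lemma eq_iff_zeta: "a = b \<longleftrightarrow> (\<forall>i. \<zeta> i a = \<zeta> i b)"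
  using inj_torus_map by (auto simp: inj_def torus_map_def vec_eq_iff)

lemma inv_torus_map_eqI:
  assumes "\<And>i. z $ i = \<zeta> i a" shows "inv (torus_map \<zeta>) z = a"
proof -
  have "z = torus_map \<zeta> a" using assms by (simp add: torus_map_def vec_eq_iff)
  then show ?thesis by (simp add: inj_torus_map)
qed

lemma cover_eq_iff: "cover x = a \<longleftrightarrow> (\<forall>i. \<zeta> i a = cis (x $ i))"
  by (auto simp: eq_iff_zeta[of "cover x"])

text \<open>A point has angles inside the open cube exactly when no coordinate is antipodal to that
  of the centre. In this form the patch is visibly open.\<close>

lemma patch_eq: "patch b = {a. \<forall>i. \<zeta> i a \<noteq> - cis (b $ i)}"
proof (intro set_eqI iffI)
  fix a assume "a \<in> patch b"
  then obtain x where x: "x \<in> torus_box b" "a = cover x" by (auto simp: patch_def)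
  have "cis (x $ i) \<noteq> - cis (b $ i)" for i
  proof
    assume eq: "cis (x $ i) = - cis (b $ i)"
    have b: "b $ i - pi < x $ i" "x $ i < b $ i + pi" using x(1) by (auto simp: torus_box_def)
    have "x $ i = b $ i + pi"
    proof (rule cis_eq_imp_eq)
      show "cis (x $ i) = cis (b $ i + pi)" unfolding eq cis_mult[symmetric] cis_pi by simp
    qed (use b in linarith)
    then show False using b by simp
  qed
  then show "a \<in> {a. \<forall>i. \<zeta> i a \<noteq> - cis (b $ i)}" using x by simp
next
  fix a assume a: "a \<in> {a. \<forall>i. \<zeta> i a \<noteq> - cis (b $ i)}"
  have "\<exists>t. b $ i - pi < t \<and> t < b $ i + pi \<and> \<zeta> i a = cis t" for i
  proof -
    have "\<zeta> i a \<noteq> - cis (b $ i)" using a by blast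
    then show ?thesis by (rule unit_eq_cis_near[OF norm_zeta]) blast
  qed
  then obtain t where t: "\<And>i. b $ i - pi < t i \<and> t i < b $ i + pi \<and> \<zeta> i a = cis (t i)" by metis
  then have "(\<chi> i. t i) \<in> torus_box b" "cover (\<chi> i. t i) = a"
    by (auto simp: torus_box_def cover_eq_iff)
  then show "a \<in> patch b" by (auto simp: patch_def)
qed

lemma ex_cover: obtains x where "cover x = a"
proof -
  have "\<zeta> i a = cis (Arg (\<zeta> i a))" for i
    by (metis norm_zeta rcis_cmod_Arg rcis_def mult_1 of_real_1)
  then have "cover (\<chi> i. Arg (\<zeta> i a)) = a" by (simp add: cover_eq_iff)
  then show ?thesis by (rule that)
qed

lemma lift_cover: "x \<in> torus_box b \<Longrightarrow> lift b (cover x) = x"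
  by (simp add: lift_def inv_into_f_f[OF inj_on_torus_exp])

lemma patch_lift:
  assumes "a \<in> patch b" shows "cover (lift b a) = a" "lift b a \<in> torus_box b"
  using assms by (auto simp: patch_def lift_cover)

lemma cover_in_patch: "cover b \<in> patch b"
  by (simp add: patch_def mem_torus_box_self)

lemma vimage_torus_map: "torus_map \<zeta> -` (torus_exp ` torus_box b) = patch b"
proof -
  have "torus_map \<zeta> a \<in> torus_exp ` torus_box b \<longleftrightarrow> a \<in> patch b" for a
  proof
    assume "torus_map \<zeta> a \<in> torus_exp ` torus_box b"
    then obtain x where "x \<in> torus_box b" "torus_map \<zeta> a = torus_map \<zeta> (cover x)" by auto
    then show "a \<in> patch b" using inj_torus_map unfolding patch_def by (metis injD imageI)
  qed (auto simp: patch_def)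
  then show ?thesis by auto
qed

lemma continuous_zeta: "continuous_on S (\<zeta> i)"
  using smooth_zeta continuous_on_subset[of UNIV _ S]
  by (auto simp: smooth_fun_def smooth_map_on_def)

lemma open_patch: "open (patch b)"
proof -
  have "open {a. \<zeta> i a \<noteq> - cis (b $ i)}" for i
    by (intro open_Collect_neq continuous_zeta continuous_on_const)
  then have "open (\<Inter>i. {a. \<zeta> i a \<noteq> - cis (b $ i)})" by (intro open_INT) auto
  then show ?thesis by (simp add: patch_eq Collect_all_eq)
qed

lemma continuous_cover: "continuous_on S cover"
proof -
  have "continuous_on torus (inv (torus_map \<zeta>))"
    using diffeo by (simp add: diffeomorphism_def smooth_map_on_def)
  then have "continuous_on S (\<lambda>x. inv (torus_map \<zeta>) (torus_exp x))"
    by (rule continuous_on_compose2) (auto simp: continuous_on_torus_exp torus_exp_in_torus)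
  then show ?thesis by (simp add: cover_def[abs_def])
qed

lemma open_vimage_cover: "open U \<Longrightarrow> open (cover -` U)"
  using continuous_cover[of UNIV] by (simp add: continuous_on_open_vimage)

lemma chart:
  assumes "(U, \<phi>) \<in> A"
  shows "open U" "open (\<phi> ` U)" "homeomorphism U (\<phi> ` U) \<phi> (inv_into U \<phi>)"
  using atlas assms by (auto simp: smooth_atlas_def)

lemma ex_chart: obtains U \<phi> where "(U, \<phi>) \<in> A" "a \<in> U"
proof -
  have "a \<in> (\<Union>(U, \<phi>)\<in>A. U)" using atlas by (simp add: smooth_atlas_def)
  then show ?thesis using that by auto
qed

lemma chart_inv:
  assumes "(U, \<phi>) \<in> A" "a \<in> U" shows "inv_into U \<phi> (\<phi> a) = a"
  using chart(3)[OF assms(1)] assms(2) by (simp add: homeomorphism_def)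

lemma chart_image_open:
  assumes "(U, \<phi>) \<in> A" "open W"
  shows "open (\<phi> ` (U \<inter> W))"
proof -
  have "openin (top_of_set (\<phi> ` U)) (\<phi> ` (U \<inter> W))"
    using chart[OF assms(1)] assms(2)
    by (intro homeomorphism_imp_open_map[of U "\<phi> ` U" \<phi> "inv_into U \<phi>"]) (auto simp: openin_open)
  then show ?thesis using chart(2)[OF assms(1)] openin_open_trans by blast
qed

lemma smooth_lift_chart:
  assumes "(U, \<phi>) \<in> A"
  shows "smooth_on (\<phi> ` (U \<inter> patch b)) (\<lambda>y. lift b (inv_into U \<phi> y))"
proof -
  have "(torus_exp ` torus_box b, inv_into (torus_box b) torus_exp) \<in> torus_atlas"
    by (auto simp: torus_atlas_def)
  then have "smooth_on (\<phi> ` (U \<inter> UNIV \<inter> torus_map \<zeta> -` (torus_exp ` torus_box b))) 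
      (inv_into (torus_box b) torus_exp \<circ> torus_map \<zeta> \<circ> inv_into U \<phi>)"
    using smooth_map_onD[OF _ assms] diffeo unfolding diffeomorphism_def by blast
  then show ?thesis by (simp add: vimage_torus_map lift_def o_def)
qed

text \<open>Smoothness of the inverse of \<open>torus_map \<zeta>\<close>, read in angle charts.
  Such a chart sees one cube at a time, hence the localization to the cube centred at the point in
  question.\<close>

lemma smooth_cover_chart:
  assumes "(U, \<phi>) \<in> A"
  shows "smooth_on (cover -` U) (\<lambda>x. \<phi> (cover x))"
proof (rule smooth_on_locallyI)
  fix b assume b: "b \<in> cover -` U"
  let ?B = "torus_box b" and ?W = "torus_exp ` torus_box b" and ?psi = "inv_into (torus_box b) torus_exp"
  have "(?W, ?psi) \<in> torus_atlas"
    by (auto simp: torus_atlas_def)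
  then have s: "smooth_on (?psi ` (?W \<inter> torus \<inter> inv (torus_map \<zeta>) -` U)) 
      (\<phi> \<circ> inv (torus_map \<zeta>) \<circ> inv_into ?W ?psi)"
    using smooth_map_onD[OF _ _ assms] diffeo unfolding diffeomorphism_def by blast
  have psi: "?psi (torus_exp x) = x" if "x \<in> ?B" for x
    by (simp add: inv_into_f_f[OF inj_on_torus_exp that])
  \<comment> \<open>The inverse of the chart \<open>?psi\<close> is taken on its domain
    \<open>?W\<close>; there it is \<open>torus_exp\<close> again.\<close>
  have "inj_on ?psi ?W" by (metis inj_on_inv_into subset_refl)
  then have inv: "inv_into ?W ?psi x = torus_exp x" if "x \<in> ?B" for x
    by (rule inv_into_f_eq) (use that psi in auto)
  have op: "open (?B \<inter> cover -` U)"
    by (intro open_Int open_torus_box open_vimage_cover chart[OF assms])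
  have "?psi ` (?W \<inter> torus \<inter> inv (torus_map \<zeta>) -` U) = ?B \<inter> cover -` U"
    by (force simp: psi cover_def torus_exp_in_torus image_iff)
  with s have "smooth_on (?B \<inter> cover -` U) (\<phi> \<circ> inv (torus_map \<zeta>) \<circ> inv_into ?W ?psi)" by simp
  then have "smooth_on (?B \<inter> cover -` U) (\<lambda>x. \<phi> (cover x))"
    by (rule smooth_on_eq[OF _ op]) (simp add: inv cover_def)
  then show "\<exists>W. open W \<and> b \<in> W \<and> smooth_on W (\<lambda>x. \<phi> (cover x))"
    using op b mem_torus_box_self by blast
qed

lemma smooth_chart_cover_compose:
  fixes c :: "'b::real_normed_vector \<Rightarrow> real ^ 'm"
  assumes "(U, \<phi>) \<in> A" "open S" "smooth_on S c" "\<And>y. y \<in> S \<Longrightarrow> cover (c y) \<in> U"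
  shows "smooth_on S (\<lambda>y. \<phi> (cover (c y)))"
  by (rule smooth_on_compose[where g = "\<lambda>x. \<phi> (cover x)", OF assms(2) _ _ assms(3) smooth_cover_chart[OF assms(1)]])
    (use assms in \<open>auto intro: open_vimage_cover chart\<close>)

lemma continuous_on_lift: "continuous_on (patch b) (lift b)"
proof -
  have "continuous_on (U \<inter> patch b) (lift b)" if "(U, \<phi>) \<in> A" for U \<phi>
  proof -
    have "continuous_on U \<phi>" using chart(3)[OF that] by (simp add: homeomorphism_def)
    then have c: "continuous_on (U \<inter> patch b) \<phi>" by (rule continuous_on_subset) auto
    have "continuous_on (U \<inter> patch b) (\<lambda>a. lift b (inv_into U \<phi> (\<phi> a)))"
      by (rule continuous_on_compose2[OF smooth_on_imp_continuous_on[OF smooth_lift_chart[OF that]] c]) auto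
    then show ?thesis by (rule continuous_on_eq) (simp add: chart_inv[OF that])
  qed
  then have "continuous_on (\<Union>(U, \<phi>)\<in>A. U \<inter> patch b) (lift b)"
    by (intro continuous_on_open_UN) (auto intro: chart open_patch)
  then show ?thesis by (rule continuous_on_subset) (use ex_chart in blast)
qed

text \<open>The maps \<open>lift b\<close> are continuous local sections of \<open>cover\<close>,
  and the patches are open and cover the manifold.\<close>

lemma continuous_on_UNIV_coverI:
  assumes "continuous_on UNIV (\<lambda>x. f (cover x))"
  shows "continuous_on UNIV f"
proof -
  have "continuous_on (patch b) f" for b
  proof -
    have "continuous_on (patch b) (\<lambda>a. f (cover (lift b a)))"
      by (rule continuous_on_compose2[OF assms continuous_on_lift]) auto
    then show ?thesis by (rule continuous_on_eq) (simp add: patch_lift)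
  qed
  then have "continuous_on (\<Union>b. patch b) f"
    by (intro continuous_on_open_UN) (auto intro: open_patch)
  then show ?thesis by (rule continuous_on_subset) (metis cover_in_patch ex_cover UN_I UNIV_I subsetI)
qed

section \<open>Smooth functions tested on the cover\<close>

lemma smooth_fun_chart: "smooth_fun A f \<Longrightarrow> (U, \<phi>) \<in> A \<Longrightarrow> smooth_on (\<phi> ` U) (\<lambda>y. f (inv_into U \<phi> y))"
  using smooth_map_onD[of A eucl_atlas UNIV f U \<phi> UNIV "\<lambda>x. x"]
  by (simp add: smooth_fun_def eucl_atlas_def o_def)

text \<open>Seen in any chart, \<open>cover\<close> is smooth and has smooth local sections, so
  smoothness passes in both directions. From here on calculus with functions takes place on
  \<open>real ^ 'm\<close>.\<close>

lemma smooth_fun_iff: "smooth_fun A f \<longleftrightarrow> smooth_on UNIV (\<lambda>x. f (cover x))"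
proof
  assume f: "smooth_fun A f"
  show "smooth_on UNIV (\<lambda>x. f (cover x))"
  proof (rule smooth_on_locallyI)
    fix x
    obtain U \<phi> where U: "(U, \<phi>) \<in> A" "cover x \<in> U" by (rule ex_chart)
    have op: "open (cover -` U)" by (intro open_vimage_cover chart[OF U(1)])
    have "smooth_on (cover -` U) (\<lambda>x. f (inv_into U \<phi> (\<phi> (cover x))))"
      by (rule smooth_on_compose[where g = "\<lambda>y. f (inv_into U \<phi> y)", OF op chart(2)[OF U(1)] _ 
          smooth_cover_chart[OF U(1)] smooth_fun_chart[OF f U(1)]]) auto
    then have "smooth_on (cover -` U) (\<lambda>x. f (cover x))"
      by (rule smooth_on_eq[OF _ op]) (auto simp: chart_inv[OF U(1)])
    then show "\<exists>W. open W \<and> x \<in> W \<and> smooth_on W (\<lambda>x. f (cover x))"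
      using op U by blast
  qed
next
  assume f: "smooth_on UNIV (\<lambda>x. f (cover x))"
  have "smooth_on (\<phi> ` U) (\<lambda>y. f (inv_into U \<phi> y))" if U: "(U, \<phi>) \<in> A" for U \<phi>
  proof (rule smooth_on_locallyI)
    fix y assume "y \<in> \<phi> ` U"
    then obtain a where a: "a \<in> U" "y = \<phi> a" by auto
    obtain b where b: "cover b = a" by (rule ex_cover)
    let ?W = "\<phi> ` (U \<inter> patch b)"
    have op: "open ?W" by (intro chart_image_open U open_patch)
    have "smooth_on ?W (\<lambda>y. f (cover (lift b (inv_into U \<phi> y))))"
      by (rule smooth_on_compose[OF op open_UNIV _ smooth_lift_chart[OF U] f]) auto
    then have "smooth_on ?W (\<lambda>y. f (inv_into U \<phi> y))"
      by (rule smooth_on_eq[OF _ op]) (auto simp: chart_inv[OF U] patch_lift)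
    then show "\<exists>W. open W \<and> y \<in> W \<and> smooth_on W (\<lambda>y. f (inv_into U \<phi> y))"
      using op a b cover_in_patch by blast
  qed
  moreover have "continuous_on UNIV f"
    by (intro continuous_on_UNIV_coverI smooth_on_imp_continuous_on f)
  ultimately show "smooth_fun A f"
    by (auto simp: smooth_fun_def smooth_map_on_def eucl_atlas_def o_def)
qed

lemma smooth_fun_const: "smooth_fun A (\<lambda>a. c)"
  by (simp add: smooth_fun_iff smooth_on_const)

lemma smooth_fun_linear_compose:
  "bounded_linear L \<Longrightarrow> smooth_fun A f \<Longrightarrow> smooth_fun A (\<lambda>a. L (f a))"
  using smooth_on_linear_compose[of L UNIV "\<lambda>x. f (cover x)"] by (simp add: smooth_fun_iff)

lemma smooth_fun_add: "smooth_fun A f \<Longrightarrow> smooth_fun A g \<Longrightarrow> smooth_fun A (\<lambda>a. f a + g a)"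
  by (simp add: smooth_fun_iff smooth_on_add)

lemma smooth_fun_mult:
  fixes f g :: "'a \<Rightarrow> real"
  shows "smooth_fun A f \<Longrightarrow> smooth_fun A g \<Longrightarrow> smooth_fun A (\<lambda>a. f a * g a)"
  by (simp add: smooth_fun_iff smooth_on_mult)

lemma smooth_fun_diff:
  fixes f g :: "'a \<Rightarrow> real"
  assumes "smooth_fun A f" "smooth_fun A g" shows "smooth_fun A (\<lambda>a. f a - g a)"
  using smooth_fun_add[OF assms(1) smooth_fun_mult[OF smooth_fun_const[of "-1"] assms(2)]] by simp

lemma smooth_fun_sum: "(\<And>i. i \<in> I \<Longrightarrow> smooth_fun A (f i)) \<Longrightarrow> smooth_fun A (\<lambda>a. \<Sum>i\<in>I. f i a)"
  by (simp add: smooth_fun_iff smooth_on_sum)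

lemma smooth_fun_Re_zeta: "smooth_fun A (\<lambda>a. Re (\<zeta> i a))"
  and smooth_fun_Im_zeta: "smooth_fun A (\<lambda>a. Im (\<zeta> i a))"
  by (rule smooth_fun_linear_compose[OF bounded_linear_Re smooth_zeta] 
      smooth_fun_linear_compose[OF bounded_linear_Im smooth_zeta])+

end

section \<open>Tangent vectors\<close>

lemma vec_eq_sum_axis: "(w :: real ^ 'n) = (\<Sum>i\<in>UNIV. (w $ i) *\<^sub>R axis i 1)"
  by (simp add: vec_eq_iff axis_def if_distrib sum.delta' cong: if_cong)

lemma linear_sum_axis:
  fixes L :: "real ^ 'n \<Rightarrow> 'b::real_vector"
  assumes "linear L" shows "L w = (\<Sum>i\<in>UNIV. (w $ i) *\<^sub>R L (axis i 1))"
  by (subst vec_eq_sum_axis[of w]) (simp add: linear_sum[OF assms] linear_scale[OF assms])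

section \<open>Tangent vectors as directions on the cover\<close>

context torus_manifold
begin

text \<open>The image of the direction \<open>w\<close> under the differential of
  \<open>cover\<close> at \<open>x\<close>. The value 0 on nonsmooth functions agrees with the
  convention in \<open>velocity\<close>.\<close>

definition tvec :: "real ^ 'm \<Rightarrow> real ^ 'm \<Rightarrow> 'a tvec" where
  "tvec x w = (\<lambda>f. if smooth_fun A f then frechet_derivative (\<lambda>y. f (cover y)) (at x) w else 0)"

lemma smooth_fun_has_derivative:
  "smooth_fun A f \<Longrightarrow> ((\<lambda>y. f (cover y)) has_derivative frechet_derivative (\<lambda>y. f (cover y)) (at x)) (at x)"
  by (simp add: smooth_fun_iff smooth_on_has_derivative)

lemma tvec_eqI: "smooth_fun A f \<Longrightarrow> ((\<lambda>y. f (cover y)) has_derivative D) (at x) \<Longrightarrow> tvec x w f = D w"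
  using frechet_derivative_eqI[of "\<lambda>y. f (cover y)" D x] by (simp add: tvec_def)

text \<open>Agreement near time 0 is all that can be asked, since a curve is lifted to the cover
  only while it stays in one patch.\<close>

lemma velocity_eq_tvec:
  assumes "(\<gamma> has_vector_derivative w) (at 0)" "\<gamma> 0 = x" "\<forall>\<^sub>F t in nhds 0. c t = cover (\<gamma> t)"
  shows "velocity A c = tvec x w"
proof
  fix f
  show "velocity A c f = tvec x w f"
  proof (cases "smooth_fun A f")
    case True
    let ?D = "frechet_derivative (\<lambda>y. f (cover y)) (at x)"
    have D: "((\<lambda>y. f (cover y)) has_derivative ?D) (at (\<gamma> 0))"
      using smooth_fun_has_derivative[OF True] assms(2) by simp
    have "((\<lambda>t. f (cover (\<gamma> t))) has_derivative (\<lambda>s. ?D (s *\<^sub>R w))) (at 0)"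
      by (rule has_derivative_compose[OF assms(1)[unfolded has_vector_derivative_def] D])
    then have "((\<lambda>t. f (cover (\<gamma> t))) has_real_derivative ?D w) (at 0)"
      using has_derivative_linear[OF D] by (simp add: has_field_derivative_def linear_scale mult_commute_abs)
    moreover have "\<forall>\<^sub>F t in nhds 0. f (c t) = f (cover (\<gamma> t))"
      using assms(3) by eventually_elim simp
    ultimately have "((\<lambda>t. f (c t)) has_real_derivative ?D w) (at 0)"
      by (subst DERIV_cong_ev[OF refl _ refl])
    then show ?thesis using True by (simp add: velocity_def tvec_def DERIV_imp_deriv)
  qed (simp add: velocity_def tvec_def)
qed

lemma velocity_line: "velocity A (\<lambda>t. cover (x + t *\<^sub>R w)) = tvec x w"
  by (rule velocity_eq_tvec[where \<gamma> = "\<lambda>t. x + t *\<^sub>R w"]) (auto intro!: derivative_eq_intros)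

lemma tvec_in_tangent_space: "tvec x w \<in> tangent_space A (cover x)"
proof -
  have "smooth_map_on eucl_atlas A {-1<..<1} (\<lambda>t. cover (x + t *\<^sub>R w))"
    unfolding smooth_map_on_def
  proof (intro conjI ballI, safe)
    show "continuous_on {-1<..<1} (\<lambda>t. cover (x + t *\<^sub>R w))"
      by (rule continuous_on_compose2[OF continuous_cover[of UNIV]]) (auto intro!: continuous_intros)
  next
    fix U :: "real set" and \<phi> :: "real \<Rightarrow> real" and V \<psi>
    assume eucl: "(U, \<phi>) \<in> eucl_atlas" and V: "(V, \<psi>) \<in> A"
    let ?l = "\<lambda>t::real. x + t *\<^sub>R w"
    let ?S = "{-1<..<1} \<inter> (\<lambda>t. cover (?l t)) -` V"
    have "continuous_on UNIV (\<lambda>t. cover (?l t))"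
      by (rule continuous_on_compose2[OF continuous_cover[of UNIV]]) (auto intro!: continuous_intros)
    then have op: "open ?S"
      using chart(1)[OF V] by (intro open_Int) (auto simp: continuous_on_open_vimage)
    have "smooth_on ?S (\<lambda>t. \<psi> (cover (?l t)))"
      by (rule smooth_chart_cover_compose[OF V op smooth_on_add[OF op smooth_on_const 
              smooth_on_bounded_linear[OF bounded_linear_scaleR_left op]]]) auto
    then show "smooth_on (\<phi> ` (U \<inter> {-1<..<1} \<inter> (\<lambda>t. cover (?l t)) -` V)) 
      (\<psi> \<circ> (\<lambda>t. cover (?l t)) \<circ> inv_into U \<phi>)"
      using eucl by (simp add: eucl_atlas_def o_def)
  qed
  then show ?thesis
    unfolding tangent_space_def velocity_line[symmetric]
    by (intro CollectI exI[of _ "\<lambda>t. cover (x + t *\<^sub>R w)"] exI[of _ 1]) auto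
qed

text \<open>A smooth curve stays in the patch about \<open>x\<close> for a short time and its lift
  has a derivative at 0, which is the direction. Conversely, straight lines upstairs realize every
  direction.\<close>

lemma tangent_space_cover: "tangent_space A (cover x) = range (tvec x)"
proof (intro subset_antisym subsetI)
  fix u assume "u \<in> tangent_space A (cover x)"
  then obtain c \<epsilon> where u: "u = velocity A c" and \<epsilon>: "\<epsilon> > 0" and c0: "c 0 = cover x"
    and c: "smooth_map_on eucl_atlas A {-\<epsilon><..<\<epsilon>} c"
    by (auto simp: tangent_space_def)
  obtain U \<phi> where U: "(U, \<phi>) \<in> A" "cover x \<in> U" by (rule ex_chart)
  let ?I = "{-\<epsilon><..<\<epsilon>}"
  have cont: "continuous_on ?I c" using c by (simp add: smooth_map_on_def)
  have "smooth_on (?I \<inter> c -` U) (\<lambda>t. \<phi> (c t))"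
    using smooth_map_onD[OF c _ U(1), of UNIV "\<lambda>x. x"] by (simp add: eucl_atlas_def o_def)
  then have s1: "smooth_on (?I \<inter> c -` (U \<inter> patch x)) (\<lambda>t. \<phi> (c t))"
    by (rule smooth_on_subset) auto
  have op: "open (?I \<inter> c -` (U \<inter> patch x))"
    using cont chart(1)[OF U(1)] open_patch by (intro continuous_open_preimage) auto
  have "smooth_on (?I \<inter> c -` (U \<inter> patch x)) (\<lambda>t. lift x (inv_into U \<phi> (\<phi> (c t))))"
    by (rule smooth_on_compose[OF op chart_image_open[OF U(1) open_patch] _ s1 smooth_lift_chart[OF U(1)]]) auto
  then have s2: "smooth_on (?I \<inter> c -` (U \<inter> patch x)) (\<lambda>t. lift x (c t))"
    by (rule smooth_on_eq[OF _ op]) (auto simp: chart_inv[OF U(1)])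
  have 0: "0 \<in> ?I \<inter> c -` (U \<inter> patch x)"
    using \<epsilon> c0 U cover_in_patch by simp
  obtain D where D: "((\<lambda>t. lift x (c t)) has_derivative D) (at 0)"
    using smooth_on_has_derivative[OF s2 0] by blast
  have "(\<lambda>t. t *\<^sub>R D 1) = D"
  proof
    fix t show "t *\<^sub>R D 1 = D t"
      using linear_scale[OF has_derivative_linear[OF D], of t 1] unfolding real_scaleR_def mult_1_right by (rule sym)
  qed
  then have "((\<lambda>t. lift x (c t)) has_vector_derivative D 1) (at 0)"
    using D by (simp add: has_vector_derivative_def)
  moreover have "lift x (c 0) = x" by (simp add: c0 lift_cover mem_torus_box_self)
  moreover have "\<forall>\<^sub>F t in nhds 0. c t = cover (lift x (c t))"
    by (rule eventually_mono[OF eventually_nhds_in_open[OF op 0]]) (auto simp: patch_lift)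
  ultimately have "u = tvec x (D 1)" unfolding u by (rule velocity_eq_tvec)
  then show "u \<in> range (tvec x)" by blast
qed (auto simp: tvec_in_tangent_space)

lemma tangent_spaceE:
  assumes "u \<in> tangent_space A a"
  obtains x w where "a = cover x" "u = tvec x w"
proof -
  obtain x where x: "cover x = a" by (rule ex_cover)
  then show ?thesis using assms tangent_space_cover[of x] that by auto
qed

text \<open>The form d\<theta>^i, written as the imaginary part of the conjugate of \<zeta>_i times
  d\<zeta>_i. The angle itself is not a global function, and tangent vectors act on real functions,
  so real and imaginary parts are used.\<close>

definition angle_form :: "'m \<Rightarrow> 'a \<Rightarrow> 'a tvec \<Rightarrow> real" where
  "angle_form i a u = Re (\<zeta> i a) * u (\<lambda>b. Im (\<zeta> i b)) - Im (\<zeta> i a) * u (\<lambda>b. Re (\<zeta> i b))"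

lemma tvec_Re_zeta: "tvec x w (\<lambda>b. Re (\<zeta> i b)) = - sin (x $ i) * w $ i"
  and tvec_Im_zeta: "tvec x w (\<lambda>b. Im (\<zeta> i b)) = cos (x $ i) * w $ i"
proof -
  have i: "((\<lambda>y. y $ i) has_derivative (\<lambda>y. y $ i)) (at x)"
    by (rule bounded_linear_imp_has_derivative) (rule bounded_linear_vec_nth)
  show "tvec x w (\<lambda>b. Re (\<zeta> i b)) = - sin (x $ i) * w $ i"
    by (rule tvec_eqI[OF smooth_fun_Re_zeta, where D = "\<lambda>w. - sin (x $ i) * w $ i"])
      (auto intro!: derivative_eq_intros i)
  show "tvec x w (\<lambda>b. Im (\<zeta> i b)) = cos (x $ i) * w $ i"
    by (rule tvec_eqI[OF smooth_fun_Im_zeta, where D = "\<lambda>w. cos (x $ i) * w $ i"])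
      (auto intro!: derivative_eq_intros i)
qed

lemma angle_form_tvec [simp]: "angle_form i (cover x) (tvec x w) = w $ i"
proof -
  have "angle_form i (cover x) (tvec x w) = ((cos (x $ i))\<^sup>2 + (sin (x $ i))\<^sup>2) * w $ i"
    unfolding angle_form_def tvec_Re_zeta tvec_Im_zeta zeta_cover cis.sel by algebra
  then show ?thesis by simp
qed

lemma tvec_lincomb: "(\<lambda>f. p * tvec x v f + q * tvec x w f) = tvec x (p *\<^sub>R v + q *\<^sub>R w)"
proof
  fix f show "p * tvec x v f + q * tvec x w f = tvec x (p *\<^sub>R v + q *\<^sub>R w) f"
  proof (cases "smooth_fun A f")
    case True
    then show ?thesis using has_derivative_linear[OF smooth_fun_has_derivative[OF True]]
      by (simp add: tvec_def linear_add linear_scale)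
  qed (simp add: tvec_def)
qed

lemma linear_tvec: "linear (\<lambda>w. tvec x w f)"
proof (cases "smooth_fun A f")
  case True
  then show ?thesis using has_derivative_linear[OF smooth_fun_has_derivative[OF True]]
    by (simp add: tvec_def[abs_def])
qed (simp add: tvec_def linear_zero)

lemma tvec_nonzero_iff: "tvec x w = (\<lambda>f. 0) \<longleftrightarrow> w = 0"
proof
  assume "tvec x w = (\<lambda>f. 0)"
  then have "angle_form i (cover x) (tvec x w) = 0" for i by (simp add: angle_form_def del: angle_form_tvec)
  then show "w = 0" by (simp add: vec_eq_iff)
next
  assume "w = 0"
  then show "tvec x w = (\<lambda>f. 0)" using linear_0[OF linear_tvec] by (auto simp: fun_eq_iff)
qed

lemma angle_field_cover: "angle_field A \<zeta> i (cover x) = tvec x (axis i 1)"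
proof -
  have "inv (torus_map \<zeta>) (\<chi> j. if j = i then cis t * \<zeta> j (cover x) else \<zeta> j (cover x)) 
    = cover (x + t *\<^sub>R axis i 1)" for t
    by (rule inv_torus_map_eqI) (auto simp: axis_def cis_mult add.commute)
  then show ?thesis by (simp add: angle_field_def velocity_line)
qed

lemma tangent_expand:
  assumes "u \<in> tangent_space A a"
  shows "u f = (\<Sum>i\<in>UNIV. angle_form i a u * angle_field A \<zeta> i a f)"
  using assms
proof (rule tangent_spaceE)
  fix x w assume "a = cover x" "u = tvec x w"
  then show ?thesis
    using linear_sum_axis[OF linear_tvec[of x f], of w] by (simp add: angle_field_cover)
qed

lemma tangent_combination:
  "(\<lambda>f. \<Sum>i\<in>UNIV. c i * angle_field A \<zeta> i (cover x) f) = tvec x (\<chi> i. c i)"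
proof
  fix f
  show "(\<Sum>i\<in>UNIV. c i * angle_field A \<zeta> i (cover x) f) = tvec x (\<chi> i. c i) f"
    using linear_sum_axis[OF linear_tvec[of x f], of "\<chi> i. c i"] by (simp add: angle_field_cover)
qed

lemma angle_form_combination:
  "angle_form i a (\<lambda>f. \<Sum>j\<in>UNIV. c j * angle_field A \<zeta> j a f) = c i"
proof -
  obtain x where "cover x = a" by (rule ex_cover)
  then show ?thesis using tangent_combination[of c x] by auto
qed

lemma angle_field_in_tangent_space: "angle_field A \<zeta> i a \<in> tangent_space A a"
proof -
  obtain x where "cover x = a" by (rule ex_cover)
  then show ?thesis using angle_field_cover[of i x] tvec_in_tangent_space by auto
qed

lemma linear_tangent_angle_form: "linear_tangent A a (angle_form i a)"
  unfolding linear_tangent_def by (simp add: angle_form_def algebra_simps)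

lemma linear_tangent_linear:
  assumes "linear_tangent A (cover x) l"
  shows "linear (\<lambda>w. l (tvec x w))"
proof (rule linearI)
  have *: "l (tvec x (p *\<^sub>R v + q *\<^sub>R w)) = p * l (tvec x v) + q * l (tvec x w)" for p q v w
    using assms unfolding linear_tangent_def tvec_lincomb[symmetric]
    by (metis tvec_in_tangent_space)
  show "l (tvec x (v + w)) = l (tvec x v) + l (tvec x w)" for v w
    using *[of 1 v 1 w] by simp
  show "l (tvec x (p *\<^sub>R v)) = p *\<^sub>R l (tvec x v)" for p v
    using *[of p v 0 0] by simp
qed

text \<open>Valid for any linear functional \<open>l\<close> on tangent vectors, not merely for
  evaluation at a function; uniqueness of the dual forms rests on it.\<close>

lemma linear_tangent_expand:
  assumes "linear_tangent A a l" "u \<in> tangent_space A a"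
  shows "l u = (\<Sum>i\<in>UNIV. angle_form i a u * l (angle_field A \<zeta> i a))"
  using assms(2)
proof (rule tangent_spaceE)
  fix x w assume "a = cover x" "u = tvec x w"
  then show ?thesis
    using linear_sum_axis[OF linear_tangent_linear[of x l], of w] assms(1) by (simp add: angle_field_cover)
qed

text \<open>Smoothness of both summands matters: a sum of two nonsmooth functions may be smooth,
  while each summand is sent to 0.\<close>

lemma tangent_add:
  assumes "u \<in> tangent_space A a" "smooth_fun A f" "smooth_fun A g"
  shows "u (\<lambda>b. f b + g b) = u f + u g"
  using assms(1)
proof (rule tangent_spaceE)
  fix x w assume "a = cover x" "u = tvec x w"
  moreover have "tvec x w (\<lambda>b. f b + g b) = frechet_derivative (\<lambda>y. f (cover y)) (at x) w + frechet_derivative (\<lambda>y. g (cover y)) (at x) w"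
    by (rule tvec_eqI) (intro smooth_fun_add assms has_derivative_add smooth_fun_has_derivative)+
  ultimately show ?thesis using assms by (simp add: tvec_def)
qed

lemma tangent_mult:
  assumes "u \<in> tangent_space A a" "smooth_fun A f" "smooth_fun A g"
  shows "u (\<lambda>b. f b * g b) = u f * g a + f a * u g"
  using assms(1)
proof (rule tangent_spaceE)
  fix x w assume "a = cover x" "u = tvec x w"
  moreover have "tvec x w (\<lambda>b. f b * g b) = f (cover x) * frechet_derivative (\<lambda>y. g (cover y)) (at x) w 
      + frechet_derivative (\<lambda>y. f (cover y)) (at x) w * g (cover x)"
    by (rule tvec_eqI[OF smooth_fun_mult[OF assms(2,3)] 
          has_derivative_mult[OF smooth_fun_has_derivative[OF assms(2)] smooth_fun_has_derivative[OF assms(3)]]])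
  ultimately show ?thesis using assms by (simp add: tvec_def)
qed

lemma tangent_const:
  assumes "u \<in> tangent_space A a"
  shows "u (\<lambda>b. c) = 0"
  using assms
proof (rule tangent_spaceE)
  fix x w assume "a = cover x" "u = tvec x w"
  moreover have "tvec x w (\<lambda>b. c) = 0"
    by (rule tvec_eqI[OF smooth_fun_const has_derivative_const])
  ultimately show ?thesis by simp
qed

lemma tangent_cmult:
  assumes "u \<in> tangent_space A a" "smooth_fun A f"
  shows "u (\<lambda>b. c * f b) = c * u f"
  using tangent_mult[OF assms(1) smooth_fun_const assms(2), of c] tangent_const[OF assms(1)] by simp

lemma tangent_sum:
  assumes "u \<in> tangent_space A a" "\<And>i. i \<in> I \<Longrightarrow> smooth_fun A (f i)"
  shows "u (\<lambda>b. \<Sum>i\<in>I. f i b) = (\<Sum>i\<in>I. u (f i))"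
proof (cases "finite I")
  case True
  then show ?thesis using assms(2)
  proof (induction I rule: finite_induct)
    case (insert j I)
    then have "u (\<lambda>b. f j b + (\<Sum>i\<in>I. f i b)) = u (f j) + u (\<lambda>b. \<Sum>i\<in>I. f i b)"
      by (intro tangent_add[OF assms(1)] smooth_fun_sum) auto
    then show ?case using insert by simp
  qed (simp add: tangent_const[OF assms(1)])
qed (simp add: tangent_const[OF assms(1)])

lemma tangent_nonsmooth:
  assumes "u \<in> tangent_space A a" "\<not> smooth_fun A f" shows "u f = 0"
  using assms by (auto elim!: tangent_spaceE simp: tvec_def)

section \<open>Vector fields in the angle frame\<close>

lemma smooth_fun_angle_field:
  assumes "smooth_fun A f" shows "smooth_fun A (\<lambda>a. angle_field A \<zeta> i a f)"
proof -
  have "smooth_on UNIV (\<lambda>x. frechet_derivative (\<lambda>y. f (cover y)) (at x) (axis i 1))"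
    using assms by (intro smooth_on_frechet_derivative) (simp add: smooth_fun_iff)
  then show ?thesis
    unfolding smooth_fun_iff[of "\<lambda>a. angle_field A \<zeta> i a f"] using assms by (simp add: angle_field_cover tvec_def)
qed

lemma smooth_vector_fieldD:
  assumes "smooth_vector_field A X"
  shows "X a \<in> tangent_space A a" "smooth_fun A f \<Longrightarrow> smooth_fun A (\<lambda>a. X a f)"
  using assms by (auto simp: smooth_vector_field_def)

lemma smooth_fun_angle_form:
  assumes "smooth_vector_field A X" shows "smooth_fun A (\<lambda>a. angle_form i a (X a))"
  unfolding angle_form_def
  by (intro smooth_fun_diff smooth_fun_mult smooth_fun_Re_zeta smooth_fun_Im_zeta smooth_vector_fieldD(2)[OF assms])

lemma smooth_vector_field_combination:
  assumes "\<And>i. smooth_fun A (c i)"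
  shows "smooth_vector_field A (\<lambda>a f. \<Sum>i\<in>UNIV. c i a * angle_field A \<zeta> i a f)"
  unfolding smooth_vector_field_def
proof (intro conjI allI impI)
  fix a
  obtain x where x: "cover x = a" by (rule ex_cover)
  then show "(\<lambda>f. \<Sum>i\<in>UNIV. c i a * angle_field A \<zeta> i a f) \<in> tangent_space A a"
    using tangent_combination[of "\<lambda>i. c i a" x] tvec_in_tangent_space[of x] by auto
qed (intro smooth_fun_sum smooth_fun_mult assms smooth_fun_angle_field)

text \<open>On the cover both sides are second partial derivatives of the pulled-back function,
  which are symmetric. For nonsmooth \<open>f\<close> the inner functions are the constant 0, and
  both sides vanish.\<close>

lemma angle_fields_commute:
  "angle_field A \<zeta> i a (\<lambda>b. angle_field A \<zeta> j b f) = angle_field A \<zeta> j a (\<lambda>b. angle_field A \<zeta> i b f)"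
proof (cases "smooth_fun A f")
  case True
  obtain x where x: "cover x = a" by (rule ex_cover)
  have "angle_field A \<zeta> i (cover x) (\<lambda>b. angle_field A \<zeta> j b f) =
    frechet_derivative (\<lambda>y. frechet_derivative (\<lambda>y. f (cover y)) (at y) (axis j 1)) (at x) (axis i 1)" for i j
    using smooth_fun_angle_field[OF True] True by (simp add: angle_field_cover tvec_def)
  moreover have "Ck_on 2 UNIV (\<lambda>y. f (cover y))" 
    using True by (simp add: smooth_fun_iff smooth_on_def)
  ultimately show ?thesis unfolding x[symmetric] using mixed_derivatives_commute by metis
next
  case False
  then have "angle_field A \<zeta> i = angle_field A \<zeta> i \<and> (\<lambda>b. angle_field A \<zeta> i b f) = (\<lambda>b. 0)" for i
    using tangent_nonsmooth[OF angle_field_in_tangent_space] by auto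
  then show ?thesis using tangent_const[OF angle_field_in_tangent_space] by simp
qed

end

section \<open>Translation flows\<close>

lemma smooth_map_onI:
  assumes "continuous_on S f"
    and "\<And>U \<phi> V \<psi>. (U, \<phi>) \<in> A \<Longrightarrow> (V, \<psi>) \<in> B \<Longrightarrow> smooth_on (\<phi> ` (U \<inter> S \<inter> f -` V)) (\<psi> \<circ> f \<circ> inv_into U \<phi>)"
  shows "smooth_map_on A B S f"
  unfolding smooth_map_on_def using assms by auto

section \<open>Translations of the torus transported to the manifold\<close>

context torus_manifold
begin

lemma inj_on_chart: "(U, \<phi>) \<in> A \<Longrightarrow> inj_on \<phi> U"
  by (rule inj_on_inverseI) (rule chart_inv)

definition shift :: "real ^ 'm \<Rightarrow> 'a \<Rightarrow> 'a" where
  "shift v a = inv (torus_map \<zeta>) (\<chi> j. cis (v $ j) * \<zeta> j a)"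

lemma shift_cover [simp]: "shift v (cover x) = cover (x + v)"
  unfolding shift_def by (rule inv_torus_map_eqI) (simp add: cis_mult add.commute)

lemma shift_patch: "a \<in> patch b \<Longrightarrow> shift v a = cover (lift b a + v)"
  by (metis patch_lift(1) shift_cover)

lemma shift_shift: "shift v (shift w a) = shift (w + v) a"
  by (rule ex_cover[of a]) (auto simp: add.assoc)

lemma shift_0: "shift 0 a = a"
  by (rule ex_cover[of a]) auto

text \<open>Treats the flow and a single translation at once by letting the translation vector
  depend linearly on a real parameter. On \<open>W b\<close> the starting point has a lift and the
  translated point lies in the target chart, so the map is \<open>cover\<close> after an
  addition.\<close>

lemma smooth_on_shift_chart:
  fixes L :: "real \<Rightarrow> real ^ 'm"
  assumes L: "bounded_linear L" and U: "(U, \<phi>) \<in> A" and V: "(V, \<psi>) \<in> A"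
  defines "W b \<equiv> UNIV \<times> \<phi> ` (U \<inter> patch b) \<inter> (\<lambda>(p, y). lift b (inv_into U \<phi> y) + L p) -` (cover -` V)"
  shows "open (W b)" "smooth_on (W b) (\<lambda>(p, y). \<psi> (shift (L p) (inv_into U \<phi> y)))"
proof -
  let ?S = "(UNIV :: real set) \<times> \<phi> ` (U \<inter> patch b)"
  let ?\<gamma> = "\<lambda>z :: real \<times> (real ^ 'm). lift b (inv_into U \<phi> (snd z)) + L (fst z)"
  have opS: "open ?S" by (intro open_Times open_UNIV chart_image_open U open_patch)
  have "smooth_on ?S (\<lambda>z. lift b (inv_into U \<phi> (snd z)))"
    by (rule smooth_on_compose[OF opS chart_image_open[OF U open_patch] _ 
          smooth_on_bounded_linear[OF bounded_linear_snd opS] smooth_lift_chart[OF U]]) auto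
  moreover have "smooth_on ?S (\<lambda>z. L (fst z))"
    by (rule smooth_on_bounded_linear[OF bounded_linear_compose[OF L bounded_linear_fst] opS])
  ultimately have \<gamma>: "smooth_on ?S ?\<gamma>" by (rule smooth_on_add[OF opS])
  have W: "W b = ?S \<inter> ?\<gamma> -` (cover -` V)" by (auto simp: W_def)
  show op: "open (W b)"
    unfolding W
    by (rule continuous_open_preimage[OF smooth_on_imp_continuous_on[OF \<gamma>] opS open_vimage_cover[OF chart(1)[OF V]]])
  have "smooth_on (W b) ?\<gamma>" by (rule smooth_on_subset[OF \<gamma>]) (simp add: W)
  then have "smooth_on (W b) (\<lambda>z. \<psi> (cover (?\<gamma> z)))"
    by (rule smooth_chart_cover_compose[OF V op]) (simp add: W)
  then show "smooth_on (W b) (\<lambda>(p, y). \<psi> (shift (L p) (inv_into U \<phi> y)))"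
    by (rule smooth_on_eq[OF _ op]) (auto simp: W chart_inv[OF U] shift_patch)
qed

lemma continuous_on_shift: "continuous_on UNIV (\<lambda>(t, a). shift (t *\<^sub>R w) a)"
proof -
  have "continuous_on (UNIV \<times> patch b) (\<lambda>(t, a). shift (t *\<^sub>R w) a)" for b
  proof -
    have "continuous_on (UNIV \<times> patch b) (\<lambda>z. cover (lift b (snd z) + fst z *\<^sub>R w))"
      by (rule continuous_on_compose2[OF continuous_cover[of UNIV]])
        (auto intro!: continuous_intros continuous_on_compose2[OF continuous_on_lift])
    then show ?thesis by (rule continuous_on_eq) (auto simp: shift_patch)
  qed
  then have "continuous_on (\<Union>b. UNIV \<times> patch b) (\<lambda>(t, a). shift (t *\<^sub>R w) a)"
    by (intro continuous_on_open_UN) (auto intro: open_patch open_Times)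
  then show ?thesis
  proof (rule continuous_on_subset)
    show "UNIV \<subseteq> (\<Union>b. (UNIV :: real set) \<times> patch b)"
    proof
      fix z :: "real \<times> 'a"
      obtain x where "cover x = snd z" by (rule ex_cover)
      then show "z \<in> (\<Union>b. UNIV \<times> patch b)"
        using cover_in_patch[of x] by (intro UN_I[of x]) (simp_all add: mem_Times_iff)
    qed
  qed
qed

lemma smooth_flow_shift: "smooth_flow A (\<lambda>t. shift (t *\<^sub>R w))"
  unfolding smooth_flow_def
proof (intro conjI allI)
  let ?F = "\<lambda>(t, a). shift (t *\<^sub>R w) a"
  show "smooth_map_on (prod_atlas eucl_atlas A) A UNIV ?F"
  proof (rule smooth_map_onI[OF continuous_on_shift])
    fix W :: "(real \<times> 'a) set" and \<kappa> :: "real \<times> 'a \<Rightarrow> real \<times> (real ^ 'm)" and V \<psi>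
    assume "(W, \<kappa>) \<in> prod_atlas eucl_atlas A" and V: "(V, \<psi>) \<in> A"
    then obtain U \<phi> where U: "(U, \<phi>) \<in> A" and W: "W = UNIV \<times> U" "\<kappa> = map_prod (\<lambda>x. x) \<phi>"
      by (auto simp: prod_atlas_def eucl_atlas_def)
    have inj: "inj_on \<kappa> W"
      unfolding W by (intro map_prod_inj_on inj_on_chart[OF U]) simp
    show "smooth_on (\<kappa> ` (W \<inter> UNIV \<inter> ?F -` V)) (\<psi> \<circ> ?F \<circ> inv_into W \<kappa>)"
    proof (rule smooth_on_locallyI)
      fix z assume "z \<in> \<kappa> ` (W \<inter> UNIV \<inter> ?F -` V)"
      then obtain t a where z: "z = (t, \<phi> a)" "a \<in> U" "shift (t *\<^sub>R w) a \<in> V" by (auto simp: W)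
      obtain b where b: "cover b = a" by (rule ex_cover)
      let ?N = "UNIV \<times> \<phi> ` (U \<inter> patch b) \<inter> (\<lambda>(p, y). lift b (inv_into U \<phi> y) + p *\<^sub>R w) -` (cover -` V)"
      note N = smooth_on_shift_chart[OF bounded_linear_scaleR_left[of w] U V, of b]
      have "inv_into W \<kappa> (p, \<phi> c) = (p, c)" if "c \<in> U" for p c
        using inv_into_f_f[OF inj, of "(p, c)"] that by (simp add: W)
      then have "smooth_on ?N (\<psi> \<circ> ?F \<circ> inv_into W \<kappa>)"
        by (intro smooth_on_eq[OF N(2) N(1)]) (auto simp: chart_inv[OF U])
      moreover have "z \<in> ?N"
        using z b cover_in_patch[of b] by (auto simp: chart_inv[OF U] lift_cover mem_torus_box_self shift_patch)
      ultimately show "\<exists>N. open N \<and> z \<in> N \<and> smooth_on N (\<psi> \<circ> ?F \<circ> inv_into W \<kappa>)"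
        using N(1) by blast
    qed
  qed
qed (simp_all add: shift_0 shift_shift scaleR_left_distrib add.commute)

lemma smooth_map_on_shift: "smooth_map_on A A UNIV (shift v)"
proof (rule smooth_map_onI)
  show "continuous_on UNIV (shift v)"
    using continuous_on_compose2[OF continuous_on_shift[of v], of UNIV "\<lambda>a. (1, a)"]
    by (simp add: continuous_on_Pair continuous_on_const continuous_on_id)
next
  fix U \<phi> V \<psi> assume U: "(U, \<phi>) \<in> A" and V: "(V, \<psi>) \<in> A"
  show "smooth_on (\<phi> ` (U \<inter> UNIV \<inter> shift v -` V)) (\<psi> \<circ> shift v \<circ> inv_into U \<phi>)"
  proof (rule smooth_on_locallyI)
    fix z assume "z \<in> \<phi> ` (U \<inter> UNIV \<inter> shift v -` V)"
    then obtain a where z: "z = \<phi> a" "a \<in> U" "shift v a \<in> V" by auto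
    obtain b where b: "cover b = a" by (rule ex_cover)
    let ?N = "UNIV \<times> \<phi> ` (U \<inter> patch b) \<inter> (\<lambda>(p, y). lift b (inv_into U \<phi> y) + p *\<^sub>R v) -` (cover -` V)"
    \<comment> \<open>The translation by \<open>v\<close> is the translation flow in direction
      \<open>v\<close> at parameter 1, so it inherits smoothness through this inclusion.\<close>
    let ?i = "\<lambda>y :: real ^ 'm. (1 :: real, y)"
    note N = smooth_on_shift_chart[OF bounded_linear_scaleR_left[of v] U V, of b]
    have op: "open (?i -` ?N)"
      by (rule continuous_open_vimage[OF N(1)]) (simp add: continuous_Pair)
    have i: "smooth_on (?i -` ?N) ?i"
    proof -
      have "smooth_on (?i -` ?N) (\<lambda>y. (1, 0) + (0, y))"
        by (intro smooth_on_add smooth_on_const smooth_on_bounded_linear op bounded_linear_Pair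
            bounded_linear_zero bounded_linear_ident)
      then show ?thesis by simp
    qed
    have "smooth_on (?i -` ?N) (\<lambda>y. (\<lambda>(p, y). \<psi> (shift (p *\<^sub>R v) (inv_into U \<phi> y))) (?i y))"
      by (rule smooth_on_compose[OF op N(1) _ i N(2)]) auto
    then have "smooth_on (?i -` ?N) (\<psi> \<circ> shift v \<circ> inv_into U \<phi>)"
      by (simp add: o_def)
    moreover have "z \<in> ?i -` ?N"
      using z b cover_in_patch[of b] by (auto simp: chart_inv[OF U] lift_cover mem_torus_box_self shift_patch)
    ultimately show "\<exists>N. open N \<and> z \<in> N \<and> smooth_on N (\<psi> \<circ> shift v \<circ> inv_into U \<phi>)"
      using op by blast
  qed
qed

lemma diffeomorphism_shift: "diffeomorphism A A UNIV UNIV (shift v)"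
proof -
  have 1: "shift (- v) (shift v a) = a" "shift v (shift (- v) a) = a" for a v
    by (simp_all add: shift_shift shift_0)
  then have "bij (shift v)" by (intro bij_betwI[where g = "shift (- v)"]) auto
  moreover have "inv (shift v) = shift (- v)"
    by (rule inv_equality) (use 1 in auto)
  ultimately show ?thesis by (simp add: diffeomorphism_def smooth_map_on_shift)
qed

text \<open>On the cover a shift adds a constant, and its differential is the identity.\<close>

lemma pushforward_shift: "pushforward A (shift v) (tvec x w) = tvec (x + v) w"
proof
  fix f
  show "pushforward A (shift v) (tvec x w) f = tvec (x + v) w f"
  proof (cases "smooth_fun A f")
    case True
    let ?D = "frechet_derivative (\<lambda>y. f (cover y)) (at (x + v))"
    have "smooth_on UNIV (\<lambda>y. f (cover (y + v)))"
      by (rule smooth_on_compose[of UNIV UNIV "\<lambda>y. y + v" "\<lambda>y. f (cover y)"])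
        (use True in \<open>auto simp: smooth_fun_iff intro!: smooth_on_add smooth_on_const smooth_on_ident\<close>)
    then have s: "smooth_fun A (f \<circ> shift v)" by (simp add: smooth_fun_iff)
    have "((\<lambda>y. f (cover (y + v))) has_derivative ?D) (at x)"
      by (rule has_derivative_compose[where g = "\<lambda>y. f (cover y)" and f = "\<lambda>y. y + v" and f' = "\<lambda>h. h", simplified])
        (auto intro!: derivative_eq_intros smooth_fun_has_derivative True)
    then have "tvec x w (f \<circ> shift v) = ?D w"
      by (intro tvec_eqI s) simp
    then show ?thesis using True by (simp add: pushforward_def tvec_def)
  qed (simp add: pushforward_def tvec_def)
qed

text \<open>\<open>velocity\<close> is built on \<open>deriv\<close>, which has a value even where
  there is no derivative. Genuine differentiability in time has to be extracted from joint
  smoothness in charts around \<open>a\<close> and \<open>\<Psi> t a\<close>.\<close>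

lemma smooth_flow_differentiable:
  assumes "smooth_flow A \<Psi>" "smooth_fun A (f :: 'a \<Rightarrow> real)"
  shows "(\<lambda>t. f (\<Psi> t a)) differentiable at t"
proof -
  let ?F = "\<lambda>(t, a). \<Psi> t a"
  have F: "smooth_map_on (prod_atlas eucl_atlas A) A UNIV ?F"
    using assms(1) by (simp add: smooth_flow_def)
  obtain U \<phi> where U: "(U, \<phi>) \<in> A" "a \<in> U" by (rule ex_chart)
  obtain V \<psi> where V: "(V, \<psi>) \<in> A" "\<Psi> t a \<in> V" by (rule ex_chart)
  let ?W = "(UNIV :: real set) \<times> U" and ?\<kappa> = "map_prod (\<lambda>x. x) \<phi>"
  have "(?W, ?\<kappa>) \<in> prod_atlas eucl_atlas A"
    using U by (auto simp: prod_atlas_def eucl_atlas_def)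
  note s = smooth_map_onD[OF F this V(1)]
  have inj: "inj_on ?\<kappa> ?W"
    by (intro map_prod_inj_on inj_on_chart[OF U(1)]) simp
  have inv: "inv_into ?W ?\<kappa> (p, \<phi> a) = (p, a)" for p
    using inv_into_f_f[OF inj, of "(p, a)"] U by simp
  have mem: "(t, \<phi> a) \<in> ?\<kappa> ` (?W \<inter> UNIV \<inter> ?F -` V)"
    using U V by (intro image_eqI[of _ _ "(t, a)"]) auto
  obtain D where D: "((\<psi> \<circ> ?F \<circ> inv_into ?W ?\<kappa>) has_derivative D) (at (t, \<phi> a))"
    using smooth_on_has_derivative[OF s mem] by blast
  have "((\<lambda>r. (\<psi> \<circ> ?F \<circ> inv_into ?W ?\<kappa>) (r, \<phi> a)) has_derivative (\<lambda>r. D (r, 0))) (at t)"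
    by (rule has_derivative_compose[where f = "\<lambda>r. (r, \<phi> a)" and f' = "\<lambda>r. (r, 0)", OF _ D])
      (auto intro!: derivative_eq_intros)
  then have 1: "((\<lambda>r. \<psi> (\<Psi> r a)) has_derivative (\<lambda>r. D (r, 0))) (at t)"
    by (simp add: inv)
  have "smooth_on (\<psi> ` V) (\<lambda>y. f (inv_into V \<psi> y))" by (rule smooth_fun_chart[OF assms(2) V(1)])
  from smooth_on_has_derivative[OF this] V(2) obtain D' 
    where D': "((\<lambda>y. f (inv_into V \<psi> y)) has_derivative D') (at (\<psi> (\<Psi> t a)))" by blast
  have 2: "((\<lambda>r. f (inv_into V \<psi> (\<psi> (\<Psi> r a)))) has_derivative (\<lambda>r. D' (D (r, 0)))) (at t)"
    by (rule has_derivative_compose[OF 1 D'])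
  have "continuous_on UNIV (\<lambda>r. \<Psi> r a)"
    using F continuous_on_compose2[of UNIV ?F UNIV "\<lambda>r. (r, a)"]
    by (simp add: smooth_map_on_def continuous_on_Pair continuous_on_const continuous_on_id)
  then have "open ((\<lambda>r. \<Psi> r a) -` V)" using chart(1)[OF V(1)] by (simp add: continuous_on_open_vimage)
  then have "((\<lambda>r. f (\<Psi> r a)) has_derivative (\<lambda>r. D' (D (r, 0)))) (at t)"
    by (rule has_derivative_transform_within_open[OF 2]) (use V in \<open>auto simp: chart_inv[OF V(1)]\<close>)
  then show ?thesis by (rule differentiableI)
qed

text \<open>Integrating factor: multiplied by \<open>cis (- (t * c))\<close> the solution has
  derivative zero.\<close>

lemma rotation_ode_solution:
  assumes "\<And>t. ((\<lambda>t. h t) has_vector_derivative \<i> * c * h t) (at t)"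
  shows "h t = cis (t * c) * h 0"
proof -
  let ?k = "\<lambda>t. cis (- (t * c)) * h t"
  have "(?k has_derivative (\<lambda>s. 0)) (at t)" for t
  proof -
    have "((\<lambda>t. cis (- (t * c))) has_vector_derivative (- c) *\<^sub>R (\<i> * cis (- (t * c)))) (at t)"
      unfolding cis_conv_exp
      by (auto intro!: derivative_eq_intros has_vector_derivative_real_field simp: scaleR_conv_of_real)
    then have "(?k has_vector_derivative cis (- (t * c)) * (\<i> * c * h t) + (- c) *\<^sub>R (\<i> * cis (- (t * c))) * h t) (at t)"
      by (rule has_vector_derivative_mult[OF _ assms])
    then show ?thesis by (simp add: has_vector_derivative_def scaleR_conv_of_real)
  qed
  then obtain k where k: "\<And>t. ?k t = k"
    using has_derivative_zero_constant[of UNIV ?k] by auto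
  have "h t = cis (t * c) * ?k t" by (simp add: mult.assoc[symmetric] cis_mult)
  also have "?k t = ?k 0" using k[of t] k[of 0] by (simp only:)
  finally show ?thesis by simp
qed

text \<open>The group law carries the velocity at time 0 to every time and yields a linear equation
  for \<zeta>_i along the orbit. As the \<zeta>_i separate points, this identifies
  \<open>\<Phi>\<close> and also every flow generated by v_i, without a general uniqueness theorem
  for integral curves.\<close>

lemma zeta_flow_of_velocity:
  assumes \<Psi>: "smooth_flow A \<Psi>" and gen: "\<And>a. velocity A (\<lambda>t. \<Psi> t a) (\<lambda>b. Re (\<zeta> i b)) = - (w $ i) * Im (\<zeta> i a)"
    "\<And>a. velocity A (\<lambda>t. \<Psi> t a) (\<lambda>b. Im (\<zeta> i b)) = w $ i * Re (\<zeta> i a)"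
  shows "\<zeta> i (\<Psi> t a) = cis (t * w $ i) * \<zeta> i a"
proof -
  have add: "\<Psi> (s + t) a = \<Psi> s (\<Psi> t a)" and zero: "\<Psi> 0 a = a" for s t a
    using \<Psi> by (auto simp: smooth_flow_def)
  have der: "((\<lambda>r. f (\<Psi> r a)) has_real_derivative velocity A (\<lambda>s. \<Psi> s (\<Psi> t a)) f) (at t)" 
    if f: "smooth_fun A f" for f t
  proof -
    have "(\<lambda>s. f (\<Psi> s (\<Psi> t a))) differentiable at 0"
      by (rule smooth_flow_differentiable[OF \<Psi> f])
    then have "((\<lambda>s. f (\<Psi> s (\<Psi> t a))) has_real_derivative velocity A (\<lambda>s. \<Psi> s (\<Psi> t a)) f) (at 0)"
      using f by (simp add: velocity_def DERIV_deriv_iff_real_differentiable)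
    then have "((\<lambda>s. f (\<Psi> (s + t) a)) has_real_derivative velocity A (\<lambda>s. \<Psi> s (\<Psi> t a)) f) (at 0)"
      by (simp add: add)
    then show ?thesis using DERIV_shift[of "\<lambda>r. f (\<Psi> r a)" _ 0 t] by simp
  qed
  have "((\<lambda>r. \<zeta> i (\<Psi> r a)) has_vector_derivative \<i> * (w $ i) * \<zeta> i (\<Psi> t a)) (at t)" for t
  proof -
    have re: "((\<lambda>r. Re (\<zeta> i (\<Psi> r a))) has_real_derivative - (w $ i) * Im (\<zeta> i (\<Psi> t a))) (at t)"
      using der[OF smooth_fun_Re_zeta, of i t] by (simp only: gen)
    have im: "((\<lambda>r. Im (\<zeta> i (\<Psi> r a))) has_real_derivative w $ i * Re (\<zeta> i (\<Psi> t a))) (at t)"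
      using der[OF smooth_fun_Im_zeta, of i t] by (simp only: gen)
    show ?thesis
      using re im by (simp add: has_vector_derivative_complex_iff has_real_derivative_iff_has_vector_derivative)
  qed
  from rotation_ode_solution[OF this] show ?thesis by (simp add: zero)
qed

end

section \<open>Translation-invariant metrics\<close>

context torus_manifold
begin

text \<open>The coefficients refer to the angle frame and not to the fields v_i.\<close>

definition const_metric :: "('m \<Rightarrow> 'm \<Rightarrow> real) \<Rightarrow> 'a metric_tensor" where
  "const_metric C a u w = (\<Sum>i\<in>UNIV. \<Sum>j\<in>UNIV. C i j * angle_form i a u * angle_form j a w)"

lemma const_metric_tvec:
  "const_metric C (cover x) (tvec x u) (tvec x w) = (\<Sum>i\<in>UNIV. \<Sum>j\<in>UNIV. C i j * u $ i * w $ j)"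
  by (simp add: const_metric_def)

lemma smooth_fun_const_metric:
  assumes "smooth_vector_field A X" "smooth_vector_field A Y"
  shows "smooth_fun A (\<lambda>a. const_metric C a (X a) (Y a))"
  unfolding const_metric_def
  by (intro smooth_fun_sum smooth_fun_mult smooth_fun_const smooth_fun_angle_form assms)

lemma linear_tangent_const_metric: "linear_tangent A a (const_metric C a u)"
  unfolding linear_tangent_def
proof (intro ballI allI)
  fix v w p q
  have "angle_form j a (\<lambda>f. p * v f + q * w f) = p * angle_form j a v + q * angle_form j a w" for j
    by (simp add: angle_form_def algebra_simps)
  then show "const_metric C a u (\<lambda>f. p * v f + q * w f) = p * const_metric C a u v + q * const_metric C a u w"
    by (simp add: const_metric_def sum_distrib_left sum.distrib[symmetric] algebra_simps)
qed

lemma riemannian_const_metric: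
  assumes sym: "\<And>i j. C i j = C j i"
    and pos: "\<And>w :: real ^ 'm. w \<noteq> 0 \<Longrightarrow> (\<Sum>i\<in>UNIV. \<Sum>j\<in>UNIV. C i j * w $ i * w $ j) > 0"
  shows "riemannian_metric A (const_metric C)"
  unfolding riemannian_metric_def
proof (intro conjI allI ballI impI)
  fix a u assume "u \<in> tangent_space A a" "u \<noteq> (\<lambda>f. 0)"
  then show "const_metric C a u u > 0"
    by (elim tangent_spaceE) (auto simp: const_metric_tvec tvec_nonzero_iff intro: pos)
next
  fix a u w
  show "const_metric C a u w = const_metric C a w u"
    unfolding const_metric_def by (subst sum.swap) (simp add: sym mult.commute mult.left_commute)
qed (auto intro: linear_tangent_const_metric smooth_fun_const_metric)

text \<open>Angle components are unchanged by a translation and the coefficients do not depend on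
  the point.\<close>

lemma isometry_shift: "isometry A (const_metric C) (shift v)"
  unfolding isometry_def
proof (intro conjI allI ballI diffeomorphism_shift)
  fix a u w assume u: "u \<in> tangent_space A a" and w: "w \<in> tangent_space A a"
  obtain x where x: "cover x = a" by (rule ex_cover)
  obtain u' w' where "u = tvec x u'" "w = tvec x w'"
    using u w tangent_space_cover[of x] x by auto
  then show "const_metric C (shift v a) (pushforward A (shift v) u) (pushforward A (shift v) w) = const_metric C a u w"
    by (simp add: x[symmetric] pushforward_shift const_metric_tvec)
qed

section \<open>The connection for which the angle frame is parallel\<close>

definition connection :: "('a \<Rightarrow> 'a tvec) \<Rightarrow> ('a \<Rightarrow> 'a tvec) \<Rightarrow> 'a \<Rightarrow> 'a tvec" where
  "connection X Y = (\<lambda>a f. \<Sum>i\<in>UNIV. X a (\<lambda>b. angle_form i b (Y b)) * angle_field A \<zeta> i a f)"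

lemma angle_form_connection: "angle_form i a (connection X Y a) = X a (\<lambda>b. angle_form i b (Y b))"
  unfolding connection_def by (rule angle_form_combination)

lemma smooth_connection:
  assumes "smooth_vector_field A X" "smooth_vector_field A Y"
  shows "smooth_vector_field A (connection X Y)"
  unfolding connection_def
  by (intro smooth_vector_field_combination smooth_vector_fieldD(2)[OF assms(1)] smooth_fun_angle_form assms(2))

text \<open>Separates the second derivative into the covariant derivative and the Hessian in the
  angle frame. The Hessian part is symmetric in \<open>X\<close> and \<open>Y\<close>, so it drops
  out of the bracket.\<close>

lemma second_derivative_expand:
  assumes X: "smooth_vector_field A X" and Y: "smooth_vector_field A Y" and f: "smooth_fun A f"
  shows "X a (\<lambda>b. Y b f) = connection X Y a f + (\<Sum>i\<in>UNIV. \<Sum>j\<in>UNIV.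
    angle_form i a (Y a) * angle_form j a (X a) * angle_field A \<zeta> j a (\<lambda>b. angle_field A \<zeta> i b f))"
proof -
  have "X a (\<lambda>b. Y b f) = X a (\<lambda>b. \<Sum>i\<in>UNIV. angle_form i b (Y b) * angle_field A \<zeta> i b f)"
    using tangent_expand[OF smooth_vector_fieldD(1)[OF Y]] by (intro arg_cong[of _ _ "X a"]) blast
  also have "\<dots> = (\<Sum>i\<in>UNIV. X a (\<lambda>b. angle_form i b (Y b) * angle_field A \<zeta> i b f))"
    by (intro tangent_sum[OF smooth_vector_fieldD(1)[OF X]] smooth_fun_mult smooth_fun_angle_form Y 
        smooth_fun_angle_field f)
  also have "\<dots> = (\<Sum>i\<in>UNIV. X a (\<lambda>b. angle_form i b (Y b)) * angle_field A \<zeta> i a f 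
      + angle_form i a (Y a) * X a (\<lambda>b. angle_field A \<zeta> i b f))"
    by (intro sum.cong refl tangent_mult[OF smooth_vector_fieldD(1)[OF X]] smooth_fun_angle_form Y 
        smooth_fun_angle_field f)
  also have "\<dots> = connection X Y a f + (\<Sum>i\<in>UNIV. angle_form i a (Y a) * X a (\<lambda>b. angle_field A \<zeta> i b f))"
    by (simp add: connection_def sum.distrib)
  also have "(\<Sum>i\<in>UNIV. angle_form i a (Y a) * X a (\<lambda>b. angle_field A \<zeta> i b f)) = (\<Sum>i\<in>UNIV. \<Sum>j\<in>UNIV.
    angle_form i a (Y a) * angle_form j a (X a) * angle_field A \<zeta> j a (\<lambda>b. angle_field A \<zeta> i b f))"
    by (subst tangent_expand[OF smooth_vector_fieldD(1)[OF X]]) (simp add: sum_distrib_left mult.assoc)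
  finally show ?thesis .
qed

lemma connection_torsion_free:
  assumes X: "smooth_vector_field A X" and Y: "smooth_vector_field A Y"
  shows "(\<lambda>a f. connection X Y a f - connection Y X a f) = lie_bracket X Y"
proof (intro ext)
  fix a f
  show "connection X Y a f - connection Y X a f = lie_bracket X Y a f"
  proof (cases "smooth_fun A f")
    case True
    let ?S = "\<lambda>X Y. \<Sum>i\<in>UNIV. \<Sum>j\<in>UNIV. angle_form i a (Y a) * angle_form j a (X a) 
      * angle_field A \<zeta> j a (\<lambda>b. angle_field A \<zeta> i b f)"
    have "?S Y X = (\<Sum>i\<in>UNIV. \<Sum>j\<in>UNIV. angle_form j a (X a) * angle_form i a (Y a) 
        * angle_field A \<zeta> i a (\<lambda>b. angle_field A \<zeta> j b f))"
      by (rule sum.swap)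
    also have "\<dots> = ?S X Y"
      by (intro sum.cong refl) (simp only: mult.commute angle_fields_commute[of _ a _ f])
    finally have "?S Y X = ?S X Y" .
    then show ?thesis
      using second_derivative_expand[OF X Y True, of a] second_derivative_expand[OF Y X True, of a]
      by (simp add: lie_bracket_def)
  next
    \<comment> \<open>Equality of vector fields is equality on all functions. On nonsmooth ones
      every field involved gives 0, and so does its derivative.\<close>
    case False
    have "X b f = 0" "Y b f = 0" "angle_field A \<zeta> i b f = 0" for b i
      by (rule tangent_nonsmooth[OF _ False] smooth_vector_fieldD(1)[OF X] smooth_vector_fieldD(1)[OF Y]
        angle_field_in_tangent_space)+
    then show ?thesis
      using tangent_const[OF smooth_vector_fieldD(1)[OF X]] tangent_const[OF smooth_vector_fieldD(1)[OF Y]]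
      by (simp add: lie_bracket_def connection_def)
  qed
qed

lemma connection_metric:
  assumes X: "smooth_vector_field A X" and Y: "smooth_vector_field A Y" and Z: "smooth_vector_field A Z"
  shows "X a (\<lambda>b. const_metric C b (Y b) (Z b)) = 
    const_metric C a (connection X Y a) (Z a) + const_metric C a (Y a) (connection X Z a)"
proof -
  note Xa = smooth_vector_fieldD(1)[OF X, of a]
  note sm = smooth_fun_angle_form[OF Y] smooth_fun_angle_form[OF Z]
  have "X a (\<lambda>b. C i j * angle_form i b (Y b) * angle_form j b (Z b)) =
    C i j * X a (\<lambda>b. angle_form i b (Y b)) * angle_form j a (Z a) +
    C i j * angle_form i a (Y a) * X a (\<lambda>b. angle_form j b (Z b))" for i j
  proof -
    have "X a (\<lambda>b. C i j * angle_form i b (Y b) * angle_form j b (Z b)) 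
      = X a (\<lambda>b. C i j * (angle_form i b (Y b) * angle_form j b (Z b)))"
      by (simp only: mult.assoc)
    also have "\<dots> = C i j * X a (\<lambda>b. angle_form i b (Y b) * angle_form j b (Z b))"
      by (rule tangent_cmult[OF Xa smooth_fun_mult[OF sm]])
    also have "X a (\<lambda>b. angle_form i b (Y b) * angle_form j b (Z b)) = 
      X a (\<lambda>b. angle_form i b (Y b)) * angle_form j a (Z a) + angle_form i a (Y a) * X a (\<lambda>b. angle_form j b (Z b))"
      by (rule tangent_mult[OF Xa sm])
    finally show ?thesis by (simp only: distrib_left mult.assoc)
  qed
  moreover have "X a (\<lambda>b. const_metric C b (Y b) (Z b)) = 
    (\<Sum>i\<in>UNIV. X a (\<lambda>b. \<Sum>j\<in>UNIV. C i j * angle_form i b (Y b) * angle_form j b (Z b)))"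
    unfolding const_metric_def by (intro tangent_sum[OF Xa] smooth_fun_sum smooth_fun_mult smooth_fun_const sm)
  moreover have "X a (\<lambda>b. \<Sum>j\<in>UNIV. C i j * angle_form i b (Y b) * angle_form j b (Z b)) =
    (\<Sum>j\<in>UNIV. X a (\<lambda>b. C i j * angle_form i b (Y b) * angle_form j b (Z b)))" for i
    by (intro tangent_sum[OF Xa] smooth_fun_mult smooth_fun_const sm)
  ultimately show ?thesis
    by (simp only: const_metric_def angle_form_connection sum.distrib)
qed

lemma levi_civita_connection: "levi_civita A (const_metric C) connection"
  unfolding levi_civita_def
proof (intro allI impI, elim conjE, intro conjI allI)
  fix X Y Z and h :: "'a \<Rightarrow> real"
  assume X: "smooth_vector_field A X" and Y: "smooth_vector_field A Y" and Z: "smooth_vector_field A Z"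
    and h: "smooth_fun A h"
  note sm = smooth_fun_angle_form[OF Y] smooth_fun_angle_form[OF Z]
  note Xa = smooth_vector_fieldD(1)[OF X]
  show "smooth_vector_field A (connection X Y)" by (rule smooth_connection[OF X Y])
  show "connection (\<lambda>a f. X a f + Y a f) Z = (\<lambda>a f. connection X Z a f + connection Y Z a f)"
    by (simp add: connection_def distrib_right sum.distrib)
  show "connection (\<lambda>a f. h a * X a f) Y = (\<lambda>a f. h a * connection X Y a f)"
    by (simp add: connection_def sum_distrib_left mult.assoc)
  show "connection X (\<lambda>a f. Y a f + Z a f) = (\<lambda>a f. connection X Y a f + connection X Z a f)"
  proof -
    have "angle_form i b (\<lambda>f. Y b f + Z b f) = angle_form i b (Y b) + angle_form i b (Z b)" for i b
      by (simp add: angle_form_def algebra_simps)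
    then show ?thesis
      by (simp add: connection_def tangent_add[OF Xa sm] distrib_right sum.distrib)
  qed
  show "connection X (\<lambda>a f. h a * Y a f) = (\<lambda>a f. X a h * Y a f + h a * connection X Y a f)"
  proof (intro ext)
    fix a f
    have "angle_form i b (\<lambda>f. h b * Y b f) = h b * angle_form i b (Y b)" for i b
      by (simp add: angle_form_def algebra_simps)
    then have "connection X (\<lambda>a f. h a * Y a f) a f = 
      X a h * (\<Sum>i\<in>UNIV. angle_form i a (Y a) * angle_field A \<zeta> i a f) + h a * connection X Y a f"
      by (simp add: connection_def tangent_mult[OF Xa h sm(1)] distrib_right sum.distrib sum_distrib_left mult.assoc)
    then show "connection X (\<lambda>a f. h a * Y a f) a f = X a h * Y a f + h a * connection X Y a f"
      by (simp only: tangent_expand[OF smooth_vector_fieldD(1)[OF Y], symmetric])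
  qed
  show "(\<lambda>a f. connection X Y a f - connection Y X a f) = lie_bracket X Y"
    by (rule connection_torsion_free[OF X Y])
  show "X a (\<lambda>b. const_metric C b (Y b) (Z b)) = 
    const_metric C a (connection X Y a) (Z a) + const_metric C a (Y a) (connection X Z a)" for a
    by (rule connection_metric[OF X Y Z])
qed

text \<open>The connection applies fields directly to component functions, so an iterated covariant
  derivative of \<open>Z\<close> has components X(Y(Z^i)). The bracket is by definition the
  commutator of these operators, which cancels the curvature.\<close>

lemma flat_const_metric: "flat_metric A (const_metric C)"
  unfolding flat_metric_def
proof (intro exI[of _ connection] conjI levi_civita_connection allI impI)
  fix X Y Z a f
  show "connection X (connection Y Z) a f - connection Y (connection X Z) a f
    - connection (lie_bracket X Y) Z a f = 0"
    unfolding connection_def[of X "connection Y Z"] connection_def[of Y "connection X Z"] 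
      connection_def[of "lie_bracket X Y"] angle_form_connection
    by (simp add: lie_bracket_def left_diff_distrib sum_subtractf)
qed

end

section \<open>Trigonometric polynomials\<close>

lemma prod_cis: "finite I \<Longrightarrow> (\<Prod>i\<in>I. cis (f i)) = cis (\<Sum>i\<in>I. f i)"
  by (induction I rule: finite_induct) (simp_all add: cis_mult)

section \<open>Characters and their linear span\<close>

context torus_manifold
begin

definition character :: "('m \<Rightarrow> int) \<Rightarrow> 'a \<Rightarrow> complex" where
  "character k a = (\<Prod>i\<in>UNIV. \<zeta> i a powi k i)"

lemma character_cover: "character k (cover x) = cis (\<Sum>i\<in>UNIV. of_int (k i) * x $ i)"
  by (simp add: character_def cis_power_int prod_cis)

lemma character_0: "character (\<lambda>i. 0) a = 1"
  by (simp add: character_def)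

lemma zeta_nonzero: "\<zeta> i a \<noteq> 0"
  using norm_zeta[of i a] by (metis norm_zero zero_neq_one)

lemma character_add: "character (\<lambda>i. k i + l i) a = character k a * character l a"
  by (simp add: character_def power_int_add zeta_nonzero prod.distrib)

lemma continuous_character: "continuous_on UNIV (character k)"
proof (rule continuous_on_UNIV_coverI)
  show "continuous_on UNIV (\<lambda>x. character k (cover x))"
    unfolding character_cover by (intro continuous_intros)
qed

lemma character_unit: "character (\<lambda>j. if j = i then 1 else 0) a = \<zeta> i a"
proof -
  have "character (\<lambda>j. if j = i then 1 else 0) a = (\<Prod>j\<in>UNIV. if j = i then \<zeta> j a else 1)"
    unfolding character_def by (intro prod.cong) auto
  then show ?thesis by simp
qed

lemma character_minus_unit: "character (\<lambda>j. if j = i then - 1 else 0) a = cnj (\<zeta> i a)"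
proof -
  have "character (\<lambda>j. if j = i then - 1 else 0) a = (\<Prod>j\<in>UNIV. if j = i then inverse (\<zeta> j a) else 1)"
    unfolding character_def by (intro prod.cong) (auto simp: power_int_minus)
  moreover have "inverse (\<zeta> i a) = cnj (\<zeta> i a)"
    using divide_conv_cnj[OF norm_zeta[of i a], of 1] by (simp add: inverse_eq_divide)
  ultimately show ?thesis by simp
qed

text \<open>Finite linear combinations of characters as an inductive predicate: a statement about
  integrals or averages then needs only the case of one character and additivity.\<close>

inductive trig_poly :: "('a \<Rightarrow> complex) \<Rightarrow> bool" where
  monomial: "trig_poly (\<lambda>a. c * character k a)"
| add: "trig_poly f \<Longrightarrow> trig_poly g \<Longrightarrow> trig_poly (\<lambda>a. f a + g a)"

lemma trig_poly_const: "trig_poly (\<lambda>a. c)"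
  using monomial[of c "\<lambda>i. 0"] by (simp add: character_0)

lemma trig_poly_mult:
  assumes "trig_poly f" "trig_poly g"
  shows "trig_poly (\<lambda>a. f a * g a)"
  using assms(1)
proof induction
  case (monomial c k)
  show ?case using assms(2)
  proof induction
    case (monomial d l)
    have "(\<lambda>a. c * character k a * (d * character l a)) = (\<lambda>a. (c * d) * character (\<lambda>i. k i + l i) a)"
      by (simp add: character_add mult_ac)
    then show ?case by (simp only: trig_poly.monomial)
  next
    case (add f g)
    then show ?case using trig_poly.add by (simp add: distrib_left)
  qed
next
  case (add f g)
  then show ?case using trig_poly.add by (simp add: distrib_right)
qed

lemma trig_poly_zeta: "trig_poly (\<zeta> i)" and trig_poly_cnj_zeta: "trig_poly (\<lambda>a. cnj (\<zeta> i a))"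
  using monomial[of 1 "\<lambda>j. if j = i then 1 else 0"] monomial[of 1 "\<lambda>j. if j = i then - 1 else 0"]
  by (simp_all add: character_unit character_minus_unit)

lemma trig_poly_Re_zeta: "trig_poly (\<lambda>a. complex_of_real (Re (\<zeta> i a)))"
proof -
  have "trig_poly (\<lambda>a. 1 / 2 * (\<zeta> i a + cnj (\<zeta> i a)))"
    by (intro trig_poly_mult trig_poly_const add trig_poly_zeta trig_poly_cnj_zeta)
  then show ?thesis by (simp add: complex_add_cnj)
qed

lemma trig_poly_Im_zeta: "trig_poly (\<lambda>a. complex_of_real (Im (\<zeta> i a)))"
proof -
  have "trig_poly (\<lambda>a. (1 / (2 * \<i>)) * (\<zeta> i a + (- 1) * cnj (\<zeta> i a)))"
    by (intro trig_poly_mult trig_poly_const add trig_poly_zeta trig_poly_cnj_zeta)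
  moreover have "(1 / (2 * \<i>)) * (\<zeta> i a + (- 1) * cnj (\<zeta> i a)) = of_real (Im (\<zeta> i a))" for a
    by (simp add: complex_eq_iff)
  ultimately show ?thesis by simp
qed

lemma trig_poly_continuous: "trig_poly f \<Longrightarrow> continuous_on UNIV f"
  by (induction rule: trig_poly.induct) (auto intro!: continuous_intros continuous_character)

text \<open>Real Stone-Weierstrass, applied to the real functions whose complexification is a
  trigonometric polynomial. Real and imaginary parts of the \<zeta>_i belong to this algebra and
  separate points.\<close>

lemma trig_poly_dense:
  fixes f :: "'a \<Rightarrow> real"
  assumes "compact (UNIV :: 'a set)" "continuous_on UNIV f" "e > 0"
  obtains g where "trig_poly (\<lambda>a. of_real (g a))" "\<And>a. \<bar>f a - g a\<bar> < e"
proof -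
  let ?R = "{g. trig_poly (\<lambda>a. complex_of_real (g a))}"
  interpret function_ring_on ?R UNIV
  proof (standard, goal_cases)
    case 1
    show ?case by (rule assms(1))
  next
    case (2 f)
    then have "continuous_on UNIV (\<lambda>a. Re (of_real (f a)))"
      by (intro continuous_intros trig_poly_continuous) simp
    then show ?case by simp
  next
    case (3 f g)
    then have "trig_poly (\<lambda>a. of_real (f a) + of_real (g a))" by (intro trig_poly.add) simp_all
    then show ?case by simp
  next
    case (4 f g)
    then have "trig_poly (\<lambda>a. of_real (f a) * of_real (g a))" by (intro trig_poly_mult) simp_all
    then show ?case by simp
  next
    case (5 c)
    show ?case by (simp add: trig_poly_const)
  next
    case (6 x y)
    then obtain i where "\<zeta> i x \<noteq> \<zeta> i y" using eq_iff_zeta by blast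
    then consider "Re (\<zeta> i x) \<noteq> Re (\<zeta> i y)" | "Im (\<zeta> i x) \<noteq> Im (\<zeta> i y)" by (auto simp: complex_eq_iff)
    then show ?case
    proof cases
      case 1
      then show ?thesis using trig_poly_Re_zeta by (intro bexI[of _ "\<lambda>a. Re (\<zeta> i a)"]) auto
    next
      case 2
      then show ?thesis using trig_poly_Im_zeta by (intro bexI[of _ "\<lambda>a. Im (\<zeta> i a)"]) auto
    qed
  qed
  obtain g where "g \<in> ?R" "\<forall>x\<in>UNIV. \<bar>f x - g x\<bar> < e"
    using Stone_Weierstrass_basic[OF assms(2,3)] by blast
  then show ?thesis using that by simp
qed

end

section \<open>Probability measures determined by their Fourier coefficients\<close>

lemma borel_measurable_continuous:
  fixes f :: "'a::topological_space \<Rightarrow> 'b::topological_space"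
  assumes "sets M = sets borel" "continuous_on UNIV f"
  shows "f \<in> borel_measurable M"
  using borel_measurable_continuous_onI[OF assms(2)] measurable_cong_sets[OF assms(1) refl] by blast

lemma integrable_continuous_compact:
  fixes f :: "'a::topological_space \<Rightarrow> 'b::{banach, second_countable_topology}"
  assumes "compact (UNIV :: 'a set)" "prob_space M" "sets M = sets borel" "continuous_on UNIV f"
  shows "integrable M f"
proof -
  interpret prob_space M by fact
  have "bounded (range f)"
    by (rule compact_imp_bounded[OF compact_continuous_image[OF assms(4,1)]])
  then obtain B where "\<And>x. norm (f x) \<le> B" by (auto simp: bounded_iff)
  then show ?thesis
    by (intro integrable_const_bound[where B = B] borel_measurable_continuous[OF assms(3,4)]) auto
qed

text \<open>Equality extends linearly to trigonometric polynomials. Uniform approximation within e/2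
  costs at most e/2 for each of the two probability measures.\<close>

lemma (in torus_manifold) integral_eq_of_characters:
  fixes f :: "'a \<Rightarrow> real"
  assumes comp: "compact (UNIV :: 'a set)"
    and M: "prob_space M" "sets M = sets borel" and N: "prob_space N" "sets N = sets borel"
    and eq: "\<And>k. (LINT a|M. character k a) = (LINT a|N. character k a)"
    and f: "continuous_on UNIV f"
  shows "(LINT a|M. f a) = (LINT a|N. f a)"
proof -
  interpret M: prob_space M by fact
  interpret N: prob_space N by fact
  note iM = integrable_continuous_compact[OF comp M] and iN = integrable_continuous_compact[OF comp N]
  have trig: "(LINT a|M. g a) = (LINT a|N. g a)" if "trig_poly g" for g
    using that
  proof induction
    case (monomial c k)
    then show ?case using eq[of k] by simp
  next
    case (add f g)
    then show ?case
      by (simp add: Bochner_Integration.integral_add iM[OF trig_poly_continuous] iN[OF trig_poly_continuous])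
  qed
  have "\<bar>(LINT a|M. f a) - (LINT a|N. f a)\<bar> \<le> e" if "e > 0" for e
  proof -
    obtain g where g: "trig_poly (\<lambda>a. of_real (g a))" "\<And>a. \<bar>f a - g a\<bar> < e / 2"
      using trig_poly_dense[OF comp f half_gt_zero[OF \<open>e > 0\<close>]] by blast
    have cg: "continuous_on UNIV g"
      using continuous_on_Re[OF trig_poly_continuous[OF g(1)]] by simp
    have "complex_of_real (LINT a|M. g a) = of_real (LINT a|N. g a)"
      using trig[OF g(1)] by simp
    then have eq': "(LINT a|M. g a) = (LINT a|N. g a)" by (simp only: of_real_eq_iff)
    have "\<bar>(LINT a|M. f a) - (LINT a|M. g a)\<bar> \<le> e / 2"
    proof -
      have "\<bar>(LINT a|M. f a) - (LINT a|M. g a)\<bar> = \<bar>LINT a|M. f a - g a\<bar>"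
        using iM[OF f] iM[OF cg] by simp
      also have "\<dots> \<le> (LINT a|M. \<bar>f a - g a\<bar>)" by (rule integral_abs_bound)
      also have "\<dots> \<le> e / 2"
        using iM[OF f] iM[OF cg] g(2) by (intro M.integral_le_const) (auto intro: less_imp_le)
      finally show ?thesis .
    qed
    moreover have "\<bar>(LINT a|N. f a) - (LINT a|N. g a)\<bar> \<le> e / 2"
    proof -
      have "\<bar>(LINT a|N. f a) - (LINT a|N. g a)\<bar> = \<bar>LINT a|N. f a - g a\<bar>"
        using iN[OF f] iN[OF cg] by simp
      also have "\<dots> \<le> (LINT a|N. \<bar>f a - g a\<bar>)" by (rule integral_abs_bound)
      also have "\<dots> \<le> e / 2"
        using iN[OF f] iN[OF cg] g(2) by (intro N.integral_le_const) (auto intro: less_imp_le)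
      finally show ?thesis .
    qed
    ultimately show ?thesis using eq' by linarith
  qed
  then have "\<bar>(LINT a|M. f a) - (LINT a|N. f a)\<bar> \<le> 0" by (rule field_le_epsilon) simp
  then show ?thesis by simp
qed

text \<open>Closed sets generate the Borel sets and are stable under intersection, and their
  indicators are limits of continuous functions. No metric on the manifold is given, so distances
  are measured between images on the torus.\<close>

lemma (in torus_manifold) measure_eq_of_characters:
  assumes comp: "compact (UNIV :: 'a set)"
    and M: "prob_space M" "sets M = sets borel" and N: "prob_space N" "sets N = sets borel"
    and eq: "\<And>k. (LINT a|M. character k a) = (LINT a|N. character k a)"
  shows "M = N"
proof (rule measure_eqI_generator_eq)
  interpret M: prob_space M by fact
  interpret N: prob_space N by fact
  have ct: "continuous_on UNIV (torus_map \<zeta>)"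
    unfolding torus_map_def by (intro continuous_on_vec_lambda continuous_zeta)
  show "Int_stable (Collect (closed :: 'a set \<Rightarrow> bool))" by (auto simp: Int_stable_def)
  show "Collect (closed :: 'a set \<Rightarrow> bool) \<subseteq> Pow UNIV" by simp
  show "sets M = sigma_sets UNIV (Collect closed)" "sets N = sigma_sets UNIV (Collect closed)"
    using M N by (simp_all add: borel_eq_closed)
  show "range (\<lambda>_. UNIV) \<subseteq> Collect (closed :: 'a set \<Rightarrow> bool)" by auto
  show "(\<Union>i::nat. UNIV) = (UNIV :: 'a set)" by simp
  show "emeasure M UNIV \<noteq> \<infinity>" for i :: nat by simp
  fix C :: "'a set" assume "C \<in> Collect closed"
  then have C: "closed C" by simp
  show "emeasure M C = emeasure N C"
  \<comment> \<open>By convention \<open>infdist\<close> to the empty set is 0, and the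
    approximating functions would be constantly 1 there.\<close>
  proof (cases "C = {}")
    case False
    let ?D = "torus_map \<zeta> ` C"
    have D: "closed ?D"
      using closed_Int_compact[OF C comp] continuous_on_subset[OF ct, of C]
      by (intro compact_imp_closed compact_continuous_image) auto
    let ?f = "\<lambda>n a. max 0 (1 - real n * infdist (torus_map \<zeta> a) ?D)"
    have cf: "continuous_on UNIV (?f n)" for n
      by (intro continuous_intros ct)
    have lim: "(\<lambda>n. ?f n a) \<longlonglongrightarrow> indicator C a" for a
    proof (cases "a \<in> C")
      case True
      then have "?f n a = 1" for n by simp
      then show ?thesis using True by simp
    next
      case False
      then have "torus_map \<zeta> a \<notin> ?D" using inj_torus_map by (auto simp: inj_def)
      then have "infdist (torus_map \<zeta> a) ?D \<noteq> 0"
        using in_closed_iff_infdist_zero[OF D] \<open>C \<noteq> {}\<close> by simp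
      then have pos: "infdist (torus_map \<zeta> a) ?D > 0"
        using infdist_nonneg[of "torus_map \<zeta> a" ?D] by linarith
      then obtain k where k: "1 < real k * infdist (torus_map \<zeta> a) ?D"
        using ex_less_of_nat_mult by blast
      have "?f n a = 0" if "n \<ge> k" for n
      proof -
        have "real k * infdist (torus_map \<zeta> a) ?D \<le> real n * infdist (torus_map \<zeta> a) ?D"
          using that pos by (intro mult_right_mono) auto
        then show ?thesis using k by simp
      qed
      then have "\<forall>\<^sub>F n in sequentially. ?f n a = 0" using eventually_sequentially by blast
      then show ?thesis using False by (simp add: tendsto_eventually)
    qed
    have bound: "norm (?f n a) \<le> 1" for n a
      using infdist_nonneg[of "torus_map \<zeta> a" ?D] by simp
    have 1: "(\<lambda>n. LINT a|M. ?f n a) \<longlonglongrightarrow> (LINT a|M. indicator C a)"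
    proof (rule integral_dominated_convergence[where w = "\<lambda>_. 1"])
      show "indicator C \<in> borel_measurable M" using C M by (intro borel_measurable_indicator) simp
      show "?f n \<in> borel_measurable M" for n by (rule borel_measurable_continuous[OF M(2) cf])
    qed (use bound lim in auto)
    have 2: "(\<lambda>n. LINT a|N. ?f n a) \<longlonglongrightarrow> (LINT a|N. indicator C a)"
    proof (rule integral_dominated_convergence[where w = "\<lambda>_. 1"])
      show "indicator C \<in> borel_measurable N" using C N by (intro borel_measurable_indicator) simp
      show "?f n \<in> borel_measurable N" for n by (rule borel_measurable_continuous[OF N(2) cf])
    qed (use bound lim in auto)
    have "(LINT a|M. ?f n a) = (LINT a|N. ?f n a)" for n
      by (rule integral_eq_of_characters[OF comp M N eq cf])
    then have "(LINT a|M. indicator C a) = (LINT a|N. indicator C a :: real)"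
      using 1 2 LIMSEQ_unique by simp
    then have "measure M C = measure N C"
      using C M N by simp
    then show ?thesis by (simp add: M.emeasure_eq_measure N.emeasure_eq_measure)
  qed simp
qed

section \<open>The eigenfunctions along the flow and equidistribution\<close>

text \<open>In a chart the set contains a nonempty open piece, which is not Lebesgue null, and the
  density is positive on it. This full support upgrades almost-everywhere equality of continuous
  functions to equality.\<close>

lemma emeasure_pos_of_smooth_density:
  fixes A :: "('a::t2_space, real ^ 'm) atlas"
  assumes "smooth_atlas UNIV A" "smooth_positive_density A \<mu>" "sets \<mu> = sets borel" "open W" "W \<noteq> {}"
  shows "emeasure \<mu> W > 0"
proof -
  obtain a where a: "a \<in> W" using assms(5) by auto
  have "a \<in> (\<Union>(U, \<phi>)\<in>A. U)" using assms(1) by (simp add: smooth_atlas_def)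
  then obtain U \<phi> where U: "(U, \<phi>) \<in> A" "a \<in> U" by auto
  have opU: "open U" "open (\<phi> ` U)" and hom: "homeomorphism U (\<phi> ` U) \<phi> (inv_into U \<phi>)"
    using assms(1) U(1) by (auto simp: smooth_atlas_def)
  let ?E = "U \<inter> W"
  have opE: "open (\<phi> ` ?E)"
  proof -
    have "openin (top_of_set (\<phi> ` U)) (\<phi> ` ?E)"
      using hom opU assms(4)
      by (intro homeomorphism_imp_open_map[of U "\<phi> ` U" \<phi> "inv_into U \<phi>"]) (auto simp: openin_open)
    then show ?thesis using opU openin_open_trans by blast
  qed
  obtain \<rho> where \<rho>: "smooth_on (\<phi> ` U) \<rho>" "\<And>x. x \<in> \<phi> ` U \<Longrightarrow> \<rho> x > (0::real)"
    "\<And>E. E \<in> sets borel \<Longrightarrow> E \<subseteq> U \<Longrightarrow> emeasure \<mu> E = (\<integral>\<^sup>+x\<in>\<phi> ` E. ennreal (\<rho> x) \<partial>lborel)"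
    using assms(2) U(1) unfolding smooth_positive_density_def by fastforce
  have borE: "?E \<in> sets borel" using opU assms(4) by (intro borel_open open_Int)
  have "emeasure \<mu> ?E \<noteq> 0"
  proof
    assume "emeasure \<mu> ?E = 0"
    then have 0: "(\<integral>\<^sup>+x\<in>\<phi> ` ?E. ennreal (\<rho> x) \<partial>lborel) = 0" using \<rho>(3)[OF borE] by simp
    have "continuous_on (\<phi> ` ?E) \<rho>"
      by (rule continuous_on_subset[OF smooth_on_imp_continuous_on[OF \<rho>(1)]]) auto
    then have "(\<lambda>x. indicator (\<phi> ` ?E) x *\<^sub>R \<rho> x) \<in> borel_measurable borel"
      by (intro borel_measurable_continuous_on_indicator) (use opE in auto)
    then have "(\<lambda>x. ennreal (indicator (\<phi> ` ?E) x *\<^sub>R \<rho> x)) \<in> borel_measurable lborel"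
      by simp
    moreover have "ennreal (indicator (\<phi> ` ?E) x *\<^sub>R \<rho> x) = ennreal (\<rho> x) * indicator (\<phi> ` ?E) x" for x
      by (simp add: indicator_def)
    ultimately have "(\<lambda>x. ennreal (\<rho> x) * indicator (\<phi> ` ?E) x) \<in> borel_measurable lborel"
      by simp
    then have "AE x in lborel. ennreal (\<rho> x) * indicator (\<phi> ` ?E) x = 0"
      using 0 by (simp only: nn_integral_0_iff_AE)
    then have "AE x in lborel. x \<notin> \<phi> ` ?E"
    proof eventually_elim
      case (elim x)
      show ?case
      proof
        assume x: "x \<in> \<phi> ` ?E"
        then have "\<rho> x > 0" by (intro \<rho>(2)) auto
        then show False using elim x by simp
      qed
    qed
    then have "\<phi> ` ?E \<in> null_sets lborel"
      using opE by (subst AE_iff_null_sets) auto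
    then have "negligible (\<phi> ` ?E)"
      by (simp add: negligible_iff_null_sets null_sets_completionI)
    moreover have "\<phi> ` ?E \<noteq> {}" using a U by auto
    ultimately show False using open_not_negligible[OF opE] by simp
  qed
  moreover have "emeasure \<mu> ?E \<le> emeasure \<mu> W"
    using assms by (intro emeasure_mono) auto
  ultimately show ?thesis by (metis gr_zeroI le_zero_eq)
qed

text \<open>The geometric sum stays bounded by 2 / |w - 1|, so division by \<open>n\<close> sends it
  to 0.\<close>

lemma geometric_averages_tendsto_0:
  fixes w :: complex
  assumes "norm w = 1" "w \<noteq> 1"
  shows "(\<lambda>n. (\<Sum>k<n. w ^ k) / of_nat n) \<longlonglongrightarrow> 0"
proof (rule Lim_null_comparison)
  have "norm ((\<Sum>k<n. w ^ k) / of_nat n) \<le> (2 / norm (w - 1)) * (1 / real n)" for n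
  proof -
    have "norm (\<Sum>k<n. w ^ k) = norm (w ^ n - 1) / norm (w - 1)"
      using geometric_sum[OF assms(2), of n] by (simp add: norm_divide)
    also have "norm (w ^ n - 1) \<le> 2"
      using norm_triangle_ineq4[of "w ^ n" 1] assms(1) by (simp add: norm_power)
    finally have "norm (\<Sum>k<n. w ^ k) \<le> 2 / norm (w - 1)"
      by (simp add: divide_right_mono)
    then show ?thesis using divide_right_mono[of _ "2 / norm (w - 1)" "real n"] by (simp add: norm_divide)
  qed
  then show "\<forall>\<^sub>F n in sequentially. norm ((\<Sum>k<n. w ^ k) / of_nat n) \<le> (2 / norm (w - 1)) * (1 / real n)"
    by (intro always_eventually) auto
  show "(\<lambda>n. (2 / norm (w - 1)) * (1 / real n)) \<longlonglongrightarrow> 0"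
    by (rule tendsto_mult_right_zero) (rule lim_1_over_n)
qed

lemma (in torus_manifold) continuous_smooth_flow:
  assumes "smooth_flow A \<Psi>" shows "continuous_on UNIV (\<Psi> t)"
  using continuous_on_compose2[of UNIV "\<lambda>(t, a). \<Psi> t a" UNIV "\<lambda>a. (t, a)"] assms
  by (simp add: smooth_flow_def smooth_map_on_def continuous_on_Pair continuous_on_const continuous_on_id)

section \<open>The given flow as a rotation of the torus\<close>

locale torus_rotation = torus_manifold A \<zeta>
  for A :: "('a::t2_space, real ^ 'm) atlas" and \<zeta> +
  fixes \<Phi> :: "real \<Rightarrow> 'a \<Rightarrow> 'a" and v :: "'a \<Rightarrow> 'a tvec" and \<mu> :: "'a measure" and T :: real
    and \<Omega> :: "'m \<Rightarrow> real"
  assumes compact_manifold: "compact (UNIV :: 'a set)"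
    and flow: "smooth_flow A \<Phi>"
    and field: "smooth_vector_field A v"
    and gen: "generates A v \<Phi>"
    and prob: "prob_space \<mu>"
    and sets_mu: "sets \<mu> = sets borel"
    and density: "smooth_positive_density A \<mu>"
    and ergodic: "ergodic \<mu> (\<Phi> T)"
    and independent: "rationally_independent \<Omega>"
    and koopman: "\<And>i. koopman_generator \<mu> \<Phi> (\<zeta> i) (\<lambda>x. \<i> * \<Omega> i * \<zeta> i x)"
    and basis: "orthonormal_basis_L2 \<mu> (\<lambda>(k :: 'm \<Rightarrow> int) x. \<Prod>i\<in>UNIV. \<zeta> i x powi k i)"
begin

sublocale prob_space \<mu> by (rule prob)

lemma space_mu: "space \<mu> = UNIV"
  using sets_eq_imp_space_eq[OF sets_mu] by simp

lemma measure_pos: "open W \<Longrightarrow> W \<noteq> {} \<Longrightarrow> measure \<mu> W > 0"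
  using emeasure_pos_of_smooth_density[OF atlas density sets_mu, of W] by (simp add: emeasure_eq_measure)

lemma continuous_integrable: 
  fixes f :: "'a \<Rightarrow> 'b::{banach, second_countable_topology}"
  shows "continuous_on UNIV f \<Longrightarrow> integrable \<mu> f"
  by (rule integrable_continuous_compact[OF compact_manifold prob sets_mu])

lemma AE_eq_continuous:
  fixes f g :: "'a \<Rightarrow> 'b::t2_space"
  assumes "continuous_on UNIV f" "continuous_on UNIV g" "AE a in \<mu>. f a = g a"
  shows "f a = g a"
proof (rule ccontr)
  assume neq: "f a \<noteq> g a"
  have op: "open {a. f a \<noteq> g a}" by (intro open_Collect_neq assms)
  then have "{a. f a \<noteq> g a} \<in> sets \<mu>" using sets_mu by auto
  then have "emeasure \<mu> {a. f a \<noteq> g a} = 0"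
    using assms(3) AE_iff_measurable[of "{a. f a \<noteq> g a}" \<mu> "\<lambda>a. f a = g a"] by (simp add: space_mu)
  then have "measure \<mu> {a. f a \<noteq> g a} = 0" by (simp add: measure_def)
  moreover have "measure \<mu> {a. f a \<noteq> g a} > 0" using neq by (intro measure_pos[OF op]) auto
  ultimately show False by simp
qed

lemma continuous_smooth_fun: "smooth_fun A f \<Longrightarrow> continuous_on UNIV f"
  by (simp add: smooth_fun_def smooth_map_on_def)

lemma field_eq: "v a f = velocity A (\<lambda>t. \<Phi> t a) f"
  using gen by (simp add: generates_def)

lemma difference_quotient_tendsto:
  "((\<lambda>t. (\<zeta> i (\<Phi> t a) - \<zeta> i a) /\<^sub>R t) \<longlongrightarrow> Complex (v a (\<lambda>b. Re (\<zeta> i b))) (v a (\<lambda>b. Im (\<zeta> i b)))) (at 0)"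
proof -
  have "((\<lambda>t. (f (\<Phi> t a) - f a) / t) \<longlongrightarrow> v a f) (at 0)" if f: "smooth_fun A f" for f
  proof -
    have "((\<lambda>t. f (\<Phi> t a)) has_real_derivative v a f) (at 0)"
      using smooth_flow_differentiable[OF flow f, of a 0] f
      by (simp add: field_eq velocity_def DERIV_deriv_iff_real_differentiable)
    moreover have "\<Phi> 0 a = a" using flow by (simp add: smooth_flow_def)
    ultimately show ?thesis by (simp add: DERIV_def)
  qed
  from tendsto_Complex[OF this[OF smooth_fun_Re_zeta] this[OF smooth_fun_Im_zeta]]
  have "((\<lambda>t. Complex ((Re (\<zeta> i (\<Phi> t a)) - Re (\<zeta> i a)) / t) ((Im (\<zeta> i (\<Phi> t a)) - Im (\<zeta> i a)) / t))
    \<longlongrightarrow> Complex (v a (\<lambda>b. Re (\<zeta> i b))) (v a (\<lambda>b. Im (\<zeta> i b)))) (at 0)" .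
  moreover have "Complex ((Re z - Re w) / t) ((Im z - Im w) / t) = (z - w) /\<^sub>R t" for z w t
    by (simp add: complex_eq_iff divide_inverse mult.commute)
  ultimately show ?thesis by simp
qed

text \<open>The generator equation only holds in mean square. The difference quotients also converge pointwise, so
  Fatou's lemma identifies the two limits almost everywhere, hence everywhere by continuity and full support.\<close>
lemma field_zeta: "Complex (v a (\<lambda>b. Re (\<zeta> i b))) (v a (\<lambda>b. Im (\<zeta> i b))) = \<i> * \<Omega> i * \<zeta> i a"
proof (rule AE_eq_continuous[where a = a])
  let ?r = "\<lambda>a. Complex (v a (\<lambda>b. Re (\<zeta> i b))) (v a (\<lambda>b. Im (\<zeta> i b)))"
  have cr: "continuous_on UNIV (\<lambda>a. v a (\<lambda>b. Re (\<zeta> i b)))" "continuous_on UNIV (\<lambda>a. v a (\<lambda>b. Im (\<zeta> i b)))"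
    by (intro continuous_smooth_fun smooth_vector_fieldD(2)[OF field] smooth_fun_Re_zeta smooth_fun_Im_zeta)+
  show "continuous_on UNIV ?r"
    unfolding Complex_eq by (intro continuous_intros cr)
  show "continuous_on UNIV (\<lambda>a. \<i> * \<Omega> i * \<zeta> i a)"
    by (intro continuous_intros continuous_zeta)
  let ?t = "\<lambda>n. 1 / real (Suc n)"
  let ?h = "\<lambda>n a. (norm ((\<zeta> i (\<Phi> (?t n) a) - \<zeta> i a) /\<^sub>R ?t n - \<i> * \<Omega> i * \<zeta> i a))\<^sup>2"
  let ?l = "\<lambda>a. (norm (?r a - \<i> * \<Omega> i * \<zeta> i a))\<^sup>2"
  have t: "filterlim ?t (at 0) sequentially"
    unfolding filterlim_at using lim_inverse_n'[THEN LIMSEQ_Suc] by auto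
  have lim: "(\<lambda>n. ?h n a) \<longlonglongrightarrow> ?l a" for a
    by (intro tendsto_intros filterlim_compose[OF difference_quotient_tendsto t])
  have ch: "continuous_on UNIV (?h n)" for n
    by (intro continuous_intros continuous_zeta 
        continuous_on_compose2[OF continuous_zeta[of UNIV] continuous_smooth_flow[OF flow]]) auto
  have mh: "?h n \<in> borel_measurable \<mu>" for n
    by (rule borel_measurable_continuous[OF sets_mu ch])
  have ml: "?l \<in> borel_measurable \<mu>"
    using mh lim by (rule borel_measurable_LIMSEQ_metric)
  have "(\<lambda>n. LINT a|\<mu>. ?h n a) \<longlonglongrightarrow> 0"
    using koopman[of i] unfolding koopman_generator_def by (elim conjE) (erule filterlim_compose[OF _ t])
  then have "(\<lambda>n. ennreal (LINT a|\<mu>. ?h n a)) \<longlonglongrightarrow> ennreal 0"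
    by (rule tendsto_ennrealI)
  moreover have "ennreal (LINT a|\<mu>. ?h n a) = (\<integral>\<^sup>+a. ennreal (?h n a) \<partial>\<mu>)" for n
    by (rule nn_integral_eq_integral[symmetric, OF continuous_integrable[OF ch]]) simp
  ultimately have lim0: "(\<lambda>n. \<integral>\<^sup>+a. ennreal (?h n a) \<partial>\<mu>) \<longlonglongrightarrow> 0" by simp
  have "(\<integral>\<^sup>+a. ennreal (?l a) \<partial>\<mu>) = (\<integral>\<^sup>+a. liminf (\<lambda>n. ennreal (?h n a)) \<partial>\<mu>)"
    by (intro nn_integral_cong lim_imp_Liminf[symmetric] tendsto_ennrealI lim) simp
  also have "\<dots> \<le> liminf (\<lambda>n. \<integral>\<^sup>+a. ennreal (?h n a) \<partial>\<mu>)"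
    by (rule nn_integral_liminf) (rule measurable_compose[OF mh measurable_ennreal])
  also have "\<dots> = 0" by (rule lim_imp_Liminf[OF _ lim0]) simp
  finally have "(\<integral>\<^sup>+a. ennreal (?l a) \<partial>\<mu>) = 0" by simp
  then have "AE a in \<mu>. ennreal (?l a) = 0"
    using nn_integral_0_iff_AE[OF measurable_compose[OF ml measurable_ennreal]] by simp
  then show "AE a in \<mu>. ?r a = \<i> * \<Omega> i * \<zeta> i a"
    by eventually_elim simp
qed

lemma zeta_flow: "\<zeta> i (\<Phi> t a) = cis (t * \<Omega> i) * \<zeta> i a"
proof -
  have "velocity A (\<lambda>t. \<Phi> t a) (\<lambda>b. Re (\<zeta> i b)) = - \<Omega> i * Im (\<zeta> i a)"
    "velocity A (\<lambda>t. \<Phi> t a) (\<lambda>b. Im (\<zeta> i b)) = \<Omega> i * Re (\<zeta> i a)" for a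
    using arg_cong[OF field_zeta[of a i], of Re] arg_cong[OF field_zeta[of a i], of Im]
    unfolding field_eq[symmetric] by simp_all
  then show ?thesis using zeta_flow_of_velocity[OF flow, of i "\<chi> i. \<Omega> i"] by simp
qed

lemma flow_eq: "\<Phi> t = shift (t *\<^sub>R (\<chi> i. \<Omega> i))"
proof
  fix a
  obtain x where x: "cover x = a" by (rule ex_cover)
  have "cover (x + t *\<^sub>R (\<chi> i. \<Omega> i)) = \<Phi> t a"
    unfolding cover_eq_iff zeta_flow by (simp add: x[symmetric] cis_mult add.commute)
  then show "\<Phi> t a = shift (t *\<^sub>R (\<chi> i. \<Omega> i)) a" by (simp add: x[symmetric])
qed

section \<open>Fourier analysis of time averages\<close>

lemma character_flow: "character k (\<Phi> t a) = cis (t * (\<Sum>i\<in>UNIV. of_int (k i) * \<Omega> i)) * character k a"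
proof -
  obtain x where x: "cover x = a" by (rule ex_cover)
  show ?thesis
    by (simp add: flow_eq x[symmetric] character_cover cis_mult distrib_left sum.distrib sum_distrib_left 
        algebra_simps)
qed

text \<open>The character with index 0 is the constant 1, so the mean is the inner product of two
  members of the orthonormal basis.\<close>

lemma integral_character: "(LINT a|\<mu>. character k a) = (if k = (\<lambda>i. 0) then 1 else 0)"
proof -
  have "\<forall>k l. (LINT a|\<mu>. cnj (character k a) * character l a) = (if k = l then 1 else 0)"
    using basis unfolding orthonormal_basis_L2_def character_def by (rule conjunct1[OF conjunct2])
  from this[THEN spec, THEN spec, of "\<lambda>i. 0" k] show ?thesis
    by (simp add: character_0 eq_commute[of k])
qed

text \<open>At a resonance the nonconstant character \<open>character k\<close> would be invariant
  under \<open>\<Phi> T\<close>. Then \<open>?E\<close> is invariant and has positive measure, yet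
  not measure 1, because the disjoint open set \<open>?F\<close> has positive measure too.\<close>

lemma nonresonant:
  fixes k :: "'m \<Rightarrow> int"
  assumes "k \<noteq> (\<lambda>i. 0)"
  shows "cis (T * (\<Sum>i\<in>UNIV. of_int (k i) * \<Omega> i)) \<noteq> 1"
proof
  assume 1: "cis (T * (\<Sum>i\<in>UNIV. of_int (k i) * \<Omega> i)) = 1"
  let ?E = "{a. Re (character k a) > 0}" and ?F = "{a. Re (character k a) < 0}"
  have c: "continuous_on UNIV (\<lambda>a. Re (character k a))"
    by (intro continuous_intros continuous_character)
  have op: "open ?E" "open ?F"
    by (intro open_Collect_less c continuous_on_const)+
  have sets: "?E \<in> sets \<mu>" "?F \<in> sets \<mu>" using op sets_mu by auto
  have "\<Phi> T -` ?E \<inter> space \<mu> = ?E"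
    using 1 by (auto simp: space_mu character_flow)
  then have "measure \<mu> ?E = 0 \<or> measure \<mu> ?E = 1"
    using ergodic sets(1) unfolding ergodic_def by blast
  moreover have "measure \<mu> ?E > 0"
  proof (rule measure_pos[OF op(1)])
    have "cover 0 \<in> ?E" by (simp add: character_cover)
    then show "?E \<noteq> {}" by blast
  qed
  moreover have "measure \<mu> ?F > 0"
  proof (rule measure_pos[OF op(2)])
    obtain i where i: "k i \<noteq> 0" using assms by auto
    \<comment> \<open>Moving the single angle \<open>i\<close> to \<pi> / k_i makes the phase equal
      to \<pi>, so the character takes the value -1.\<close>
    have "(\<Sum>j\<in>UNIV. of_int (k j) * axis i (pi / k i) $ j) = (\<Sum>j\<in>UNIV. if j = i then pi else 0)"
      by (intro sum.cong) (auto simp: axis_def i)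
    then have "character k (cover (axis i (pi / k i))) = cis pi"
      unfolding character_cover by simp
    then have "cover (axis i (pi / k i)) \<in> ?F" by simp
    then show "?F \<noteq> {}" by blast
  qed
  moreover have "measure \<mu> (?E \<union> ?F) = measure \<mu> ?E + measure \<mu> ?F"
    using sets by (intro finite_measure_Union) auto
  ultimately show False using prob_le_1[of "?E \<union> ?F"] by linarith
qed

lemma Birkhoff_trig_poly:
  assumes "trig_poly f"
  shows "(\<lambda>s. (\<Sum>k<s. f (\<Phi> (- (real k * T)) a)) / of_nat s) \<longlonglongrightarrow> (LINT a|\<mu>. f a)"
  using assms
proof induction
  case (monomial c k)
  let ?w = "cis (- (T * (\<Sum>i\<in>UNIV. of_int (k i) * \<Omega> i)))"
  have "cis (- (real n * T) * (\<Sum>i\<in>UNIV. of_int (k i) * \<Omega> i)) = ?w ^ n" for n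
    unfolding Complex.DeMoivre by (simp add: mult.assoc)
  then have eq: "(\<Sum>n<s. c * character k (\<Phi> (- (real n * T)) a)) / of_nat s 
      = c * character k a * ((\<Sum>n<s. ?w ^ n) / of_nat s)" for s
    by (simp add: character_flow sum_distrib_left sum_divide_distrib mult_ac)
  show ?case
  proof (cases "k = (\<lambda>i. 0)")
    case True
    \<comment> \<open>The average of the constant 1 is 1 from \<open>s = 1\<close> on; at
      \<open>s = 0\<close> it is 0 by the convention on division.\<close>
    have "(\<lambda>s. c * character k a * ((\<Sum>n<s. ?w ^ n) / of_nat s)) \<longlonglongrightarrow> c"
      by (rule tendsto_eventually, rule eventually_sequentiallyI[of 1]) (simp add: True character_0)
    then show ?thesis unfolding eq using integral_character[of k] True by simp
  next
    case False
    \<comment> \<open>Averaging runs backward in time, so the ratio of the geometric sum is the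
      conjugate of the multiplier in \<open>nonresonant\<close>.\<close>
    have "?w = cnj (cis (T * (\<Sum>i\<in>UNIV. of_int (k i) * \<Omega> i)))" by (simp add: cis_cnj)
    then have "?w \<noteq> 1" using nonresonant[OF False] by (metis complex_cnj_cnj complex_cnj_one)
    then have "(\<lambda>s. c * character k a * ((\<Sum>n<s. ?w ^ n) / of_nat s)) \<longlonglongrightarrow> 0"
      by (intro tendsto_mult_right_zero geometric_averages_tendsto_0) simp_all
    then show ?thesis unfolding eq using integral_character[of k] False by simp
  qed
next
  case (add f g)
  then have "(\<lambda>s. (\<Sum>k<s. f (\<Phi> (- (real k * T)) a)) / of_nat s + (\<Sum>k<s. g (\<Phi> (- (real k * T)) a)) / of_nat s)
    \<longlonglongrightarrow> (LINT a|\<mu>. f a) + (LINT a|\<mu>. g a)" by (intro tendsto_add)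
  moreover have "(LINT a|\<mu>. f a + g a) = (LINT a|\<mu>. f a) + (LINT a|\<mu>. g a)"
    by (intro Bochner_Integration.integral_add continuous_integrable trig_poly_continuous add.hyps)
  ultimately show ?case by (simp add: sum.distrib add_divide_distrib)
qed

text \<open>Replacing \<open>f\<close> by a trigonometric polynomial within e/3 moves the integral
  and every average along the orbit by at most e/3, uniformly in the length. Hence convergence at
  every point and not merely almost everywhere.\<close>

lemma Birkhoff_continuous:
  fixes f :: "'a \<Rightarrow> real"
  assumes "continuous_on UNIV f"
  shows "(\<lambda>s. (\<Sum>k<s. f (\<Phi> (- (real k * T)) a)) / real s) \<longlonglongrightarrow> (LINT a|\<mu>. f a)"
proof (rule LIMSEQ_I)
  fix e :: real assume "e > 0"
  then have e3: "e / 3 > 0" by simp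
  obtain g where g: "trig_poly (\<lambda>a. of_real (g a))" "\<And>a. \<bar>f a - g a\<bar> < e / 3"
    using trig_poly_dense[OF compact_manifold assms e3] by blast
  have cg: "continuous_on UNIV g"
    using continuous_on_Re[OF trig_poly_continuous[OF g(1)]] by simp
  let ?A = "\<lambda>f s. (\<Sum>k<s. f (\<Phi> (- (real k * T)) a)) / real s"
  have "(\<lambda>s. complex_of_real (?A g s)) \<longlonglongrightarrow> of_real (LINT a|\<mu>. g a)"
    using Birkhoff_trig_poly[OF g(1), of a] by simp
  then have "(\<lambda>s. ?A g s) \<longlonglongrightarrow> (LINT a|\<mu>. g a)" by (simp only: tendsto_of_real_iff)
  from LIMSEQ_D[OF this e3] obtain N where N: "\<And>s. s \<ge> N \<Longrightarrow> norm (?A g s - (LINT a|\<mu>. g a)) < e / 3"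
    by blast
  have fg: "\<bar>(LINT a|\<mu>. f a) - (LINT a|\<mu>. g a)\<bar> \<le> e / 3"
  proof -
    have "\<bar>(LINT a|\<mu>. f a) - (LINT a|\<mu>. g a)\<bar> = \<bar>LINT a|\<mu>. f a - g a\<bar>"
      using continuous_integrable[OF assms] continuous_integrable[OF cg] by simp
    also have "\<dots> \<le> (LINT a|\<mu>. \<bar>f a - g a\<bar>)" by (rule integral_abs_bound)
    also have "\<dots> \<le> e / 3"
      using continuous_integrable[OF assms] continuous_integrable[OF cg] g(2) 
      by (intro integral_le_const) (auto intro: less_imp_le)
    finally show ?thesis .
  qed
  have Afg: "\<bar>?A f s - ?A g s\<bar> \<le> e / 3" for s
  proof -
    have "\<bar>?A f s - ?A g s\<bar> = \<bar>\<Sum>k<s. f (\<Phi> (- (real k * T)) a) - g (\<Phi> (- (real k * T)) a)\<bar> / real s"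
      by (simp add: sum_subtractf diff_divide_distrib[symmetric])
    also have "\<bar>\<Sum>k<s. f (\<Phi> (- (real k * T)) a) - g (\<Phi> (- (real k * T)) a)\<bar> \<le> (\<Sum>k<s. e / 3)"
      using g(2) by (intro order_trans[OF sum_abs] sum_mono) (auto intro: less_imp_le)
    also have "(\<Sum>k<s. e / 3) / real s \<le> e / 3" using \<open>e > 0\<close> by simp
    finally show ?thesis by (simp add: divide_right_mono)
  qed
  have "norm (?A f s - (LINT a|\<mu>. f a)) < e" if "s \<ge> N" for s
  proof -
    have triangle: "\<bar>p - q\<bar> < e" if "\<bar>q - r\<bar> \<le> e / 3" "\<bar>p - t\<bar> \<le> e / 3" "\<bar>t - r\<bar> < e / 3" for p q r t :: real
      using that by linarith
    show ?thesis
      unfolding real_norm_def 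
      by (rule triangle[OF fg Afg N[OF that, unfolded real_norm_def]])
  qed
  then show "\<exists>N. \<forall>s\<ge>N. norm (?A f s - (LINT a|\<mu>. f a)) < e" by blast
qed

end

section \<open>The invariant measure in angle coordinates\<close>

lemma integral_lborel_prod_vec:
  fixes f :: "'n::finite \<Rightarrow> real \<Rightarrow> complex"
  assumes int: "\<And>i. integrable lborel (f i)"
  shows "(LINT x|(lborel :: (real ^ 'n) measure). (\<Prod>i\<in>UNIV. f i (x $ i))) = (\<Prod>i\<in>UNIV. LINT t|lborel. f i t)"
proof -
  interpret product_sigma_finite "\<lambda>_ :: real ^ 'n. lborel :: real measure" ..
  have m: "f i \<in> borel_measurable borel" for i using borel_measurable_integrable[OF int[of i]] by simp
  let ?g = "\<lambda>b :: real ^ 'n. f (axis_index b)"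
  have ax: "axis_index (axis i (1::real)) = i" for i :: 'n
    by (rule axis_index_axis)
  have coord: "((\<Sum>b\<in>Basis. x b *\<^sub>R b) :: real ^ 'n) $ i = x (axis i 1)" for x i
  proof -
    have "((\<Sum>b\<in>Basis. x b *\<^sub>R b) :: real ^ 'n) \<bullet> axis i 1 = x (axis i 1)"
      by (rule inner_sum_left_Basis) (simp add: axis_in_Basis_iff)
    then show ?thesis by (simp add: inner_axis)
  qed
  have "(LINT x|(lborel :: (real ^ 'n) measure). (\<Prod>i\<in>UNIV. f i (x $ i))) = 
    (LINT x|(\<Pi>\<^sub>M b\<in>Basis. lborel). (\<Prod>i\<in>UNIV. f i (((\<Sum>b\<in>Basis. x b *\<^sub>R b) :: real ^ 'n) $ i)))"
    by (subst lborel_eq, rule integral_distr) (use m in measurable)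
  also have "\<dots> = (LINT x|(\<Pi>\<^sub>M b\<in>Basis. lborel). (\<Prod>b\<in>Basis. ?g b (x b)))"
    by (simp only: coord prod_Basis_vec ax)
  also have "\<dots> = (\<Prod>b\<in>Basis. LINT t|lborel. ?g b t)"
    by (rule product_integral_prod) (auto intro: int)
  also have "\<dots> = (\<Prod>i\<in>UNIV. LINT t|lborel. f i t)"
    by (simp only: prod_Basis_vec ax)
  finally show ?thesis .
qed

lemma integrable_cis_period: "integrable lborel (\<lambda>t. indicator {-pi..<pi} t *\<^sub>R cis (c * t))"
proof (rule Bochner_Integration.integrable_bound[where f = "\<lambda>t. indicator {-pi..<pi} t :: real"])
  have "(\<lambda>t. cis (c * t)) \<in> borel_measurable borel"
    by (intro borel_measurable_continuous_onI continuous_intros)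
  then show "(\<lambda>t. indicator {-pi..<pi} t *\<^sub>R cis (c * t)) \<in> borel_measurable lborel" by measurable
  show "integrable lborel (\<lambda>t. indicator {-pi..<pi} t :: real)"
    by (rule integrable_real_indicator) auto
qed auto

text \<open>As \<open>k\<close> is an integer, the antiderivative takes the same value at both ends
  of a period. The missing end point is a single point and does not affect the integral.\<close>

lemma integral_cis_period:
  assumes "k \<noteq> (0 :: int)"
  shows "(LINT t|lborel. indicator {-pi..<pi} t *\<^sub>R cis (of_int k * t)) = 0"
proof -
  let ?F = "\<lambda>t. cis (of_int k * t) / (\<i> * of_int k)"
  have der: "(?F has_vector_derivative cis (of_int k * t)) (at t within {-pi..pi})" for t
    unfolding cis_conv_exp using assms
    by (auto intro!: derivative_eq_intros has_vector_derivative_real_field simp: mult_ac)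
  have "((\<lambda>t. cis (of_int k * t)) has_integral (?F pi - ?F (- pi))) {-pi..pi}"
    by (rule fundamental_theorem_of_calculus) (use der in auto)
  moreover have "cis (of_int k * pi) = cis (of_int k * (- pi))"
  proof -
    have "cis (of_int k * pi) = cis pi powi k" "cis (of_int k * (- pi)) = cis (- pi) powi k"
      by (simp_all only: cis_power_int)
    moreover have "cis (- pi) = cis pi" by (simp add: complex_eq_iff)
    ultimately show ?thesis by simp
  qed
  ultimately have "((\<lambda>t. cis (of_int k * t)) has_integral 0) {-pi..pi}" by simp
  then have "((\<lambda>t. if t \<in> {-pi..pi} then cis (of_int k * t) else 0) has_integral 0) UNIV"
    by (simp only: has_integral_restrict_UNIV)
  then have "((\<lambda>t. indicator {-pi..<pi} t *\<^sub>R cis (of_int k * t)) has_integral 0) UNIV"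
    by (rule has_integral_spike_finite[of "{pi}", rotated 2]) (auto simp: indicator_def)
  then show ?thesis
    using has_integral_integral_lborel[OF integrable_cis_period[of "of_int k"]] has_integral_unique by blast
qed

text \<open>A fundamental domain of \<open>cover\<close>: closed on one side and open on the other,
  so that each point of the manifold has exactly one preimage in it.\<close>

definition half_open_box :: "(real ^ 'n) set" where
  "half_open_box = {x. \<forall>i. - pi \<le> x $ i \<and> x $ i < pi}"

lemma half_open_box_borel [measurable]: "half_open_box \<in> sets borel"
proof -
  have "half_open_box = (\<Inter>i. {x :: real ^ 'n. - pi \<le> x $ i} \<inter> {x. x $ i < pi})"
    by (auto simp: half_open_box_def)
  also have "\<dots> \<in> sets borel"
    by (intro sets.finite_INT sets.Int borel_closed borel_open closed_Collect_le open_Collect_less continuous_intros) auto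
  finally show ?thesis .
qed

text \<open>Positive and finite is what normalizing to a probability measure requires; the value (2
  \<pi>)^m is never computed.\<close>

lemma emeasure_half_open_box:
  "0 < emeasure lborel (half_open_box :: (real ^ 'n) set)" "emeasure lborel (half_open_box :: (real ^ 'n) set) < \<infinity>"
proof -
  let ?Q = "half_open_box :: (real ^ 'n) set"
  have "torus_box 0 \<subseteq> ?Q" by (auto simp: torus_box_def half_open_box_def less_imp_le)
  then have le: "emeasure lborel (torus_box 0 :: (real ^ 'n) set) \<le> emeasure lborel ?Q" by (rule emeasure_mono) simp
  have "\<not> negligible (torus_box 0 :: (real ^ 'n) set)"
    by (rule open_not_negligible[OF open_torus_box]) (use mem_torus_box_self in blast)
  then have "emeasure lborel (torus_box 0 :: (real ^ 'n) set) \<noteq> 0"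
    using open_torus_box[of "0 :: real ^ 'n"] null_sets_completionI[of "torus_box (0 :: real ^ 'n)" lborel]
    by (auto simp: negligible_iff_null_sets null_sets_def[of lborel])
  then show "0 < emeasure lborel ?Q" using le by (metis gr_zeroI le_zero_eq)
  have "?Q \<subseteq> cbox (\<chi> i. - pi) (\<chi> i. pi)" by (auto simp: half_open_box_def mem_box_cart less_imp_le)
  then have "emeasure lborel ?Q \<le> emeasure lborel (cbox (\<chi> i. - pi) (\<chi> i. pi) :: (real ^ 'n) set)"
    by (rule emeasure_mono) simp
  also have "\<dots> < \<infinity>" by (rule emeasure_lborel_cbox_finite)
  finally show "emeasure lborel ?Q < \<infinity>" .
qed

section \<open>Lebesgue measure on the fundamental domain, pushed to the manifold\<close>

context torus_rotation
begin

lemma inj_on_cover: "inj_on cover half_open_box"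
proof (rule inj_onI)
  fix x y assume x: "x \<in> half_open_box" and y: "y \<in> half_open_box" and eq: "cover x = cover y"
  have "x $ i = y $ i" for i
  proof (rule cis_eq_imp_eq)
    show "cis (x $ i) = cis (y $ i)" using arg_cong[OF eq, of "\<zeta> i"] by simp
    have "- pi \<le> x $ i" "x $ i < pi" "- pi \<le> y $ i" "y $ i < pi" using x y by (auto simp: half_open_box_def)
    then show "\<bar>x $ i - y $ i\<bar> < 2 * pi" by linarith
  qed
  then show "x = y" by (simp add: vec_eq_iff)
qed

lemma ex_cover_half_open_box: obtains x where "x \<in> half_open_box" "cover x = a"
proof -
  have "\<exists>t. - pi \<le> t \<and> t < pi \<and> \<zeta> i a = cis t" for i
  proof (cases "\<zeta> i a = - 1")
    case True
    then have "\<zeta> i a = cis (- pi)" by (simp add: complex_eq_iff)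
    then show ?thesis using pi_gt_zero by (intro exI[of _ "- pi"]) auto
  next
    case False
    then have "\<zeta> i a \<noteq> - cis 0" by simp
    from unit_eq_cis_near[OF norm_zeta this] obtain t where "0 - pi < t" "t < 0 + pi" "\<zeta> i a = cis t" .
    then show ?thesis by (intro exI[of _ t]) auto
  qed
  then obtain t where t: "\<And>i. - pi \<le> t i \<and> t i < pi \<and> \<zeta> i a = cis (t i)" by metis
  then have "(\<chi> i. t i) \<in> half_open_box" "cover (\<chi> i. t i) = a"
    by (simp_all add: half_open_box_def cover_eq_iff)
  then show ?thesis by (rule that)
qed

lemma measurable_cover [measurable]: "cover \<in> borel_measurable borel"
  by (rule borel_measurable_continuous_onI[OF continuous_cover])

lemma mu_eq: "\<mu> = distr (uniform_measure lborel (half_open_box :: (real ^ 'm) set)) borel cover" (is "_ = ?N")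
proof (rule measure_eq_of_characters[OF compact_manifold prob sets_mu])
  have P: "prob_space (uniform_measure lborel (half_open_box :: (real ^ 'm) set))"
    using emeasure_half_open_box[where 'n = 'm] by (intro prob_space_uniform_measure) auto
  have mc: "cover \<in> measurable (uniform_measure lborel (half_open_box :: (real ^ 'm) set)) borel"
    using measurable_cover measurable_cong_sets[OF sets_uniform_measure refl] by auto
  show N: "prob_space ?N" "sets ?N = sets borel"
    by (auto intro: prob_space.prob_space_distr[OF P mc])
  fix k
  have "(LINT a|?N. character k a) = (LINT x|uniform_measure lborel (half_open_box :: (real ^ 'm) set). character k (cover x))"
    by (rule integral_distr[OF mc borel_measurable_continuous_onI[OF continuous_character]])
  also have "\<dots> = (if k = (\<lambda>i. 0) then 1 else 0)"
  proof (cases "k = (\<lambda>i. 0)")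
    case True
    then show ?thesis using prob_space.prob_space[OF P] by (simp add: character_0)
  next
    case False
    then obtain i where i: "k i \<noteq> 0" by auto
    \<comment> \<open>The indicator of the cube and the character both factor over the coordinates.
      By Fubini a single factor with \<open>k i \<noteq> 0\<close> makes the integral
      vanish.\<close>
    have ind: "indicator half_open_box x *\<^sub>R character k (cover x) = 
      (\<Prod>i\<in>UNIV. indicator {-pi..<pi} (x $ i) *\<^sub>R cis (of_int (k i) * x $ i))" for x
    proof (cases "x \<in> half_open_box")
      case True
      then show ?thesis by (simp add: half_open_box_def character_cover prod_cis)
    next
      case False
      then obtain j where "x $ j \<notin> {-pi..<pi}" by (auto simp: half_open_box_def)
      then have "(\<Prod>i\<in>UNIV. indicator {-pi..<pi} (x $ i) *\<^sub>R cis (of_int (k i) * x $ i)) = 0"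
        by (intro prod_zero bexI[of _ j]) auto
      then show ?thesis using False by simp
    qed
    have "(LINT x|lborel. indicator half_open_box x *\<^sub>R character k (cover x)) = 
      (\<Prod>i\<in>UNIV. LINT t|lborel. indicator {-pi..<pi} t *\<^sub>R cis (of_int (k i) * t))"
      unfolding ind by (rule integral_lborel_prod_vec) (rule integrable_cis_period)
    also have "\<dots> = 0" using integral_cis_period[OF i] by (intro prod_zero bexI[of _ i]) auto
    finally have 0: "(LINT x|lborel. indicator half_open_box x *\<^sub>R character k (cover x)) = 0" .
    let ?c = "measure lborel (half_open_box :: (real ^ 'm) set)"
    have c: "emeasure lborel (half_open_box :: (real ^ 'm) set) = ennreal ?c"
      using emeasure_half_open_box(2)[where 'n = 'm] by (intro emeasure_eq_ennreal_measure) simp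
    have cpos: "?c > 0"
      using emeasure_half_open_box(1)[where 'n = 'm] unfolding c by simp
    have "indicator half_open_box x / emeasure lborel (half_open_box :: (real ^ 'm) set) 
      = ennreal (indicator half_open_box x / ?c)" for x :: "real ^ 'm"
      unfolding c using divide_ennreal[of "indicator half_open_box x" ?c] cpos 
      by (simp only: indicator_pos_le ennreal_indicator)
    then have "(LINT x|uniform_measure lborel (half_open_box :: (real ^ 'm) set). character k (cover x)) = 
      (LINT x|density lborel (\<lambda>x. ennreal (indicator half_open_box x / ?c)). character k (cover x))"
      by (simp add: uniform_measure_def)
    also have "\<dots> = (LINT x|lborel. (indicator half_open_box x / ?c) *\<^sub>R character k (cover x))"
    proof (rule integral_density)
      show "(\<lambda>x. character k (cover x)) \<in> borel_measurable lborel"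
        using measurable_compose[OF measurable_cover borel_measurable_continuous_onI[OF continuous_character[of k]]] by simp
    qed (use cpos in auto)
    also have "\<dots> = (LINT x|lborel. (1 / ?c) *\<^sub>R (indicator half_open_box x *\<^sub>R character k (cover x)))"
      by simp
    also have "\<dots> = 0" by (subst integral_scaleR_right) (simp add: 0)
    finally show ?thesis using False by simp
  qed
  finally show "(LINT a|\<mu>. character k a) = (LINT a|?N. character k a)"
    by (simp add: integral_character)
qed

text \<open>The previous identity with the normalizing volume multiplied out, which is the shape in
  which it meets the change of variables.\<close>

lemma emeasure_mu:
  assumes "E \<in> sets borel"
  shows "emeasure \<mu> E * emeasure lborel (half_open_box :: (real ^ 'm) set) = emeasure lborel (half_open_box \<inter> cover -` E)"
proof -
  have mc: "cover \<in> measurable (uniform_measure lborel (half_open_box :: (real ^ 'm) set)) borel"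
    using measurable_cover measurable_cong_sets[OF sets_uniform_measure refl] by auto
  have pre: "cover -` E \<in> sets borel"
    using measurable_sets[OF measurable_cover assms] by simp
  have "emeasure \<mu> E = emeasure (uniform_measure lborel (half_open_box :: (real ^ 'm) set)) (cover -` E)"
    using assms mc by (subst mu_eq) (simp add: emeasure_distr)
  also have "\<dots> = emeasure lborel (half_open_box \<inter> cover -` E) / emeasure lborel (half_open_box :: (real ^ 'm) set)"
    using pre by (intro emeasure_uniform_measure) auto
  finally show ?thesis
    using emeasure_half_open_box[where 'n = 'm] by (simp add: ennreal_divide_times)
qed

end

section \<open>The Riemannian volume\<close>

lemma continuous_on_det_entries:
  fixes M :: "'b::topological_space \<Rightarrow> real ^ 'n ^ 'n"
  assumes "\<And>i j. continuous_on S (\<lambda>x. M x $ i $ j)"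
  shows "continuous_on S (\<lambda>x. det (M x))"
  unfolding det_def by (intro continuous_intros assms)

text \<open>Along the segment from the identity to \<open>C\<close> the quadratic form stays
  positive, so no matrix on it has a kernel. The determinant cannot vanish and keeps the sign it has
  at the identity.\<close>

lemma det_pos_of_positive_definite:
  fixes C :: "real ^ 'n ^ 'n"
  assumes "\<And>w. w \<noteq> 0 \<Longrightarrow> w \<bullet> (C *v w) > 0"
  shows "det C > 0"
proof (rule ccontr)
  assume neg: "\<not> det C > 0"
  define M where "M t = (1 - t) *\<^sub>R mat 1 + t *\<^sub>R C" for t :: real
  have entries: "M t $ i $ j = (1 - t) * (if i = j then 1 else 0) + t * C $ i $ j" for t i j
    by (simp add: M_def mat_def)
  have "continuous_on {0..1} (\<lambda>t. det (M t))"
    by (intro continuous_on_det_entries) (simp only: entries, intro continuous_intros)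
  moreover have "det (M 1) \<le> 0" "0 \<le> det (M 0)" using neg by (simp_all add: M_def)
  ultimately obtain t where t: "0 \<le> t" "t \<le> 1" "det (M t) = 0"
    using IVT2'[of "\<lambda>t. det (M t)" 1 0 0] by auto
  then have "\<not> invertible (M t)" by (simp add: invertible_det_nz)
  then obtain w where w: "M t *v w = 0" "w \<noteq> 0"
    by (auto simp: invertible_left_inverse matrix_left_invertible_ker)
  have "w \<bullet> (M t *v w) = (1 - t) * (w \<bullet> w) + t * (w \<bullet> (C *v w))"
    by (simp add: M_def matrix_vector_mult_add_rdistrib scaleR_matrix_vector_assoc[symmetric] inner_add_right)
  moreover have "(1 - t) * (w \<bullet> w) + t * (w \<bullet> (C *v w)) > 0"
  proof (cases "t = 0")
    case True
    then show ?thesis using w by simp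
  next
    case False
    then have "t * (w \<bullet> (C *v w)) > 0" using t assms[OF w(2)] by simp
    moreover have "(1 - t) * (w \<bullet> w) \<ge> 0" using t by simp
    ultimately show ?thesis by linarith
  qed
  ultimately show False using w by simp
qed

section \<open>Gram determinants in the charts of the atlas\<close>

context torus_manifold
begin

lemma chart_inv_image: "(U, \<phi>) \<in> A \<Longrightarrow> y \<in> \<phi> ` U \<Longrightarrow> inv_into U \<phi> y \<in> U \<and> \<phi> (inv_into U \<phi> y) = y"
  by (simp add: inv_into_into f_inv_into_f)

text \<open>\<open>K\<close> is the Jacobian of the angles as functions of the chart coordinates. It
  is a right inverse by the chain rule for \<open>lift\<close> followed by \<open>cover\<close>, and
  its columns are the angle components of the coordinate vectors.\<close>

lemma chart_derivative_inverse:
  assumes U: "(U, \<phi>) \<in> A" and x: "cover x \<in> U"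
  obtains K where "matrix (frechet_derivative (\<lambda>x. \<phi> (cover x)) (at x)) ** K = mat 1"
    "\<And>i. coord_vec A U \<phi> i (cover x) = tvec x (\<chi> k. K $ k $ i)"
proof -
  let ?y = "\<phi> (cover x)" and ?N = "\<phi> ` (U \<inter> patch x)"
  let ?l = "\<lambda>y. lift x (inv_into U \<phi> y)"
  have opN: "open ?N" by (rule chart_image_open[OF U open_patch])
  have y: "?y \<in> ?N" using x cover_in_patch by blast
  have lx: "?l ?y = x" by (simp add: chart_inv[OF U x] lift_cover mem_torus_box_self)
  have cl: "cover (?l y) = inv_into U \<phi> y" if "y \<in> ?N" for y
    using that by (auto simp: chart_inv[OF U] patch_lift)
  let ?L = "frechet_derivative ?l (at ?y)" and ?D = "frechet_derivative (\<lambda>x. \<phi> (cover x)) (at x)"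
  have L: "(?l has_derivative ?L) (at ?y)"
    by (rule smooth_on_has_derivative[OF smooth_lift_chart[OF U] y])
  have D: "((\<lambda>x. \<phi> (cover x)) has_derivative ?D) (at (?l ?y))"
    unfolding lx by (rule smooth_on_has_derivative[OF smooth_cover_chart[OF U]]) (use x in simp)
  have "((\<lambda>y. \<phi> (cover (?l y))) has_derivative (\<lambda>w. ?D (?L w))) (at ?y)"
    by (rule has_derivative_compose[OF L D])
  then have "((\<lambda>y. y) has_derivative (\<lambda>w. ?D (?L w))) (at ?y)"
    by (rule has_derivative_transform_within_open[OF _ opN y]) (auto simp: cl chart_inv[OF U])
  then have "(\<lambda>w. ?D (?L w)) = (\<lambda>w. w)" using has_derivative_unique has_derivative_ident by blast
  then have "?D \<circ> ?L = id" by (auto simp: fun_eq_iff)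
  then have "matrix ?D ** matrix ?L = mat 1"
    using matrix_compose[OF has_derivative_linear[OF L] has_derivative_linear[OF D]] by (simp add: matrix_id_mat_1)
  moreover have "coord_vec A U \<phi> i (cover x) = tvec x (\<chi> k. matrix ?L $ k $ i)" for i
  proof -
    let ?c = "\<lambda>t. ?y + t *\<^sub>R axis i (1::real)"
    have "(?c has_derivative (\<lambda>t. t *\<^sub>R axis i 1)) (at 0)" by (auto intro!: derivative_eq_intros)
    then have "((\<lambda>t. ?l (?c t)) has_derivative (\<lambda>t. ?L (t *\<^sub>R axis i 1))) (at 0)"
      by (rule has_derivative_compose[where g = ?l]) (use L in simp)
    then have 1: "((\<lambda>t. ?l (?c t)) has_vector_derivative ?L (axis i 1)) (at 0)"
      by (simp add: has_vector_derivative_def linear_scale[OF has_derivative_linear[OF L]])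
    have "open (?c -` ?N)" by (rule continuous_open_vimage[OF opN]) (intro continuous_intros)
    then have "\<forall>\<^sub>F t in nhds 0. t \<in> ?c -` ?N" by (rule eventually_nhds_in_open) (use y in simp)
    then have 2: "\<forall>\<^sub>F t in nhds 0. inv_into U \<phi> (?c t) = cover (?l (?c t))"
      by eventually_elim (simp add: cl)
    have "velocity A (\<lambda>t. inv_into U \<phi> (?c t)) = tvec x (?L (axis i 1))"
      by (rule velocity_eq_tvec[OF 1 _ 2]) (simp add: lx)
    moreover have "(\<chi> k. matrix ?L $ k $ i) = ?L (axis i 1)" by (simp add: matrix_def vec_eq_iff)
    ultimately show ?thesis by (simp add: coord_vec_def)
  qed
  ultimately show ?thesis by (rule that)
qed

text \<open>The coordinate vector acts as a partial derivative of the function read in the chart.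
  Through the Gram determinant this gives measurability of the volume integrand.\<close>

lemma continuous_on_coord_vec:
  assumes U: "(U, \<phi>) \<in> A" and f: "smooth_fun A f"
  shows "continuous_on (\<phi> ` U) (\<lambda>y. coord_vec A U \<phi> i (inv_into U \<phi> y) f)"
proof -
  have s: "smooth_on (\<phi> ` U) (\<lambda>y. f (inv_into U \<phi> y))" by (rule smooth_fun_chart[OF f U])
  let ?D = "\<lambda>y. frechet_derivative (\<lambda>y. f (inv_into U \<phi> y)) (at y)"
  have "continuous_on (\<phi> ` U) (\<lambda>y. ?D y (axis i 1))"
    by (rule smooth_on_imp_continuous_on[OF smooth_on_frechet_derivative[OF s]])
  then show ?thesis
  proof (rule continuous_on_eq)
    fix y assume y: "y \<in> \<phi> ` U"
    have "((\<lambda>t. f (inv_into U \<phi> (y + t *\<^sub>R axis i 1))) has_real_derivative ?D y (axis i 1)) (at 0)"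
      by (rule has_derivative_imp_has_real_derivative_line) (use smooth_on_has_derivative[OF s y] in simp)
    then show "?D y (axis i 1) = coord_vec A U \<phi> i (inv_into U \<phi> y) f"
      using f chart_inv_image[OF U y] by (simp add: coord_vec_def velocity_def DERIV_imp_deriv)
  qed
qed

definition gram :: "('m \<Rightarrow> 'm \<Rightarrow> real) \<Rightarrow> 'a set \<Rightarrow> ('a \<Rightarrow> real ^ 'm) \<Rightarrow> real ^ 'm \<Rightarrow> real ^ 'm ^ 'm" where
  "gram C U \<phi> y = (\<chi> i j. let a = inv_into U \<phi> y in const_metric C a (coord_vec A U \<phi> i a) (coord_vec A U \<phi> j a))"

lemma continuous_on_gram:
  assumes U: "(U, \<phi>) \<in> A"
  shows "continuous_on (\<phi> ` U) (\<lambda>y. det (gram C U \<phi> y))"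
proof -
  have hom: "continuous_on (\<phi> ` U) (inv_into U \<phi>)" using chart(3)[OF U] by (simp add: homeomorphism_def)
  have z: "continuous_on (\<phi> ` U) (\<lambda>y. \<zeta> k (inv_into U \<phi> y))" for k
    by (rule continuous_on_compose2[OF continuous_zeta[of UNIV] hom]) simp
  have "continuous_on (\<phi> ` U) (\<lambda>y. angle_form k (inv_into U \<phi> y) (coord_vec A U \<phi> i (inv_into U \<phi> y)))" for k i
    unfolding angle_form_def
    by (intro continuous_intros z continuous_on_coord_vec[OF U] smooth_fun_Re_zeta smooth_fun_Im_zeta)
  then show ?thesis
    unfolding gram_def const_metric_def Let_def
    by (intro continuous_on_det_entries) (simp, intro continuous_intros)
qed

text \<open>The Gram matrix in the chart is \<open>transpose K ** ?C ** K\<close>, so the root of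
  its determinant picks up the factor |det K|, which the Jacobian of \<open>\<phi>\<close> after
  \<open>cover\<close> cancels.\<close>

lemma sqrt_det_gram:
  assumes U: "(U, \<phi>) \<in> A" and x: "cover x \<in> U"
  shows "\<bar>det (matrix (frechet_derivative (\<lambda>x. \<phi> (cover x)) (at x)))\<bar> * sqrt (det (gram C U \<phi> (\<phi> (cover x)))) 
    = sqrt (det (\<chi> i j. C i j))"
proof -
  let ?D = "matrix (frechet_derivative (\<lambda>x. \<phi> (cover x)) (at x))" and ?C = "\<chi> i j. C i j"
  obtain K where K: "?D ** K = mat 1" "\<And>i. coord_vec A U \<phi> i (cover x) = tvec x (\<chi> k. K $ k $ i)"
    using chart_derivative_inverse[OF U x] by blast
  have "gram C U \<phi> (\<phi> (cover x)) = transpose K ** ?C ** K"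
  proof -
    have "(\<Sum>k\<in>UNIV. \<Sum>l\<in>UNIV. C k l * K $ k $ i * K $ l $ j) = (\<Sum>l\<in>UNIV. (\<Sum>k\<in>UNIV. K $ k $ i * C k l) * K $ l $ j)" for i j
      by (subst sum.swap) (simp add: sum_distrib_left sum_distrib_right mult_ac)
    then show ?thesis
      by (simp add: gram_def Let_def chart_inv[OF U x] K(2) const_metric_tvec vec_eq_iff matrix_matrix_mult_def transpose_def)
  qed
  then have "det (gram C U \<phi> (\<phi> (cover x))) = (det K)\<^sup>2 * det ?C"
    by (simp add: det_mul power2_eq_square)
  then have "sqrt (det (gram C U \<phi> (\<phi> (cover x)))) = \<bar>det K\<bar> * sqrt (det ?C)"
    by (simp add: real_sqrt_mult)
  moreover have "\<bar>det ?D\<bar> * \<bar>det K\<bar> = 1"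
    using arg_cong[OF K(1), of det] by (simp add: det_mul abs_mult[symmetric])
  ultimately show ?thesis by (simp add: mult.assoc[symmetric])
qed

end

section \<open>The volume of a metric with constant angle components\<close>

context torus_rotation
begin

text \<open>For \<open>E\<close> inside a chart, \<open>\<phi>\<close> after \<open>cover\<close>
  maps the part \<open>?S\<close> of the fundamental domain over \<open>E\<close> bijectively to the
  image of \<open>E\<close>. The volume integral becomes \<open>?d\<close> times the Lebesgue
  measure of \<open>?S\<close>, which is \<open>?c\<close> times the measure of \<open>E\<close>; so
  \<Gamma> is \<open>?d * ?c\<close>.\<close>

lemma riemannian_volume_const_metric:
  assumes pos: "\<And>w :: real ^ 'm. w \<noteq> 0 \<Longrightarrow> (\<Sum>i\<in>UNIV. \<Sum>j\<in>UNIV. C i j * w $ i * w $ j) > 0"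
  shows "\<exists>\<Gamma>>0. riemannian_volume A (const_metric C) (density \<mu> (\<lambda>_. ennreal \<Gamma>))"
proof -
  let ?C = "\<chi> i j. C i j" and ?Q = "half_open_box :: (real ^ 'm) set"
  let ?c = "measure lborel ?Q" and ?d = "sqrt (det (\<chi> i j. C i j))"
  have c: "emeasure lborel ?Q = ennreal ?c"
    using emeasure_half_open_box(2)[where 'n = 'm] by (intro emeasure_eq_ennreal_measure) simp
  have cpos: "?c > 0" using emeasure_half_open_box(1)[where 'n = 'm] unfolding c by simp
  have "w \<bullet> (?C *v w) > 0" if "w \<noteq> 0" for w
  proof -
    have "w \<bullet> (?C *v w) = (\<Sum>i\<in>UNIV. \<Sum>j\<in>UNIV. C i j * w $ i * w $ j)"
      by (simp add: inner_vec_def matrix_vector_mult_def sum_distrib_left mult_ac)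
    then show ?thesis using pos[OF that] by simp
  qed
  then have dpos: "?d > 0" by (simp add: det_pos_of_positive_definite)
  have "riemannian_volume A (const_metric C) (density \<mu> (\<lambda>_. ennreal (?d * ?c)))"
    unfolding riemannian_volume_def
  proof (intro conjI ballI, simp add: sets_mu, clarify)
    fix U \<phi> E assume U: "(U, \<phi>) \<in> A" and E: "E \<in> sets borel" "E \<subseteq> U"
    let ?S = "?Q \<inter> cover -` E" and ?g = "\<lambda>x. \<phi> (cover x)"
    \<comment> \<open>Dividing by \<open>?d\<close> makes this the exact reciprocal of the Jacobian
      of \<open>?g\<close>, as the change of variables requires.\<close>
    let ?h = "\<lambda>y. sqrt (det (gram C U \<phi> y)) / ?d"
    have SU: "cover x \<in> U" if "x \<in> ?S" for x using that E by auto
    have img: "?g ` ?S = \<phi> ` E"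
    proof (intro subset_antisym subsetI)
      fix y assume "y \<in> \<phi> ` E"
      then obtain a where a: "a \<in> E" "y = \<phi> a" by auto
      obtain x where "x \<in> ?Q" "cover x = a" by (rule ex_cover_half_open_box)
      then show "y \<in> ?g ` ?S" using a by (intro image_eqI[of _ _ x]) auto
    qed auto
    have bS: "?S \<in> sets borel"
      using measurable_sets[OF measurable_cover E(1)] by (intro sets.Int half_open_box_borel) simp
    have S_le: "emeasure lborel ?S < \<infinity>"
    proof -
      have "emeasure lborel ?S \<le> emeasure lborel ?Q" by (rule emeasure_mono) auto
      then show ?thesis using emeasure_half_open_box(2)[where 'n = 'm] by (rule le_less_trans)
    qed
    have bE: "\<phi> ` E \<in> sets borel"
    proof -
      have inv: "continuous_on (\<phi> ` U) (inv_into U \<phi>)" using chart(3)[OF U] by (simp add: homeomorphism_def)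
      \<comment> \<open>Forward images under a chart are turned into preimages under its continuous
        inverse, which are Borel.\<close>
      have "inv_into U \<phi> -` E \<inter> \<phi> ` U = \<phi> ` E"
      proof (intro subset_antisym subsetI)
        fix y assume y: "y \<in> inv_into U \<phi> -` E \<inter> \<phi> ` U"
        then have "\<phi> (inv_into U \<phi> y) = y" using chart_inv_image[OF U] by blast
        then show "y \<in> \<phi> ` E" using y by (metis IntD1 image_eqI vimageD)
      next
        fix y assume "y \<in> \<phi> ` E"
        then show "y \<in> inv_into U \<phi> -` E \<inter> \<phi> ` U" using E chart_inv[OF U] by auto
      qed
      then show ?thesis
        using measurable_sets[OF borel_measurable_continuous_on_restrict[OF inv] E(1)] chart(2)[OF U]
        by (simp add: space_restrict_space sets_restrict_space_iff)
    qed
    have ch: "continuous_on (\<phi> ` E) ?h"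
      by (rule continuous_on_subset[of "\<phi> ` U"]) (intro continuous_intros continuous_on_gram U, use E dpos in auto)
    have mh: "(\<lambda>y. indicator (\<phi> ` E) y * ?h y) \<in> borel_measurable borel"
      using borel_measurable_continuous_on_indicator[OF bE ch] by simp
    have one: "\<bar>det (matrix (frechet_derivative ?g (at x)))\<bar> * ?h (?g x) = 1" if "x \<in> ?S" for x
      using sqrt_det_gram[OF U SU[OF that], of C] dpos by simp
    have "(\<integral>\<^sup>+y\<in>?g ` ?S. ennreal (?h y) \<partial>lborel) = emeasure lborel ?S"
    proof (rule nn_integral_image[OF bS S_le])
      show "(?g has_derivative frechet_derivative ?g (at x)) (at x)" if "x \<in> ?S" for x
        by (rule smooth_on_has_derivative[OF smooth_cover_chart[OF U]]) (use SU[OF that] in simp)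
      show "inj_on ?g ?S"
      proof (rule inj_onI)
        fix x y assume x: "x \<in> ?S" and y: "y \<in> ?S" and eq: "?g x = ?g y"
        then have "cover x = cover y" using inj_onD[OF inj_on_chart[OF U] eq SU[OF x] SU[OF y]] by simp
        then show "x = y" using inj_onD[OF inj_on_cover] x y by blast
      qed
      show "0 \<le> ?h y" if y: "y \<in> ?g ` ?S" for y
      proof -
        obtain x where x: "x \<in> ?S" "y = ?g x" using y by blast
        let ?D = "det (matrix (frechet_derivative ?g (at x)))"
        \<comment> \<open>\<open>sqrt\<close> of a negative number is negative here, so the sign of
          \<open>?h\<close> is read off from its product with the absolute Jacobian.\<close>
        have "\<bar>?D\<bar> * ?h y = 1" unfolding x(2) by (rule one[OF x(1)])
        then show ?thesis using mult_nonneg_nonpos[OF abs_ge_zero[of ?D], of "?h y"] by linarith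
      qed
      show "(\<lambda>y. indicator (?g ` ?S) y * ?h y) \<in> borel_measurable borel" unfolding img by (rule mh)
    qed (rule one)
    then have int: "(\<integral>\<^sup>+y. ennreal (?h y) * indicator (\<phi> ` E) y \<partial>lborel) = emeasure lborel ?S" by (simp only: img)
    have "emeasure (density \<mu> (\<lambda>_. ennreal (?d * ?c))) E = ennreal (?d * ?c) * emeasure \<mu> E"
      using E(1) sets_mu by (intro emeasure_density_const) simp
    also have "\<dots> = ennreal ?d * (emeasure \<mu> E * emeasure lborel ?Q)"
      using dpos cpos unfolding c by (simp add: ennreal_mult mult_ac)
    also have "\<dots> = ennreal ?d * emeasure lborel ?S" by (simp only: emeasure_mu[OF E(1)])
    also have "\<dots> = (\<integral>\<^sup>+y. ennreal ?d * (ennreal (?h y) * indicator (\<phi> ` E) y) \<partial>lborel)"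
    proof (subst nn_integral_cmult)
      have "(\<lambda>y. ennreal (?h y) * indicator (\<phi> ` E) y) = (\<lambda>y. ennreal (indicator (\<phi> ` E) y * ?h y))"
        by (auto simp: indicator_def)
      then show "(\<lambda>y. ennreal (?h y) * indicator (\<phi> ` E) y) \<in> borel_measurable lborel"
        using mh by simp
    qed (simp only: int)
    also have "\<dots> = (\<integral>\<^sup>+y\<in>\<phi> ` E. ennreal (sqrt (det (gram C U \<phi> y))) \<partial>lborel)"
    proof (intro nn_integral_cong)
      fix y
      have "ennreal ?d * ennreal (?h y) = ennreal (sqrt (det (gram C U \<phi> y)))"
        using dpos by (subst ennreal_mult'[symmetric]) simp_all
      then show "ennreal ?d * (ennreal (?h y) * indicator (\<phi> ` E) y) 
        = ennreal (sqrt (det (gram C U \<phi> y))) * indicator (\<phi> ` E) y"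
        by (simp only: mult.assoc[symmetric])
    qed
    finally show "emeasure (density \<mu> (\<lambda>_. ennreal (?d * ?c))) E = 
      (\<integral>\<^sup>+x\<in>\<phi> ` E. ennreal (sqrt (det (\<chi> i j. let a = inv_into U \<phi> x in
        const_metric C a (coord_vec A U \<phi> i a) (coord_vec A U \<phi> j a)))) \<partial>lborel)"
      unfolding gram_def .
  qed
  then show ?thesis using dpos cpos by (intro exI[of _ "?d * ?c"] conjI mult_pos_pos)
qed

end

section \<open>The limit metric\<close>

lemma rationally_independent_nonzero:
  assumes "rationally_independent \<Omega>" shows "\<Omega> i \<noteq> 0"
proof
  assume "\<Omega> i = 0"
  then have "(\<Sum>j\<in>UNIV. of_rat (if j = i then 1 else 0) * \<Omega> j) = 0" by (intro sum.neutral) auto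
  then have "(if i = i then 1 else 0 :: rat) = 0"
    by (rule assms[unfolded rationally_independent_def, THEN spec, THEN mp, THEN spec])
  then show False by simp
qed

section \<open>Frequency fields, their dual forms and their flows\<close>

context torus_manifold
begin

lemma freq_field_cover: "freq_field A \<Omega> \<zeta> i (cover x) = tvec x (\<Omega> i *\<^sub>R axis i 1)"
  using tvec_lincomb[of "\<Omega> i" x "axis i 1" 0 0] by (simp add: freq_field_def angle_field_cover)

lemma smooth_one_form_angle_form: "smooth_one_form A (\<lambda>a u. angle_form i a u / c)"
  unfolding smooth_one_form_def one_form_def
proof (intro conjI allI impI)
  fix a show "linear_tangent A a (\<lambda>u. angle_form i a u / c)"
    using linear_tangent_angle_form[of a i] by (simp add: linear_tangent_def add_divide_distrib)
next
  fix X assume "smooth_vector_field A X"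
  then have "smooth_fun A (\<lambda>a. inverse c * angle_form i a (X a))"
    by (intro smooth_fun_mult smooth_fun_const smooth_fun_angle_form)
  then show "smooth_fun A (\<lambda>a. angle_form i a (X a) / c)" by (simp add: divide_inverse mult.commute)
qed

lemma angle_form_freq_field: "angle_form i a (freq_field A \<Omega> \<zeta> j a) = (if i = j then \<Omega> j else 0)"
proof -
  obtain x where "cover x = a" by (rule ex_cover)
  then show ?thesis using freq_field_cover[of \<Omega> j x] by (auto simp: axis_def)
qed

lemma dual_form_unique:
  assumes nz: "\<And>i. \<Omega> i \<noteq> 0" and l: "linear_tangent A a l"
    and dual: "\<And>j. l (freq_field A \<Omega> \<zeta> j a) = (if i = j then 1 else 0)"
    and u: "u \<in> tangent_space A a"
  shows "l u = angle_form i a u / \<Omega> i"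
proof -
  \<comment> \<open>\<open>linear_tangent\<close> speaks of combinations of two vectors; homogeneity
    is the case with second coefficient 0.\<close>
  have "l (\<lambda>f. \<Omega> j * angle_field A \<zeta> j a f + 0 * angle_field A \<zeta> j a f) = \<Omega> j * l (angle_field A \<zeta> j a) + 0 * l (angle_field A \<zeta> j a)" for j
    using l angle_field_in_tangent_space[of j a] unfolding linear_tangent_def by blast
  then have "\<Omega> j * l (angle_field A \<zeta> j a) = (if i = j then 1 else 0)" for j
    using dual[of j] by (simp add: freq_field_def)
  note * = this
  have "l (angle_field A \<zeta> j a) = (if i = j then 1 / \<Omega> i else 0)" for j
    using *[of j] nz[of j] by (cases "i = j") (auto simp: field_simps)
  then have "l u = (\<Sum>j\<in>UNIV. angle_form j a u * (if i = j then 1 / \<Omega> i else 0))"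
    using linear_tangent_expand[OF l u] by simp
  also have "\<dots> = (\<Sum>j\<in>UNIV. if i = j then angle_form i a u / \<Omega> i else 0)"
    by (intro sum.cong) auto
  finally show ?thesis by simp
qed

lemma generates_shift: "generates A (freq_field A \<Omega> \<zeta> i) (\<lambda>t. shift (t *\<^sub>R (\<Omega> i *\<^sub>R axis i 1)))"
  unfolding generates_def
proof
  fix a
  obtain x where x: "cover x = a" by (rule ex_cover)
  show "freq_field A \<Omega> \<zeta> i a = velocity A (\<lambda>t. shift (t *\<^sub>R (\<Omega> i *\<^sub>R axis i 1)) a)"
    unfolding x[symmetric] freq_field_cover shift_cover by (rule velocity_line[symmetric])
qed

text \<open>Property (i) concerns every smooth flow generated by v_i, so the flow has to be
  identified from its velocity. The values of the \<zeta>_j along an orbit are forced, and they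
  determine the point.\<close>

lemma flow_of_freq_field:
  assumes \<Psi>: "smooth_flow A \<Psi>" and gen: "generates A (freq_field A \<Omega> \<zeta> i) \<Psi>"
  shows "\<Psi> t = shift (t *\<^sub>R (\<Omega> i *\<^sub>R axis i 1))"
proof
  fix a
  let ?w = "\<Omega> i *\<^sub>R axis i 1"
  have vel: "velocity A (\<lambda>t. \<Psi> t (cover x)) = tvec x ?w" for x
    using gen[unfolded generates_def, THEN spec, of "cover x"] by (simp add: freq_field_cover)
  have "velocity A (\<lambda>t. \<Psi> t a) (\<lambda>b. Re (\<zeta> j b)) = - (?w $ j) * Im (\<zeta> j a)"
    "velocity A (\<lambda>t. \<Psi> t a) (\<lambda>b. Im (\<zeta> j b)) = ?w $ j * Re (\<zeta> j a)" for j a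
  proof -
    obtain x where "cover x = a" by (rule ex_cover)
    then show "velocity A (\<lambda>t. \<Psi> t a) (\<lambda>b. Re (\<zeta> j b)) = - (?w $ j) * Im (\<zeta> j a)"
      "velocity A (\<lambda>t. \<Psi> t a) (\<lambda>b. Im (\<zeta> j b)) = ?w $ j * Re (\<zeta> j a)"
      using vel[of x] by (auto simp: tvec_Re_zeta tvec_Im_zeta)
  qed
  then have z: "\<zeta> j (\<Psi> t a) = cis (t * ?w $ j) * \<zeta> j a" for j by (rule zeta_flow_of_velocity[OF \<Psi>])
  obtain x where x: "cover x = a" by (rule ex_cover)
  have "cover (x + t *\<^sub>R ?w) = \<Psi> t a"
    unfolding cover_eq_iff z by (simp add: x[symmetric] cis_mult add.commute mult.assoc)
  then show "\<Psi> t a = shift (t *\<^sub>R ?w) a" by (simp add: x[symmetric])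
qed

definition angle_gram :: "('a \<Rightarrow> real ^ 'd) \<Rightarrow> 'm \<Rightarrow> 'm \<Rightarrow> 'a \<Rightarrow> real" where
  "angle_gram F i j a = induced_metric F a (angle_field A \<zeta> i a) (angle_field A \<zeta> j a)"

lemma pushforward_eucl_tvec:
  "pushforward_eucl F (tvec x w) = (\<Sum>i\<in>UNIV. w $ i *\<^sub>R pushforward_eucl F (angle_field A \<zeta> i (cover x)))"
  using tangent_expand[OF tvec_in_tangent_space, of x w] 
  by (simp add: pushforward_eucl_def vec_eq_iff)

text \<open>Isolates the dependence on the base point in the functions
  \<open>angle_gram F i j\<close>; the components \<open>p\<close> and \<open>q\<close> appear as
  plain numbers.\<close>

lemma induced_metric_tvec:
  "induced_metric F (cover x) (tvec x p) (tvec x q) = (\<Sum>i\<in>UNIV. \<Sum>j\<in>UNIV. p $ i * q $ j * angle_gram F i j (cover x))"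
  by (simp add: induced_metric_def angle_gram_def pushforward_eucl_tvec inner_sum_left inner_sum_right sum_distrib_left mult_ac)
    (subst sum.swap, simp add: mult_ac)

lemma continuous_angle_gram:
  assumes "smooth_fun A F" shows "continuous_on UNIV (angle_gram F i j)"
proof -
  have "continuous_on UNIV (\<lambda>a. angle_field A \<zeta> i a (\<lambda>x. F x $ k))" for i k
  proof -
    have "smooth_fun A (\<lambda>x. F x $ k)" by (rule smooth_fun_linear_compose[OF bounded_linear_vec_nth assms])
    from smooth_fun_angle_field[OF this] show ?thesis by (simp add: smooth_fun_def smooth_map_on_def)
  qed
  then show ?thesis
    unfolding angle_gram_def[abs_def] induced_metric_def pushforward_eucl_def inner_vec_def
    by (simp, intro continuous_intros)
qed

lemma induced_metric_freq_field:
  "induced_metric F a (freq_field A \<Omega> \<zeta> i a) (freq_field A \<Omega> \<zeta> j a) = \<Omega> i * \<Omega> j * angle_gram F i j a"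
proof -
  have "pushforward_eucl F (freq_field A \<Omega> \<zeta> i a) = \<Omega> i *\<^sub>R pushforward_eucl F (angle_field A \<zeta> i a)" for i
    by (simp add: pushforward_eucl_def freq_field_def vec_eq_iff)
  then show ?thesis by (simp add: induced_metric_def angle_gram_def)
qed

end

section \<open>The averaged Gram matrix and the limit of the delay metrics\<close>

context torus_rotation
begin

definition mean_gram :: "('a \<Rightarrow> real ^ 'd) \<Rightarrow> 'm \<Rightarrow> 'm \<Rightarrow> real" where
  "mean_gram F i j = (LINT b|\<mu>. angle_gram F i j b)"

lemma mean_gram_sum:
  assumes "smooth_fun A F"
  shows "(LINT b|\<mu>. (\<Sum>i\<in>UNIV. \<Sum>j\<in>UNIV. p $ i * q $ j * angle_gram F i j b)) = 
    (\<Sum>i\<in>UNIV. \<Sum>j\<in>UNIV. mean_gram F i j * p $ i * q $ j)"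
proof -
  note int = continuous_integrable[OF continuous_angle_gram[OF assms]]
  show ?thesis
    by (simp add: Bochner_Integration.integral_sum int integrable_mult_right mean_gram_def mult_ac)
qed

lemma mean_gram_sym: "mean_gram F i j = mean_gram F j i"
  by (simp add: mean_gram_def angle_gram_def induced_metric_def inner_commute)

text \<open>For fixed \<open>w\<close> the integrand is the induced squared length of the vector
  with constant components \<open>w\<close>. It is positive at each point because \<open>F\<close>
  is injective on tangent spaces, so its integral cannot vanish.\<close>

lemma mean_gram_pos:
  assumes F: "smooth_embedding A F" and w: "w \<noteq> 0"
  shows "(\<Sum>i\<in>UNIV. \<Sum>j\<in>UNIV. mean_gram F i j * w $ i * w $ j) > 0"
proof -
  have sF: "smooth_fun A F" and inj: "\<And>a. inj_on (pushforward_eucl F) (tangent_space A a)"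
    using F by (auto simp: smooth_embedding_def)
  let ?G = "\<lambda>b. \<Sum>i\<in>UNIV. \<Sum>j\<in>UNIV. w $ i * w $ j * angle_gram F i j b"
  have cG: "continuous_on UNIV ?G" by (intro continuous_intros continuous_angle_gram sF)
  have pos: "?G b > 0" for b
  proof -
    obtain x where x: "cover x = b" by (rule ex_cover)
    have "pushforward_eucl F (tvec x w) \<noteq> pushforward_eucl F (tvec x 0)"
    proof
      assume "pushforward_eucl F (tvec x w) = pushforward_eucl F (tvec x 0)"
      then have "tvec x w = tvec x 0" by (rule inj_onD[OF inj]) (rule tvec_in_tangent_space)+
      then have "tvec x w = (\<lambda>f. 0)" using tvec_nonzero_iff[of x 0] by simp
      then show False using w tvec_nonzero_iff by blast
    qed
    then have "pushforward_eucl F (tvec x w) \<noteq> 0" by (simp add: pushforward_eucl_tvec)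
    then have "induced_metric F (cover x) (tvec x w) (tvec x w) > 0" by (simp add: induced_metric_def)
    then show ?thesis unfolding induced_metric_tvec unfolding x .
  qed
  have "(LINT b|\<mu>. ?G b) \<noteq> 0"
  proof
    assume "(LINT b|\<mu>. ?G b) = 0"
    then have "AE b in \<mu>. ?G b = 0"
      using integral_nonneg_eq_0_iff_AE[OF continuous_integrable[OF cG]] pos by (simp add: less_imp_le)
    then have "?G b = 0" for b using AE_eq_continuous[OF cG continuous_on_const] by blast
    then show False using pos by (metis less_irrefl)
  qed
  moreover have "(LINT b|\<mu>. ?G b) \<ge> 0" using pos by (intro integral_nonneg_AE) (simp add: less_imp_le)
  ultimately show ?thesis unfolding mean_gram_sum[OF sF, symmetric] by linarith
qed

lemma delay_metric_tendsto:
  assumes F: "smooth_fun A F" and u: "u \<in> tangent_space A a" and w: "w \<in> tangent_space A a"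
  shows "(\<lambda>s. delay_metric A (induced_metric F) \<Phi> T s a u w) \<longlonglongrightarrow> const_metric (mean_gram F) a u w"
proof -
  obtain x where x: "cover x = a" by (rule ex_cover)
  obtain p q where uw: "u = tvec x p" "w = tvec x q" using u w tangent_space_cover[of x] x by auto
  let ?G = "\<lambda>b. \<Sum>i\<in>UNIV. \<Sum>j\<in>UNIV. p $ i * q $ j * angle_gram F i j b"
  \<comment> \<open>The same \<open>p\<close> and \<open>q\<close> serve along the whole orbit, so
    the delay metric is a time average of one fixed continuous function.\<close>
  have "induced_metric F (\<Phi> t a) (pushforward A (\<Phi> t) u) (pushforward A (\<Phi> t) w) = ?G (\<Phi> t a)" for t
    unfolding uw x[symmetric] flow_eq pushforward_shift shift_cover by (rule induced_metric_tvec)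
  then have "delay_metric A (induced_metric F) \<Phi> T s a u w = (\<Sum>k<s. ?G (\<Phi> (- (real k * T)) a)) / real s" for s
    by (simp add: delay_metric_def)
  moreover have "(\<lambda>s. (\<Sum>k<s. ?G (\<Phi> (- (real k * T)) a)) / real s) \<longlonglongrightarrow> (LINT b|\<mu>. ?G b)"
    by (rule Birkhoff_continuous) (intro continuous_intros continuous_angle_gram F)
  moreover have "(LINT b|\<mu>. ?G b) = const_metric (mean_gram F) a u w"
    unfolding uw x[symmetric] const_metric_tvec by (rule mean_gram_sum[OF F])
  ultimately show ?thesis by simp
qed

text \<open>B_ij is \<Omega>_i \<Omega>_j times the averaged angle Gram matrix, and the dual forms
  are the angle forms divided by the frequencies; the nonzero factors cancel.\<close>

lemma const_metric_freq:
  "const_metric (mean_gram F) a u w = (\<Sum>i\<in>UNIV. \<Sum>j\<in>UNIV.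
    (LINT b|\<mu>. induced_metric F b (freq_field A \<Omega> \<zeta> i b) (freq_field A \<Omega> \<zeta> j b))
      * (angle_form i a u / \<Omega> i) * (angle_form j a w / \<Omega> j))"
  using rationally_independent_nonzero[OF independent]
  by (simp add: const_metric_def induced_metric_freq_field mean_gram_def mult.assoc)

end

theorem theorem16:
  fixes A :: "('a::{t2_space, second_countable_topology}, real ^ 'm) atlas"
    and \<Phi> :: "real \<Rightarrow> 'a \<Rightarrow> 'a"
    and v :: "'a \<Rightarrow> 'a tvec"
    and \<mu> :: "'a measure"
    and T :: real
    and \<Omega> :: "'m \<Rightarrow> real"
    and \<zeta> :: "'m \<Rightarrow> 'a \<Rightarrow> complex"
    and F :: "'a \<Rightarrow> real ^ 'd"
  assumes "smooth_atlas UNIV A"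
    and "compact (UNIV :: 'a set)"
    and "connected (UNIV :: 'a set)"
    and "orientable UNIV A"
    and "smooth_flow A \<Phi>"
    and "smooth_vector_field A v"
    and "generates A v \<Phi>"
    and "prob_space \<mu>"
    and "sets \<mu> = sets borel"
    and "\<And>t. measure_preserving \<mu> (\<Phi> t)"
    and "smooth_positive_density A \<mu>"
    and "T > 0"
    and "ergodic \<mu> (\<Phi> T)"
    and "rationally_independent \<Omega>"
    and "\<And>i. smooth_fun A (\<zeta> i)"
    and "\<And>i. koopman_generator \<mu> \<Phi> (\<zeta> i) (\<lambda>x. \<i> * \<Omega> i * \<zeta> i x)"
    and "\<And>i x. norm (\<zeta> i x) = 1"
    and "orthonormal_basis_L2 \<mu> (\<lambda>(k :: 'm \<Rightarrow> int) x. \<Prod>i\<in>UNIV. \<zeta> i x powi k i)"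
    and "diffeomorphism A torus_atlas UNIV torus (torus_map \<zeta>)"
    and "smooth_embedding A F"
  shows "\<exists>\<beta> gbar.
      (\<forall>i. smooth_one_form A (\<beta> i)) \<and>
      (\<forall>i j a. \<beta> i a (freq_field A \<Omega> \<zeta> j a) = (if i = j then 1 else 0)) \<and>
      (\<forall>\<beta>'. (\<forall>i. one_form A (\<beta>' i)) \<and>
            (\<forall>i j a. \<beta>' i a (freq_field A \<Omega> \<zeta> j a) = (if i = j then 1 else 0)) \<longrightarrow>
            (\<forall>i a. \<forall>u\<in>tangent_space A a. \<beta>' i a u = \<beta> i a u)) \<and>
      (\<forall>a. \<forall>u\<in>tangent_space A a. \<forall>w\<in>tangent_space A a.
         (\<lambda>s. delay_metric A (induced_metric F) \<Phi> T s a u w) \<longlonglongrightarrow> gbar a u w) \<and>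
      riemannian_metric A gbar \<and>
      (\<forall>a. \<forall>u\<in>tangent_space A a. \<forall>w\<in>tangent_space A a.
         gbar a u w = (\<Sum>i\<in>UNIV. \<Sum>j\<in>UNIV.
           (LINT b|\<mu>. induced_metric F b (freq_field A \<Omega> \<zeta> i b) (freq_field A \<Omega> \<zeta> j b))
             * \<beta> i a u * \<beta> j a w)) \<and>
      (\<forall>i. (\<exists>\<Psi>. smooth_flow A \<Psi> \<and> generates A (freq_field A \<Omega> \<zeta> i) \<Psi>) \<and>
           (\<forall>\<Psi>. smooth_flow A \<Psi> \<and> generates A (freq_field A \<Omega> \<zeta> i) \<Psi> \<longrightarrow>
                (\<forall>t. isometry A gbar (\<Psi> t)))) \<and>
      flat_metric A gbar \<and>
      (\<exists>\<Gamma>>0. riemannian_volume A gbar (density \<mu> (\<lambda>_. ennreal \<Gamma>)))"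
proof -
  interpret torus_rotation A \<zeta> \<Phi> v \<mu> T \<Omega>
    by (intro torus_rotation.intro torus_manifold.intro torus_rotation_axioms.intro assms)
  have F: "smooth_fun A F" using assms(20) by (simp add: smooth_embedding_def)
  have nz: "\<Omega> i \<noteq> 0" for i by (rule rationally_independent_nonzero[OF assms(14)])
  note pos = mean_gram_pos[OF assms(20)]
  show ?thesis
  \<comment> \<open>The dual form to v_i = \<Omega>_i \<partial>/\<partial>\<theta>^i is d\<theta>^i
    / \<Omega>_i, and the limit metric has the mean Gram matrix as coefficients.\<close>
  proof (intro exI[of _ "\<lambda>i a u. angle_form i a u / \<Omega> i"] exI[of _ "const_metric (mean_gram F)"] conjI allI impI ballI)
    show "smooth_one_form A (\<lambda>a u. angle_form i a u / \<Omega> i)" for i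
      by (rule smooth_one_form_angle_form)
    show "angle_form i a (freq_field A \<Omega> \<zeta> j a) / \<Omega> i = (if i = j then 1 else 0)" for i j a
      by (simp add: angle_form_freq_field nz)
    show "\<beta>' i a u = angle_form i a u / \<Omega> i"
      if "(\<forall>i. one_form A (\<beta>' i)) \<and> (\<forall>i j a. \<beta>' i a (freq_field A \<Omega> \<zeta> j a) = (if i = j then 1 else 0))"
        "u \<in> tangent_space A a" for \<beta>' i a u
      using that by (intro dual_form_unique nz) (auto simp: one_form_def)
    show "(\<lambda>s. delay_metric A (induced_metric F) \<Phi> T s a u w) \<longlonglongrightarrow> const_metric (mean_gram F) a u w"
      if "u \<in> tangent_space A a" "w \<in> tangent_space A a" for a u w
      by (rule delay_metric_tendsto[OF F that])
    show "riemannian_metric A (const_metric (mean_gram F))"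
      by (rule riemannian_const_metric[OF mean_gram_sym pos])
    show "\<exists>\<Psi>. smooth_flow A \<Psi> \<and> generates A (freq_field A \<Omega> \<zeta> i) \<Psi>" for i
      using smooth_flow_shift generates_shift by blast
    show "isometry A (const_metric (mean_gram F)) (\<Psi> t)"
      if "smooth_flow A \<Psi> \<and> generates A (freq_field A \<Omega> \<zeta> i) \<Psi>" for i \<Psi> t
      using that flow_of_freq_field[of \<Psi> \<Omega> i t] isometry_shift by simp
    show "flat_metric A (const_metric (mean_gram F))" by (rule flat_const_metric)
    show "\<exists>\<Gamma>>0. riemannian_volume A (const_metric (mean_gram F)) (density \<mu> (\<lambda>_. ennreal \<Gamma>))"
      by (rule riemannian_volume_const_metric[OF pos])
  qed (rule const_metric_freq)
qed

end
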